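(* Let $d,m\ge1$ be integers and let $U\subseteq\mathbb{R}^m$ be open and bounded. The characteristic map $$\mathcal{E}_u:C^{0,1}(\overline U,\mathrm{Norm}(d))\to W^{1,q}(U,\mathcal{A}_d(\mathbb{C})),\qquad A\mapsto\Lambda\circ A,$$ is continuous for all $1\le q<\infty$, where $W^{1,q}(U,\mathcal{A}_d(\mathbb{C}))$ carries the metric $\rho_\Delta^{1,q}(f,g)=\|\Delta\circ f-\Delta\circ g\|_{W^{1,q}(U,\mathbb{R}^N)}$ for an Almgren embedding $\Delta:\mathcal{A}_d(\mathbb{C})\to\mathbb{R}^N$.
   Context: $M_d(\mathbb{C})$ is the space of complex $d\times d$ matrices with the Frobenius norm $\|\cdot\|_2$, and $\mathrm{Norm}(d)=\{A\in M_d(\mathbb{C}):A^*A=AA^*\}$. $\mathcal{A}_d(\mathbb{C})$ is the set of unordered $d$-tuples $[z]=[z_1,\dots,z_d]$ of complex numbers with the metric $\mathbf{d}_2([z],[w])=\min_{\sigma\in S_d}(\sum_i|z_i-w_{\sigma(i)}|^2)^{1/2}$, $S_d$ the symmetric group. $\Lambda:\mathrm{Norm}(d)\to\mathcal{A}_d(\mathbb{C})$ sends $A$ to the unordered tuple of its eigenvalues with multiplicity. Almgren embedding: for a unit complex number $\theta$ put $\eta(z)=\mathrm{Re}(\theta z)$ and let $H:\mathcal{A}_d(\mathbb{C})\to\mathbb{R}^d$ send $[z]$ to the array of $\eta(z_1),\dots,\eta(z_d)$ arranged in increasing order. Choose a finite set $\{\eta_1,\dots,\eta_h\}$ of such forms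 (given by unit complex numbers $\theta_1,\dots,\theta_h$) for which there is $\alpha>0$ such that for any $d^2$ complex numbers $z_1,\dots,z_{d^2}$ some $\eta_l$ satisfies $|\eta_l(z_k)|\ge\alpha|z_k|$ for all $k$ (such sets exist). With $H_l$ associated to $\eta_l$, $\Delta([z])=h^{-1/2}(H_1([z]),\dots,H_h([z]))\in\mathbb{R}^N$, $N=dh$, is an Almgren embedding; it is bi-Lipschitz onto its image with $\mathrm{Lip}(\Delta)\le1$. $W^{1,q}(U,\mathbb{R}^N)$ carries the norm $\|f\|_{L^q}+\sum_{i}\|\partial_if\|_{L^q}$, and $W^{1,q}(U,\mathcal{A}_d(\mathbb{C}))=\{f:U\to\mathcal{A}_d(\mathbb{C}):\Delta\circ f\in W^{1,q}(U,\mathbb{R}^N)\}$. $C^{0,1}(\overline U,\mathrm{Norm}(d))$ is the set of $A\in C^{0,1}(\overline U,M_d(\mathbb{C}))$ with values in $\mathrm{Norm}(d)$, with the topology induced by the norm $\sup_{x\in U}\|A(x)\|_2+\sup_{x\ne y\in U}\frac{\|A(x)-A(y)\|_2}{\|x-y\|_2}$. *)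

theory Defs
  imports "HOL-Analysis.Analysis" "HOL-Computational_Algebra.Polynomial"
begin

section \<open>Normal matrices and their spectrum\<close>

definition conj_transpose :: "complex^'d^'d \<Rightarrow> complex^'d^'d" where
  "conj_transpose A = (\<chi> i j. cnj (A $ j $ i))"

definition normal_matrix :: "complex^'d^'d \<Rightarrow> bool" where
  "normal_matrix A \<longleftrightarrow> conj_transpose A ** A = A ** conj_transpose A"

definition charpoly :: "complex^'d^'d \<Rightarrow> complex poly" where
  "charpoly A = det (mat [:0, 1:] - (\<chi> i j. [:A $ i $ j:]))"

(* Unordered d-tuples of complex numbers are multisets of size d. *)
definition eigenvalue_tuple :: "complex^'d^'d \<Rightarrow> complex multiset" where
  "eigenvalue_tuple A = proots (charpoly A)"

section \<open>Almgren embeddings\<close>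

(* Coordinates are indexed by a finite linear order 'd, whose element i has
   position card {..<i} (counted from 0) in the increasing enumeration. *)
definition sorted_form :: "complex \<Rightarrow> complex multiset \<Rightarrow> real^'d::{finite,linorder}" where
  "sorted_form \<theta> M =
     (\<chi> i. sorted_list_of_multiset (image_mset (\<lambda>z. Re (\<theta> * z)) M) ! card {..<i})"

(* R^N with N = d h is real^'d^'h, whose norm is the Euclidean one. Only the
   values on multisets of size d are constrained. *)
definition almgren_embedding ::
    "(complex multiset \<Rightarrow> real^'d::{finite,linorder}^'h) \<Rightarrow> bool" where
  "almgren_embedding \<Delta> \<longleftrightarrow>
     (\<exists>\<theta> :: 'h \<Rightarrow> complex.
        (\<forall>l. norm (\<theta> l) = 1) \<and>
        (\<exists>\<alpha>>0. \<forall>z :: nat \<Rightarrow> complex. \<exists>l. \<forall>k<CARD('d)\<^sup>2.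
            \<bar>Re (\<theta> l * z k)\<bar> \<ge> \<alpha> * norm (z k)) \<and>
        (\<forall>M. size M = CARD('d) \<longrightarrow>
            \<Delta> M = (1 / sqrt (real CARD('h))) *\<^sub>R (\<chi> l. sorted_form (\<theta> l) M)))"

section \<open>Sobolev spaces\<close>

primrec Ck :: "nat \<Rightarrow> (real^'m \<Rightarrow> real) \<Rightarrow> bool" where
  "Ck 0 f \<longleftrightarrow> continuous_on UNIV f"
| "Ck (Suc k) f \<longleftrightarrow> (\<forall>x. f differentiable (at x)) \<and>
     (\<forall>i. Ck k (\<lambda>x. frechet_derivative f (at x) (axis i 1)))"

definition test_functions :: "(real^'m) set \<Rightarrow> (real^'m \<Rightarrow> real) set" where
  "test_functions U = {\<phi>. (\<forall>k. Ck k \<phi>) \<and>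
     compact (closure {x. \<phi> x \<noteq> 0}) \<and> closure {x. \<phi> x \<noteq> 0} \<subseteq> U}"

definition locally_integrable :: "(real^'m) set \<Rightarrow> (real^'m \<Rightarrow> 'b::euclidean_space) \<Rightarrow> bool" where
  "locally_integrable U f \<longleftrightarrow> (\<forall>K. compact K \<and> K \<subseteq> U \<longrightarrow> integrable (lebesgue_on K) f)"

definition has_weak_partial ::
    "(real^'m) set \<Rightarrow> 'm \<Rightarrow> (real^'m \<Rightarrow> 'b::euclidean_space) \<Rightarrow> (real^'m \<Rightarrow> 'b) \<Rightarrow> bool" where
  "has_weak_partial U i f g \<longleftrightarrow>
     locally_integrable U f \<and> locally_integrable U g \<and>
     (\<forall>\<phi>\<in>test_functions U.
        (LINT x|lebesgue_on U. frechet_derivative \<phi> (at x) (axis i 1) *\<^sub>R f x) =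
        - (LINT x|lebesgue_on U. \<phi> x *\<^sub>R g x))"

(* Unique up to a null subset of U when it exists. *)
definition weak_partial ::
    "(real^'m) set \<Rightarrow> 'm \<Rightarrow> (real^'m \<Rightarrow> 'b::euclidean_space) \<Rightarrow> real^'m \<Rightarrow> 'b" where
  "weak_partial U i f = (SOME g. has_weak_partial U i f g)"

definition Lq_space :: "real \<Rightarrow> (real^'m) set \<Rightarrow> (real^'m \<Rightarrow> 'b::euclidean_space) set" where
  "Lq_space q U = {f \<in> borel_measurable (lebesgue_on U).
     integrable (lebesgue_on U) (\<lambda>x. norm (f x) powr q)}"

definition Lq_norm :: "real \<Rightarrow> (real^'m) set \<Rightarrow> (real^'m \<Rightarrow> 'b::euclidean_space) \<Rightarrow> real" where
  "Lq_norm q U f = (LINT x|lebesgue_on U. norm (f x) powr q) powr (1 / q)"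

definition W1q_space :: "real \<Rightarrow> (real^'m) set \<Rightarrow> (real^'m \<Rightarrow> 'b::euclidean_space) set" where
  "W1q_space q U = {f \<in> Lq_space q U. \<forall>i. \<exists>g\<in>Lq_space q U. has_weak_partial U i f g}"

definition W1q_norm :: "real \<Rightarrow> (real^'m) set \<Rightarrow> (real^'m \<Rightarrow> 'b::euclidean_space) \<Rightarrow> real" where
  "W1q_norm q U f = Lq_norm q U f + (\<Sum>i\<in>UNIV. Lq_norm q U (weak_partial U i f))"

definition W1q_tuples ::
    "(complex multiset \<Rightarrow> real^'d::{finite,linorder}^'h) \<Rightarrow> real \<Rightarrow> (real^'m) set
      \<Rightarrow> (real^'m \<Rightarrow> complex multiset) set" where
  "W1q_tuples \<Delta> q U = {f. (\<forall>x\<in>U. size (f x) = CARD('d)) \<and> \<Delta> \<circ> f \<in> W1q_space q U}"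

definition W1q_dist ::
    "(complex multiset \<Rightarrow> real^'d::{finite,linorder}^'h) \<Rightarrow> real \<Rightarrow> (real^'m) set
      \<Rightarrow> (real^'m \<Rightarrow> complex multiset) \<Rightarrow> (real^'m \<Rightarrow> complex multiset) \<Rightarrow> real" where
  "W1q_dist \<Delta> q U f g = W1q_norm q U (\<lambda>x. \<Delta> (f x) - \<Delta> (g x))"

section \<open>Lipschitz families of normal matrices\<close>

(* Functions are total, but only their values on closure U matter. *)
definition C01_normal :: "(real^'m) set \<Rightarrow> (real^'m \<Rightarrow> complex^'d^'d) set" where
  "C01_normal U = {A. (\<exists>L. L-lipschitz_on (closure U) A) \<and> (\<forall>x\<in>closure U. normal_matrix (A x))}"

(* The library norm on complex^'d^'d is the Frobenius norm. *)
definition C01_norm :: "(real^'m) set \<Rightarrow> (real^'m \<Rightarrow> complex^'d^'d) \<Rightarrow> real" where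
  "C01_norm U A = (SUP x\<in>U. norm (A x)) +
     (SUP (x, y)\<in>{(x, y). x \<in> U \<and> y \<in> U \<and> x \<noteq> y}. norm (A x - A y) / norm (x - y))"

end

theory Submission
  imports Defs "HOL-Computational_Algebra.Fundamental_Theorem_Algebra"
begin

text \<open>For normal \<open>A\<close> with eigenvalues \<open>z\<^sub>j\<close>, the numbers \<open>Re (\<theta> z\<^sub>j)\<close> are the eigenvalues of the
  Hermitian matrix \<open>(\<theta> A + (\<theta> A)\<^sup>*) / 2\<close>, so every coordinate of an Almgren embedding is an ordered
  eigenvalue of a Hermitian matrix depending linearly on \<open>A\<close>. By Weyl's inequality it is Lipschitz in \<open>A\<close>,
  hence along a Lipschitz family it is differentiable almost everywhere in each coordinate direction, with
  the classical derivative as weak derivative. At a point where all ordered eigenvalues are differentiable, the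
  derivative of the \<open>k\<close>-th one is \<open>\<langle>v, H' v\<rangle>\<close> for every unit eigenvector \<open>v\<close> of that eigenvalue. If
  \<open>B\<^sub>n \<rightarrow> A\<close> in the Lipschitz norm, then both the matrices and their derivatives converge
  almost everywhere; by compactness of the unit sphere the eigenvectors converge along subsequences,
  so the derivatives of the eigenvalues converge almost everywhere, boundedly, and dominated
  convergence gives convergence in
  \<open>W\<^sup>1\<^sup>,\<^sup>q\<close>.\<close>

section \<open>Normal matrices\<close>

text \<open>The obstacle is multiplicity. Eigenvalues may coincide on a set of positive measure;
  there the ordered eigenvalues are not differentiable functions of the matrix, so no chain rule
  applies, and eigenvectors admit no continuous choice. This is why the derivative formula must hold
  for every unit eigenvector: a limit of eigenvectors of the matrices \<open>B n x\<close> is some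
  eigenvector of \<open>A x\<close>, not a prescribed one. Weak partial derivatives see one
  coordinate direction at a time, so differentiability along parallel lines is enough and total
  differentiability never enters. It is obtained on the line from a Vitali covering and spread to
  Euclidean space by Fubini. The exceptional null sets depend on the family. Continuity is therefore
  tested along a sequence, which leaves countably many null sets to discard. The dominating
  constants come from a Lipschitz bound common to the whole sequence, and they are integrable
  because U is bounded.\<close>

text \<open>Conjugate linear in the first argument. The real inner product \<bullet> on the same
  type is only its real part, which is too weak to express complex orthogonality.\<close>

definition cinner :: "complex^'d \<Rightarrow> complex^'d \<Rightarrow> complex" where
  "cinner u v = (\<Sum>i\<in>UNIV. cnj (u $ i) * v $ i)"

lemma cinner_add_right: "cinner u (v + w) = cinner u v + cinner u w"
  by (simp add: cinner_def algebra_simps sum.distrib)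

lemma cinner_diff_right: "cinner u (v - w) = cinner u v - cinner u w"
  by (simp add: cinner_def algebra_simps sum_subtractf)

lemma cinner_diff_left: "cinner (v - w) u = cinner v u - cinner w u"
  by (simp add: cinner_def algebra_simps sum_subtractf)

lemma cinner_scale_right: "cinner u (c *s v) = c * cinner u v"
  by (simp add: cinner_def sum_distrib_left algebra_simps)

lemma cinner_scale_left: "cinner (c *s u) v = cnj c * cinner u v"
  by (simp add: cinner_def sum_distrib_left algebra_simps)

lemma cinner_zero_right [simp]: "cinner u 0 = 0"
  by (simp add: cinner_def)

lemma cinner_sum_right: "cinner u (\<Sum>k\<in>K. f k) = (\<Sum>k\<in>K. cinner u (f k))"
  by (induction K rule: infinite_finite_induct) (auto simp: cinner_add_right)

lemma cnj_cinner: "cnj (cinner u v) = cinner v u"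
  by (simp add: cinner_def mult.commute)

lemma Re_cinner: "Re (cinner u v) = u \<bullet> v"
  by (simp add: cinner_def inner_vec_def inner_complex_def)

lemma cinner_self: "cinner u u = complex_of_real ((norm u)\<^sup>2)"
proof (rule complex_eqI)
  show "Re (cinner u u) = Re (complex_of_real ((norm u)\<^sup>2))"
    by (simp add: Re_cinner power2_norm_eq_inner)
  have "Im (cinner u u) = - Im (cinner u u)"
    by (metis cnj_cinner cnj.simps(2))
  then show "Im (cinner u u) = Im (complex_of_real ((norm u)\<^sup>2))" by simp
qed

lemma norm_vec_scale: "norm (c *s (u::complex^'d)) = norm c * norm u"
proof -
  have "complex_of_real ((norm (c *s u))\<^sup>2) = complex_of_real ((norm c * norm u)\<^sup>2)"
    unfolding cinner_self [symmetric] cinner_scale_left cinner_scale_right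
    by (simp only: cinner_self power_mult_distrib of_real_mult complex_norm_square mult_ac)
  then have "(norm (c *s u))\<^sup>2 = (norm c * norm u)\<^sup>2" by (metis of_real_eq_iff)
  then show ?thesis by (simp add: power2_eq_iff_nonneg)
qed

text \<open>Multiplying \<open>v\<close> by a phase makes \<open>cinner u v\<close> real and
  nonnegative; the real Cauchy-Schwarz inequality then applies.\<close>

lemma norm_cinner_le: "norm (cinner u v) \<le> norm u * norm v"
proof (cases "cinner u v = 0")
  case False
  let ?c = "cnj (sgn (cinner u v))"
  have nc: "norm ?c = 1" using False by (simp add: norm_sgn)
  have "cinner u (?c *s v) = complex_of_real (norm (cinner u v))"
    using False by (simp add: cinner_scale_right sgn_eq complex_norm_square [symmetric] power2_eq_square
       field_simps)
  then have "norm (cinner u v) = u \<bullet> (?c *s v)"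
    by (metis Re_cinner Re_complex_of_real)
  also have "\<dots> \<le> norm u * norm (?c *s v)" by (rule norm_cauchy_schwarz)
  finally show ?thesis using nc by (simp add: norm_vec_scale)
qed simp

lemma cinner_conj_transpose: "cinner u (A *v w) = cinner (conj_transpose A *v u) w"
proof -
  have "cinner u (A *v w) = (\<Sum>i\<in>UNIV. \<Sum>j\<in>UNIV. cnj (u $ i) * (A $ i $ j * w $ j))"
    by (simp add: cinner_def matrix_vector_mult_def sum_distrib_left)
  also have "\<dots> = (\<Sum>j\<in>UNIV. \<Sum>i\<in>UNIV. cnj (u $ i) * (A $ i $ j * w $ j))"
    by (rule sum.swap)
  also have "\<dots> = cinner (conj_transpose A *v u) w"
    by (simp add: cinner_def matrix_vector_mult_def sum_distrib_left sum_distrib_right conj_transpose_def mult_ac)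
  finally show ?thesis .
qed

text \<open>The Frobenius norm dominates the operator norm: Cauchy-Schwarz on each row, then the sum
  of squares over the rows.\<close>

lemma norm_matrix_vector_le: "norm (A *v (w::complex^'d)) \<le> norm A * norm w"
proof -
  have *: "norm ((A *v w) $ i) \<le> norm (A $ i) * norm w" for i
  proof -
    let ?r = "\<chi> j. cnj (A $ i $ j)"
    have "(A *v w) $ i = cinner ?r w"
      by (simp add: cinner_def matrix_vector_mult_def)
    moreover have "norm ?r = norm (A $ i)" by (simp add: norm_vec_def)
    ultimately show ?thesis using norm_cinner_le [of ?r w] by simp
  qed
  have "norm (A *v w) \<le> L2_set (\<lambda>i. norm (A $ i) * norm w) UNIV"
    unfolding norm_vec_def [of "A *v w"] by (intro L2_set_mono *) auto
  also have "\<dots> = norm A * norm w"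
    by (simp add: norm_vec_def [of A] L2_set_left_distrib)
  finally show ?thesis .
qed

section \<open>The spectral theorem for normal matrices\<close>

text \<open>Linear dependence for indexed families, so that repeated vectors count with
  multiplicity; a repetition \<open>f a = f b\<close> gives the relation with coefficients 1 and
  -1.\<close>

lemma exists_nontrivial_relation:
  fixes f :: "'i \<Rightarrow> complex^'d"
  assumes "finite I" "CARD('d) < card I"
  shows "\<exists>c. (\<exists>i\<in>I. c i \<noteq> 0) \<and> (\<Sum>i\<in>I. c i *s f i) = 0"
proof (cases "inj_on f I")
  case True
  then have "card (f ` I) > CARD('d)" using assms by (simp add: card_image)
  then have "vec.dependent (f ` I)"
    using vec.dependent_biggerset_general [of "f ` I"] vec.dim_subset_UNIV [of "f ` I"]
    by (simp add: vec.dimension_def card_cart_basis)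
  then obtain u where u: "(\<exists>v\<in>f ` I. u v \<noteq> 0)" "(\<Sum>v\<in>f ` I. u v *s v) = 0"
    using vec.dependent_finite [of "f ` I"] assms(1) by auto
  then show ?thesis
    by (intro exI [of _ "u \<circ> f"]) (auto simp: sum.reindex [OF True])
next
  case False
  then obtain a b where ab: "a \<in> I" "b \<in> I" "a \<noteq> b" "f a = f b" by (auto simp: inj_on_def)
  let ?c = "\<lambda>i. if i = a then 1 else if i = b then -1 else (0::complex)"
  have "(\<Sum>i\<in>I. ?c i *s f i) = (\<Sum>i\<in>{a,b}. ?c i *s f i)"
    using ab assms(1) by (intro sum.mono_neutral_right) auto
  also have "\<dots> = 0" using ab by simp
  finally show ?thesis using ab by (intro exI [of _ ?c]) auto
qed

text \<open>The vector p(A) w, evaluated by Horner's scheme, so that matrix powers are never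
  formed.\<close>

definition poly_apply :: "complex^'d^'d \<Rightarrow> complex^'d \<Rightarrow> complex poly \<Rightarrow> complex^'d" where
  "poly_apply A w p = fold_coeffs (\<lambda>c y. c *s w + A *v y) p 0"

lemma poly_apply_0 [simp]: "poly_apply A w 0 = 0"
  by (simp add: poly_apply_def)

lemma poly_apply_pCons [simp]: "poly_apply A w (pCons c p) = c *s w + A *v poly_apply A w p"
  by (cases "c = 0 \<and> p = 0") (auto simp: poly_apply_def)

lemma poly_apply_add: "poly_apply A w (p + q) = poly_apply A w p + poly_apply A w q"
  by (induction p q rule: poly_induct2)
    (simp_all add: matrix_vector_right_distrib vec.scale_left_distrib algebra_simps)

lemma poly_apply_smult: "poly_apply A w (smult c p) = c *s poly_apply A w p"
  by (induction p) (simp_all add: vec.scale_right_distrib matrix_vector_mult_scaleR vector_scalar_commute)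

lemma poly_apply_sum: "poly_apply A w (\<Sum>i\<in>I. f i) = (\<Sum>i\<in>I. poly_apply A w (f i))"
  by (induction I rule: infinite_finite_induct) (auto simp: poly_apply_add)

text \<open>The Krylov vectors w, A w, ..., A^d w are d + 1 vectors in dimension d.\<close>

lemma exists_annihilating_poly: "\<exists>p. p \<noteq> 0 \<and> poly_apply A (w::complex^'d) p = 0"
proof -
  obtain c where c: "\<exists>i\<in>{..CARD('d)}. c i \<noteq> 0"
      "(\<Sum>i\<in>{..CARD('d)}. c i *s poly_apply A w (monom 1 i)) = 0"
    using exists_nontrivial_relation [of "{..CARD('d)}" "\<lambda>i. poly_apply A w (monom 1 i)"] by auto
  let ?p = "\<Sum>i\<le>CARD('d). monom (c i) i"
  have "coeff ?p i = c i" if "i \<le> CARD('d)" for i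
    using that by (simp add: coeff_sum sum.delta if_distrib cong: if_cong)
  then have "?p \<noteq> 0" using c(1) by (metis atMost_iff coeff_0)
  moreover have "poly_apply A w ?p = 0"
    unfolding poly_apply_sum c(2) [symmetric] poly_apply_smult [symmetric] smult_monom by simp
  ultimately show ?thesis by blast
qed

text \<open>Take p of least degree with p(A) w = 0 and split off a root, p = (X - z) q. Minimality
  makes q(A) w nonzero, and A - z annihilates it. It lies in \<open>W\<close> because invariance
  keeps every p(A) w there.\<close>

lemma exists_eigenvector_in_invariant:
  fixes A :: "complex^'d^'d"
  assumes w: "w \<in> W" "w \<noteq> 0" and W: "vec.subspace W" and inv: "\<And>x. x \<in> W \<Longrightarrow> A *v x \<in> W"
  shows "\<exists>u z. u \<in> W \<and> u \<noteq> 0 \<and> A *v u = z *s u"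
proof -
  have inW: "poly_apply A w p \<in> W" for p
    by (induction p) (use w W inv in \<open>auto intro!: vec.subspace_add vec.subspace_scale simp: vec.subspace_0\<close>)
  obtain p where p: "p \<noteq> 0" "poly_apply A w p = 0"
    and min: "\<And>q. q \<noteq> 0 \<Longrightarrow> poly_apply A w q = 0 \<Longrightarrow> degree p \<le> degree q"
    using exists_annihilating_poly [of A w]
      ex_has_least_nat [of "\<lambda>p. p \<noteq> 0 \<and> poly_apply A w p = 0" _ degree] by blast
  have "degree p \<noteq> 0"
  proof
    assume "degree p = 0"
    then obtain c where "p = [:c:]" by (meson degree_eq_zeroE)
    then show False using p w by simp
  qed
  then obtain z where "poly p z = 0"
    using fundamental_theorem_of_algebra [of p] constant_degree [of p] by auto
  then obtain q where q: "p = [:-z, 1:] * q" using poly_eq_0_iff_dvd by (metis dvdE)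
  then have "q \<noteq> 0" using p by auto
  have "degree p = Suc (degree q)" unfolding q using \<open>q \<noteq> 0\<close> by (subst degree_mult_eq) auto
  then have "poly_apply A w q \<noteq> 0" using min [OF \<open>q \<noteq> 0\<close>] by auto
  moreover have "A *v poly_apply A w q = z *s poly_apply A w q"
  proof -
    have "[:-z, 1:] * q = smult (-z) q + pCons 0 q" by (simp add: mult_pCons_left)
    then have "poly_apply A w (smult (-z) q + pCons 0 q) = 0" using p(2) q by metis
    then have "- (z *s poly_apply A w q) + A *v poly_apply A w q = 0"
      unfolding poly_apply_add poly_apply_smult by (simp add: vec.scale_minus_left)
    then show ?thesis by (metis add.commute add_diff_cancel_right' add_uminus_conv_diff eq_iff_diff_eq_0)
  qed
  ultimately show ?thesis using inW by blast
qed


text \<open>The index type is also the dimension, so such a family is automatically a basis: the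
  columns of a unitary matrix.\<close>

definition orthonormal_family :: "('d \<Rightarrow> complex^'d) \<Rightarrow> bool" where
  "orthonormal_family v \<longleftrightarrow> (\<forall>i j. cinner (v i) (v j) = (if i = j then 1 else 0))"

lemma norm_orthonormal_family: "orthonormal_family v \<Longrightarrow> norm (v i) = 1"
  by (metis orthonormal_family_def cinner_self norm_ge_zero of_real_eq_1_iff power2_eq_1_iff
      neg_0_le_iff_le not_one_le_zero)

lemma orthonormal_family_matrix:
  assumes "orthonormal_family v"
  defines "V \<equiv> \<chi> a b. v b $ a"
  shows "conj_transpose V ** V = mat 1" "V ** conj_transpose V = mat 1"
proof -
  show "conj_transpose V ** V = mat 1"
    using assms
    by (simp add: orthonormal_family_def vec_eq_iff matrix_matrix_mult_def conj_transpose_def mat_def cinner_def)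
  then show "V ** conj_transpose V = mat 1" by (rule matrix_left_right_inverse1)
qed

lemma orthonormal_family_expand:
  assumes "orthonormal_family v"
  shows "x = (\<Sum>i\<in>UNIV. cinner (v i) x *s v i)"
proof -
  let ?V = "\<chi> a b. v b $ a"
  have "x = ?V *v (conj_transpose ?V *v x)"
    using orthonormal_family_matrix [OF assms] by (simp add: matrix_vector_mul_assoc)
  also have "\<dots> = (\<Sum>i\<in>UNIV. (conj_transpose ?V *v x) $ i *s v i)"
    by (simp add: vec_eq_iff matrix_vector_mult_def mult.commute)
  also have "\<dots> = (\<Sum>i\<in>UNIV. cinner (v i) x *s v i)"
    by (simp add: matrix_vector_mult_def conj_transpose_def cinner_def)
  finally show ?thesis .
qed

lemma orthonormal_family_parseval:
  assumes "orthonormal_family v"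
  shows "(norm x)\<^sup>2 = (\<Sum>i\<in>UNIV. (norm (cinner (v i) x))\<^sup>2)"
proof -
  have "complex_of_real ((norm x)\<^sup>2) = cinner x (\<Sum>i\<in>UNIV. cinner (v i) x *s v i)"
    using orthonormal_family_expand [OF assms, of x] by (simp add: cinner_self)
  also have "\<dots> = (\<Sum>i\<in>UNIV. complex_of_real ((norm (cinner (v i) x))\<^sup>2))"
    by (simp only: cinner_sum_right cinner_scale_right complex_norm_square cnj_cinner)
  finally show ?thesis unfolding of_real_sum [symmetric] of_real_eq_iff .
qed

lemma conj_transpose_conj_transpose [simp]: "conj_transpose (conj_transpose A) = A"
  by (simp add: conj_transpose_def vec_eq_iff)

text \<open>Normality gives the adjoint of A the same norm as A on every vector. Expanding the
  square of the norm of the difference of both sides then yields 0.\<close>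

lemma normal_eigenvector_adjoint:
  assumes "normal_matrix A" and v: "A *v v = z *s v"
  shows "conj_transpose A *v v = cnj z *s v"
proof -
  let ?B = "conj_transpose A"
  have "cinner (?B *v v) (?B *v v) = cinner v (A *v (?B *v v))"
    using cinner_conj_transpose [of v A "?B *v v"] by simp
  also have "\<dots> = cinner v (?B *v (A *v v))"
    using assms(1) by (simp add: matrix_vector_mul_assoc normal_matrix_def)
  also have "\<dots> = cinner (A *v v) (A *v v)"
    using cinner_conj_transpose [of v ?B "A *v v"] by simp
  finally have 1: "cinner (?B *v v) (?B *v v) = cnj z * z * cinner v v"
    by (simp add: v cinner_scale_left cinner_scale_right)
  have 2: "cinner (?B *v v) v = z * cinner v v"
    using cinner_conj_transpose [of v A v] by (simp add: v cinner_scale_right)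
  then have 3: "cinner v (?B *v v) = cnj z * cinner v v"
    by (metis cnj_cinner complex_cnj_mult)
  let ?w = "?B *v v - cnj z *s v"
  have "cinner ?w ?w = cinner (?B *v v) ?w - z * cinner v ?w"
    by (simp add: cinner_diff_left cinner_scale_left)
  also have "\<dots> = 0"
    by (simp add: cinner_diff_right cinner_scale_right 1 2 3)
  finally have "norm ?w = 0" by (simp add: cinner_self)
  then show ?thesis by simp
qed

text \<open>The eigenvectors found so far are eigenvectors of the adjoint too, so their orthogonal
  complement \<open>W\<close> is invariant under A and contains a further eigenvector as long as it
  is nonzero.\<close>

lemma normal_matrix_orthonormal_eigenvectors:
  fixes A :: "complex^'d^'d"
  assumes "normal_matrix A" "n \<le> CARD('d)"
  shows "\<exists>S. finite S \<and> card S = n \<and> (\<forall>s\<in>S. \<forall>t\<in>S. cinner s t = (if s = t then 1 else 0)) \<and>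
    (\<forall>s\<in>S. \<exists>z. A *v s = z *s s)"
  using assms(2)
proof (induction n)
  case 0
  then show ?case by (intro exI [of _ "{}"]) auto
next
  case (Suc n)
  then obtain S where S: "finite S" "card S = n"
    and on: "\<And>s t. s \<in> S \<Longrightarrow> t \<in> S \<Longrightarrow> cinner s t = (if s = t then 1 else 0)"
    and eig: "\<And>s. s \<in> S \<Longrightarrow> \<exists>z. A *v s = z *s s"
    by (meson Suc_leD)
  define W where "W = {x. \<forall>s\<in>S. cinner s x = 0}"
  have "vec.span S \<noteq> UNIV"
    using vec.dim_le_card [of UNIV S] S Suc.prems by (auto simp: vec.dimension_def card_cart_basis)
  then obtain x where x: "x \<notin> vec.span S" by auto
  \<comment> \<open>One Gram-Schmidt step: removing from \<open>x\<close> its projection on the span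
    of \<open>S\<close> exhibits a nonzero vector of \<open>W\<close>.\<close>
  define w where "w = x - (\<Sum>s\<in>S. cinner s x *s s)"
  have "(\<Sum>s\<in>S. cinner s x *s s) \<in> vec.span S"
    by (intro vec.span_sum vec.span_scale vec.span_base)
  then have "w \<noteq> 0" using x by (auto simp: w_def)
  have "cinner t w = 0" if "t \<in> S" for t
  proof -
    have "(\<Sum>s\<in>S. cinner s x * cinner t s) = (\<Sum>s\<in>S. if t = s then cinner s x else 0)"
      using that on by (intro sum.cong) auto
    then show ?thesis
      using that S(1) by (simp add: w_def cinner_diff_right cinner_sum_right cinner_scale_right)
  qed
  then have "w \<in> W" by (simp add: W_def)
  moreover have "vec.subspace W"
    by (auto simp: W_def vec.subspace_def cinner_add_right cinner_scale_right)
  moreover have "A *v y \<in> W" if "y \<in> W" for y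
  proof -
    have "cinner s (A *v y) = 0" if "s \<in> S" for s
    proof -
      obtain z where "A *v s = z *s s" using eig [OF \<open>s \<in> S\<close>] by blast
      then have "conj_transpose A *v s = cnj z *s s"
        by (rule normal_eigenvector_adjoint [OF assms(1)])
      then show ?thesis
        using \<open>y \<in> W\<close> that by (simp add: cinner_conj_transpose cinner_scale_left W_def)
    qed
    then show ?thesis by (simp add: W_def)
  qed
  ultimately obtain u z where u: "u \<in> W" "u \<noteq> 0" "A *v u = z *s u"
    using exists_eigenvector_in_invariant \<open>w \<noteq> 0\<close> by blast
  define u' where "u' = complex_of_real (1 / norm u) *s u"
  have n1: "cinner u' u' = 1"
    using u(2) by (simp add: cinner_self u'_def norm_vec_scale norm_divide)
  have u'0: "cinner s u' = 0" "cinner u' s = 0" if "s \<in> S" for s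
  proof -
    show "cinner s u' = 0" using u(1) that by (simp add: u'_def cinner_scale_right W_def)
    then show "cinner u' s = 0" by (metis cnj_cinner complex_cnj_zero)
  qed
  have "u' \<notin> S" using n1 u'0 by force
  moreover have "A *v u' = z *s u'"
    by (simp add: u'_def vector_scalar_commute u(3) mult.commute)
  ultimately show ?case
    using S on eig n1 u'0 by (intro exI [of _ "insert u' S"]) auto
qed

lemma normal_matrix_diagonalize:
  fixes A :: "complex^'d^'d"
  assumes "normal_matrix A"
  obtains v z where "orthonormal_family v" "\<And>i. A *v v i = z i *s v i"
proof -
  obtain S where S: "finite S" "card S = CARD('d)"
    "\<And>s t. s \<in> S \<Longrightarrow> t \<in> S \<Longrightarrow> cinner s t = (if s = t then 1 else 0)"
    "\<And>s. s \<in> S \<Longrightarrow> \<exists>z. A *v s = z *s s"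
    using normal_matrix_orthonormal_eigenvectors [OF assms order_refl] by meson
  obtain v :: "'d \<Rightarrow> complex^'d" where v: "bij_betw v UNIV S"
    using S(1,2) by (metis finite_class.finite_UNIV finite_same_card_bij)
  have "orthonormal_family v"
    using v S(3) by (auto simp: orthonormal_family_def bij_betw_def inj_on_def)
  moreover have "\<exists>z. \<forall>i. A *v v i = z i *s v i"
  proof (rule choice, rule allI)
    fix i
    have "v i \<in> S" using v by (auto simp: bij_betw_def)
    then show "\<exists>z. A *v v i = z *s v i" by (rule S(4))
  qed
  ultimately show ?thesis using that by blast
qed

text \<open>With V the unitary matrix of eigenvectors and D diagonal, A V = V D. Read over the
  polynomial ring through the constant embedding \<open>?C\<close>, this becomes (X - A) V = V (X -
  D), and det V cancels from the determinants.\<close>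

lemma eigenvalue_tuple_orthonormal:
  fixes A :: "complex^'d^'d"
  assumes v: "orthonormal_family v" and A: "\<And>i. A *v v i = z i *s v i"
  shows "eigenvalue_tuple A = image_mset z (mset_set UNIV)"
proof -
  define V where "V = (\<chi> a b. v b $ a)"
  let ?C = "\<lambda>M::complex^'d^'d. (\<chi> i j. [:M $ i $ j:])"
  have C_mult: "?C (M ** N) = ?C M ** ?C N" for M N
    by (simp add: vec_eq_iff matrix_matrix_mult_def mult.commute flip: sum_to_poly)
  have C_1: "?C (mat 1) = mat 1" by (simp add: vec_eq_iff mat_def)
  define D :: "complex^'d^'d" where "D = (\<chi> i j. if i = j then z i else 0)"
  have "A ** V = V ** D"
  proof -
    have "(A ** V) $ a $ b = (A *v v b) $ a" for a b
      by (simp add: matrix_matrix_mult_def matrix_vector_mult_def V_def)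
    then show ?thesis
      by (simp add: vec_eq_iff A matrix_matrix_mult_def D_def V_def if_distrib cong: if_cong)
  qed
  note V = orthonormal_family_matrix [OF v, folded V_def]
  have diff: "(M - N) ** P = M ** P - N ** P" "P ** (M - N) = P ** M - P ** N"
    for M N P :: "complex poly^'d^'d"
    by (simp_all add: vec_eq_iff matrix_matrix_mult_def left_diff_distrib right_diff_distrib sum_subtractf)
  let ?X = "mat [:0, 1:] :: complex poly^'d^'d"
  have X: "?C M ** ?X = ?X ** ?C M" for M
    by (simp add: vec_eq_iff matrix_matrix_mult_def mat_def if_distrib [where f = "\<lambda>x. x * _"]
       if_distrib [where f = "\<lambda>x. _ * x"] if_distrib [where f = "smult _"] cong: if_cong)
  have "(?X - ?C A) ** ?C V = ?C V ** (?X - ?C D)"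
    by (simp add: diff X flip: C_mult \<open>A ** V = V ** D\<close>)
  then have "det (?X - ?C A) * det (?C V) = det (?C V) * det (?X - ?C D)"
    using arg_cong [of _ _ det] by (simp only: det_mul [symmetric])
  moreover have "det (?C (conj_transpose V)) * det (?C V) = 1"
    by (simp only: det_mul [symmetric] C_mult [symmetric] V(1) C_1 det_I)
  then have "det (?C V) \<noteq> 0" by auto
  ultimately have "charpoly A = det (?X - ?C D)"
    by (simp add: charpoly_def)
  also have "\<dots> = (\<Prod>i\<in>UNIV. [:- z i, 1:])"
    by (subst det_diagonal) (auto simp: mat_def D_def)
  finally show ?thesis
    by (simp add: eigenvalue_tuple_def proots_prod sum_unfold_sum_mset)
qed

section \<open>Ordered eigenvalues of Hermitian matrices\<close>

text \<open>Sorting is expressed by a permutation of the indices instead of a list, so that an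
  eigenbasis can be rearranged along with its eigenvalues.\<close>

lemma sorted_form_enumerate:
  fixes z :: "'d::{finite,linorder} \<Rightarrow> complex"
  obtains \<pi> :: "'d \<Rightarrow> 'd" where "inj \<pi>" "mono (\<lambda>i. Re (\<theta> * z (\<pi> i)))"
    "\<And>i. sorted_form \<theta> (image_mset z (mset_set UNIV)) $ i = Re (\<theta> * z (\<pi> i))"
proof -
  define f where "f = (\<lambda>i. Re (\<theta> * z i))"
  define ys where "ys = sort_key f (sorted_list_of_set (UNIV :: 'd set))"
  have ys: "set ys = UNIV" "distinct ys" "length ys = CARD('d)" "sorted (map f ys)"
    by (simp_all add: ys_def)
  have "image_mset (\<lambda>w. Re (\<theta> * w)) (image_mset z (mset_set UNIV)) = mset (map f ys)"
    by (simp add: ys_def f_def image_mset.compositionality o_def flip: sorted_list_of_mset_set)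
  then have sl: "sorted_list_of_multiset (image_mset (\<lambda>w. Re (\<theta> * w)) (image_mset z (mset_set UNIV))) = map f ys"
    using ys(4) by (simp only: sorted_list_of_multiset_mset sort_key_id_if_sorted map_ident sorted_sort_id)
  \<comment> \<open>The zero-based position of \<open>i\<close> in the linear order of the index
    type, as in \<open>sorted_form\<close>; it turns list positions into indices.\<close>
  define pos where "pos = (\<lambda>i::'d. card {..<i})"
  have pos_less: "pos i < length ys" for i
    unfolding pos_def ys(3) by (rule psubset_card_mono) auto
  have pos_strict: "strict_mono pos"
    unfolding pos_def by (rule strict_monoI, rule psubset_card_mono) auto
  show ?thesis
  proof (rule that [of "\<lambda>i. ys ! pos i"])
    show "inj (\<lambda>i. ys ! pos i)"
      using ys(2) pos_less strict_mono_eq [OF pos_strict] by (auto simp: inj_on_def nth_eq_iff_index_eq)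
    show "mono (\<lambda>i. Re (\<theta> * z (ys ! pos i)))"
    proof (rule monoI)
      fix i j :: 'd assume "i \<le> j"
      then have "map f ys ! pos i \<le> map f ys ! pos j"
        using pos_less strict_mono_less_eq [OF pos_strict] sorted_nth_mono [OF ys(4), of "pos i" "pos j"] by simp
      then show "Re (\<theta> * z (ys ! pos i)) \<le> Re (\<theta> * z (ys ! pos j))"
        using pos_less by (simp add: f_def)
    qed
    show "sorted_form \<theta> (image_mset z (mset_set UNIV)) $ i = Re (\<theta> * z (ys ! pos i))" for i
      using pos_less [of i] unfolding sorted_form_def sl by (simp add: pos_def f_def)
  qed
qed

text \<open>Only real linear in A because of the conjugation; \<open>linear\<close> and
  \<open>bounded_linear\<close> below refer to real scalars.\<close>

definition herm_part :: "complex \<Rightarrow> complex^'d^'d \<Rightarrow> complex^'d^'d" where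
  "herm_part \<theta> A = (\<chi> i j. (\<theta> * A $ i $ j + cnj (\<theta> * A $ j $ i)) / 2)"

lemma linear_herm_part: "linear (herm_part \<theta>)"
  by (rule linearI) (simp_all add: herm_part_def vec_eq_iff algebra_simps add_divide_distrib
      scaleR_conv_of_real [where ?'a = complex])

lemma bounded_linear_herm_part: "bounded_linear (herm_part \<theta>)"
  using linear_herm_part linear_conv_bounded_linear by blast

text \<open>An eigenvector of a normal matrix is one of its adjoint for the conjugate eigenvalue, so
  the Hermitian part averages \<theta>z and its conjugate.\<close>

lemma herm_part_eigenvector:
  assumes "normal_matrix A" "A *v v = z *s v"
  shows "herm_part \<theta> A *v v = complex_of_real (Re (\<theta> * z)) *s v"
proof -
  have "herm_part \<theta> A *v v = ((1/2) * \<theta>) *s (A *v v) + ((1/2) * cnj \<theta>) *s (conj_transpose A *v v)"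
    by (simp add: herm_part_def matrix_vector_mult_def conj_transpose_def vec_eq_iff sum_distrib_left
      distrib_left distrib_right add_divide_distrib sum.distrib mult_ac)
  also have "\<dots> = ((\<theta> * z + cnj (\<theta> * z)) / 2) *s v"
    unfolding assms(2) normal_eigenvector_adjoint [OF assms]
    by (simp add: vec_eq_iff algebra_simps add_divide_distrib)
  also have "(\<theta> * z + cnj (\<theta> * z)) / 2 = complex_of_real (Re (\<theta> * z))"
    by (simp only: complex_add_cnj) simp
  finally show ?thesis .
qed

text \<open>A relation with the eigenbasis hidden by a quantifier, since no canonical basis exists.
  Real eigenvalues on an orthonormal basis make \<open>H\<close> self-adjoint, so this need not be a
  separate clause.\<close>

definition ordered_eigenvalues :: "complex^'d::{finite,linorder}^'d::{finite,linorder} \<Rightarrow> ('d::{finite,linorder} \<Rightarrow> real) \<Rightarrow> bool" where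
  "ordered_eigenvalues H r \<longleftrightarrow> mono r \<and>
     (\<exists>v. orthonormal_family v \<and> (\<forall>j. H *v v j = complex_of_real (r j) *s v j))"

text \<open>For every \<theta> the Hermitian part has the eigenvectors of A itself; \<theta> affects
  only the order in which they are listed.\<close>

lemma normal_matrix_spectrum:
  fixes A :: "complex^'d::{finite,linorder}^'d::{finite,linorder}"
  assumes "normal_matrix A"
  shows "size (eigenvalue_tuple A) = CARD('d)"
    and "ordered_eigenvalues (herm_part \<theta> A) (\<lambda>j. sorted_form \<theta> (eigenvalue_tuple A) $ j)"
proof -
  obtain v z where v: "orthonormal_family v" "\<And>i. A *v v i = z i *s v i"
    using normal_matrix_diagonalize [OF assms] by metis
  have eig: "eigenvalue_tuple A = image_mset z (mset_set UNIV)"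
    by (rule eigenvalue_tuple_orthonormal [OF v])
  show "size (eigenvalue_tuple A) = CARD('d)" by (simp add: eig)
  obtain \<pi> :: "'d \<Rightarrow> 'd" where \<pi>: "inj \<pi>" "mono (\<lambda>i. Re (\<theta> * z (\<pi> i)))"
    "\<And>i. sorted_form \<theta> (eigenvalue_tuple A) $ i = Re (\<theta> * z (\<pi> i))"
    by (rule sorted_form_enumerate [of \<theta> z, folded eig]) blast
  have "orthonormal_family (v \<circ> \<pi>)"
    using v(1) \<pi>(1) by (auto simp: orthonormal_family_def inj_def)
  moreover have "herm_part \<theta> A *v (v \<circ> \<pi>) j = complex_of_real (Re (\<theta> * z (\<pi> j))) *s (v \<circ> \<pi>) j" for j
    using herm_part_eigenvector [OF assms v(2)] by simp
  ultimately show "ordered_eigenvalues (herm_part \<theta> A) (\<lambda>j. sorted_form \<theta> (eigenvalue_tuple A) $ j)"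
    unfolding ordered_eigenvalues_def \<pi>(3) using \<pi>(2) by blast
qed

section \<open>Weyl's inequality\<close>

lemma orthonormal_eigenbasis_form:
  assumes v: "orthonormal_family v" and H: "\<And>j. H *v v j = complex_of_real (r j) *s v j"
  shows "cinner u (H *v w) = (\<Sum>i\<in>UNIV. complex_of_real (r i) * (cinner u (v i) * cinner (v i) w))"
proof -
  have "H *v w = H *v (\<Sum>i\<in>UNIV. cinner (v i) w *s v i)"
    using orthonormal_family_expand [OF v, of w] by simp
  also have "\<dots> = (\<Sum>i\<in>UNIV. cinner (v i) w *s (H *v v i))"
    by (simp add: vec.sum vec.scale)
  finally show ?thesis
    by (simp add: H cinner_sum_right cinner_scale_right mult_ac)
qed

lemma ordered_eigenvalues_selfadjoint:
  assumes "ordered_eigenvalues H r"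
  shows "cinner u (H *v w) = cinner (H *v u) w"
proof -
  obtain v where v: "orthonormal_family v" "\<And>j. H *v v j = complex_of_real (r j) *s v j"
    using assms by (auto simp: ordered_eigenvalues_def)
  have "cinner (H *v u) w = cnj (cinner w (H *v u))" by (simp add: cnj_cinner)
  also have "\<dots> = cinner u (H *v w)"
    unfolding orthonormal_eigenbasis_form [OF v] by (simp add: cnj_cinner mult_ac)
  finally show ?thesis ..
qed

lemma orthonormal_family_coeff:
  assumes "orthonormal_family v"
  shows "cinner (v i) (\<Sum>j\<in>UNIV. c j *s v j) = c i"
proof -
  have "c j * cinner (v i) (v j) = (if i = j then c j else 0)" for j
    using assms by (auto simp: orthonormal_family_def)
  then show ?thesis by (simp add: cinner_sum_right cinner_scale_right)
qed

text \<open>The span of the eigenvectors of \<open>H\<close> from index \<open>j\<close> on and the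
  span of those of \<open>K\<close> up to \<open>j\<close> have dimensions adding up to d + 1, hence
  share some x \<noteq> 0. On x the form of \<open>H\<close> is at least \<open>r j\<close> and that
  of \<open>K\<close> at most \<open>s j\<close> times the squared norm.\<close>

lemma ordered_eigenvalues_le:
  fixes H K :: "complex^'d::{finite,linorder}^'d::{finite,linorder}"
  assumes "ordered_eigenvalues H r" "ordered_eigenvalues K s"
  shows "r j \<le> s j + norm (H - K)"
proof -
  obtain v where v: "orthonormal_family v" "\<And>j. H *v v j = complex_of_real (r j) *s v j" and r: "mono r"
    using assms(1) by (auto simp: ordered_eigenvalues_def)
  obtain w where w: "orthonormal_family w" "\<And>j. K *v w j = complex_of_real (s j) *s w j" and s: "mono s"
    using assms(2) by (auto simp: ordered_eigenvalues_def)
  \<comment> \<open>The tagged union counts \<open>j\<close> on both sides, which produces the one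
    index too many. The sign in \<open>?f\<close> turns a vanishing combination into one vector
    \<open>x\<close> with two expansions.\<close>
  let ?I = "Inl ` {j..} \<union> Inr ` {..j}"
  let ?f = "case_sum v (\<lambda>i. - w i)"
  have "card ?I = card {j..} + card {..j}"
    by (subst card_Un_disjoint) (auto simp: card_image)
  also have "\<dots> = card ({j..} \<union> {..j}) + card ({j..} \<inter> {..j})"
    by (rule card_Un_Int) auto
  also have "{j..} \<union> {..j} = UNIV" by auto
  also have "{j..} \<inter> {..j} = {j}" by auto
  finally have "CARD('d) < card ?I" by simp
  then obtain c where c: "\<exists>i\<in>?I. c i \<noteq> 0" "(\<Sum>i\<in>?I. c i *s ?f i) = 0"
    using exists_nontrivial_relation [of ?I ?f] by auto
  define a where "a = (\<lambda>i. if j \<le> i then c (Inl i) else 0)"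
  define b where "b = (\<lambda>i. if i \<le> j then c (Inr i) else 0)"
  define x where "x = (\<Sum>i\<in>UNIV. a i *s v i)"
  have xa: "cinner (v i) x = a i" for i
    unfolding x_def by (rule orthonormal_family_coeff [OF v(1)])
  have sum_a: "(\<Sum>i\<in>{j..}. c (Inl i) *s v i) = x"
    unfolding x_def a_def by (rule sum.mono_neutral_cong_left) auto
  have "(\<Sum>i\<in>?I. c i *s ?f i) = (\<Sum>i\<in>{j..}. c (Inl i) *s v i) + (\<Sum>i\<in>{..j}. c (Inr i) *s - w i)"
    by (subst sum.union_disjoint) (auto simp: sum.reindex)
  then have "x = (\<Sum>i\<in>{..j}. c (Inr i) *s w i)"
    using c(2) unfolding sum_a by (simp add: vec.scale_minus_right sum_negf)
  also have "\<dots> = (\<Sum>i\<in>UNIV. b i *s w i)"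
    unfolding b_def by (rule sum.mono_neutral_cong_left) auto
  finally have xb: "cinner (w i) x = b i" for i
    using orthonormal_family_coeff [OF w(1)] by simp
  have "x \<noteq> 0" using c(1) xa xb by (auto simp: a_def b_def split: if_splits) (metis cinner_zero_right)+
  have form: "Re (cinner x (M *v x)) = (\<Sum>i\<in>UNIV. q i * (norm (cinner (u i) x))\<^sup>2)"
    if "orthonormal_family u" "\<And>i. M *v u i = complex_of_real (q i) *s u i" for M u q
  proof -
    have "cinner x (M *v x) = (\<Sum>i\<in>UNIV. complex_of_real (q i * (norm (cinner (u i) x))\<^sup>2))"
      unfolding orthonormal_eigenbasis_form [OF that] of_real_mult complex_norm_square
      by (simp add: cnj_cinner mult_ac)
    then show ?thesis by simp
  qed
  have "r j * (norm x)\<^sup>2 \<le> Re (cinner x (H *v x))"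
    unfolding form [OF v] orthonormal_family_parseval [OF v(1), of x] sum_distrib_left
    by (intro sum_mono) (use monoD [OF r] in \<open>auto simp: xa a_def intro: mult_right_mono\<close>)
  moreover have "Re (cinner x (K *v x)) \<le> s j * (norm x)\<^sup>2"
    unfolding form [OF w] orthonormal_family_parseval [OF w(1), of x] sum_distrib_left
    by (intro sum_mono) (use monoD [OF s] in \<open>auto simp: xb b_def intro: mult_right_mono\<close>)
  moreover have "Re (cinner x (H *v x)) - Re (cinner x (K *v x)) \<le> norm (H - K) * (norm x)\<^sup>2"
  proof -
    have "Re (cinner x (H *v x)) - Re (cinner x (K *v x)) = Re (cinner x ((H - K) *v x))"
      by (simp add: matrix_vector_mult_diff_rdistrib cinner_diff_right)
    also have "\<dots> \<le> norm (cinner x ((H - K) *v x))" by (rule complex_Re_le_cmod)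
    also have "\<dots> \<le> norm x * (norm (H - K) * norm x)"
      by (meson norm_cinner_le norm_matrix_vector_le mult_left_mono norm_ge_zero order_trans)
    finally show ?thesis by (simp add: power2_eq_square mult_ac)
  qed
  ultimately have "r j * (norm x)\<^sup>2 \<le> (s j + norm (H - K)) * (norm x)\<^sup>2"
    by (simp add: algebra_simps)
  then show ?thesis using \<open>x \<noteq> 0\<close> by simp
qed


section \<open>First-order perturbation of eigenvalues\<close>

lemma has_vector_derivative_at_iff_quotient:
  fixes f :: "real \<Rightarrow> 'a::real_normed_vector"
  shows "(f has_vector_derivative D) (at x) \<longleftrightarrow> ((\<lambda>h. (f (x + h) - f x) /\<^sub>R h) \<longlongrightarrow> D) (at 0)"
proof -
  have "norm (f (x + h) - f x - h *\<^sub>R D) / norm h = norm ((f (x + h) - f x) /\<^sub>R h - D)" if "h \<noteq> 0" for h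
  proof -
    have "f (x + h) - f x - h *\<^sub>R D = h *\<^sub>R ((f (x + h) - f x) /\<^sub>R h - D)"
      using that by (simp add: scaleR_diff_right)
    then show ?thesis using that by simp
  qed
  then have "((\<lambda>h. norm (f (x + h) - f x - h *\<^sub>R D) / norm h) \<longlongrightarrow> 0) (at 0) \<longleftrightarrow>
      ((\<lambda>h. norm ((f (x + h) - f x) /\<^sub>R h - D)) \<longlongrightarrow> 0) (at 0)"
    by (intro tendsto_cong) (auto simp: eventually_at_filter)
  then show ?thesis
    unfolding has_vector_derivative_def has_derivative_at
    by (simp add: bounded_linear_scaleR_left tendsto_norm_zero_iff LIM_zero_iff)
qed

lemma matrix_vector_mult_scaleR_left:
  "(c *\<^sub>R M) *v (x :: complex^'n) = complex_of_real c *s (M *v x)"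
  by (simp add: vec_eq_iff matrix_vector_mult_def sum_distrib_left mult.assoc
      scaleR_conv_of_real [where ?'a = complex])

lemma tendsto_cinner:
  "(f \<longlongrightarrow> a) F \<Longrightarrow> (g \<longlongrightarrow> b) F \<Longrightarrow> ((\<lambda>n. cinner (f n) (g n)) \<longlongrightarrow> cinner a b) F"
  unfolding cinner_def by (intro tendsto_intros tendsto_vec_nth)

lemma tendsto_matrix_vector_mult:
  fixes f :: "'a \<Rightarrow> complex^'m^'n"
  shows "(f \<longlongrightarrow> a) F \<Longrightarrow> (g \<longlongrightarrow> b) F \<Longrightarrow> ((\<lambda>n. f n *v g n) \<longlongrightarrow> a *v b) F"
  by (rule vec_tendstoI) (auto simp: matrix_vector_mult_def intro!: tendsto_intros tendsto_vec_nth)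

lemma tendsto_vec_scale:
  fixes g :: "'a \<Rightarrow> complex^'n"
  shows "(f \<longlongrightarrow> a) F \<Longrightarrow> (g \<longlongrightarrow> b) F \<Longrightarrow> ((\<lambda>n. f n *s g n) \<longlongrightarrow> a *s b) F"
  by (rule vec_tendstoI) (auto intro!: tendsto_intros tendsto_vec_nth)

text \<open>The whole family is packed into one vector of vectors, so a single extraction from a
  compact ball serves all indices at once.\<close>

lemma orthonormal_family_convergent_subseq:
  fixes v :: "nat \<Rightarrow> 'd \<Rightarrow> complex^'d"
  assumes "\<And>n. orthonormal_family (v n)"
  obtains \<phi> :: "nat \<Rightarrow> nat" and w where "strict_mono \<phi>" "\<And>j. (\<lambda>n. v (\<phi> n) j) \<longlonglongrightarrow> w j" "orthonormal_family w"
proof -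
  define W where "W = (\<lambda>n. \<chi> j. v n j)"
  have "norm (W n) \<le> real CARD('d)" for n
  proof -
    have "norm (W n) \<le> (\<Sum>j\<in>UNIV. norm (v n j))"
      unfolding norm_vec_def [of "W n"] by (simp add: W_def L2_set_le_sum)
    then show ?thesis using norm_orthonormal_family [OF assms] by simp
  qed
  then have "W n \<in> cball 0 (real CARD('d))" for n by simp
  then obtain l \<phi> where \<phi>: "strict_mono \<phi>" "(W \<circ> \<phi>) \<longlonglongrightarrow> l"
    using compact_cball [of 0 "real CARD('d)"] unfolding compact_def by metis
  have lim: "(\<lambda>n. v (\<phi> n) j) \<longlonglongrightarrow> l $ j" for j
    using tendsto_vec_nth [OF \<phi>(2), of j] by (simp add: W_def)
  have "cinner (l $ i) (l $ j) = (if i = j then 1 else 0)" for i j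
  proof -
    have "(\<lambda>n. cinner (v (\<phi> n) i) (v (\<phi> n) j)) \<longlonglongrightarrow> cinner (l $ i) (l $ j)"
      by (intro tendsto_cinner lim)
    moreover have "(\<lambda>n. cinner (v (\<phi> n) i) (v (\<phi> n) j)) = (\<lambda>n. if i = j then 1 else 0)"
      using assms by (simp add: orthonormal_family_def)
    ultimately have "(\<lambda>n::nat. if i = j then 1 else 0) \<longlonglongrightarrow> cinner (l $ i) (l $ j)" by simp
    from LIMSEQ_unique [OF this tendsto_const] show ?thesis .
  qed
  then have "orthonormal_family (\<lambda>j. l $ j)" by (simp add: orthonormal_family_def)
  then show ?thesis using that \<phi>(1) lim by blast
qed

text \<open>Hellmann--Feynman without a choice of differentiable eigenvectors: if all ordered
  eigenvalues are differentiable, then those meeting at \<open>t = 0\<close> have equal derivatives,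
  because their ordered differences attain a minimum there.\<close>
lemma ordered_eigenvalue_derivative:
  fixes h :: "real \<Rightarrow> complex^'d::{finite,linorder}^'d::{finite,linorder}"
  assumes ev: "\<forall>\<^sub>F t in nhds 0. ordered_eigenvalues (h t) (r t)"
    and h: "(h has_vector_derivative h') (at 0)"
    and r: "\<And>j. ((\<lambda>t. r t j) has_real_derivative \<rho> j) (at 0)"
    and u: "h 0 *v u = complex_of_real (r 0 k) *s u" "norm u = 1"
  shows "\<rho> k = Re (cinner u (h' *v u))"
proof -
  obtain d where d: "d > 0" "\<And>t. \<bar>t\<bar> < d \<Longrightarrow> ordered_eigenvalues (h t) (r t)"
    using ev by (auto simp: eventually_nhds_metric dist_real_def)
  have ev0: "ordered_eigenvalues (h 0) (r 0)" using d by simp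
  have \<rho>_le: "\<rho> i = \<rho> j" if "i \<le> j" "r 0 i = r 0 j" for i j
  proof -
    have "((\<lambda>t. r t j - r t i) has_real_derivative \<rho> j - \<rho> i) (at 0)"
      by (intro derivative_intros r)
    moreover have "\<forall>t. \<bar>0 - t\<bar> < d \<longrightarrow> r 0 j - r 0 i \<le> r t j - r t i"
      using d(2) that by (auto simp: ordered_eigenvalues_def monoD)
    ultimately have "\<rho> j - \<rho> i = 0" using d(1) by (intro DERIV_local_min)
    then show ?thesis by simp
  qed
  have \<rho>_eq: "\<rho> j = \<rho> k" if "r 0 j = r 0 k" for j
    using \<rho>_le [of j k] \<rho>_le [of k j] that by (metis linear)
  \<comment> \<open>The offset 2 keeps every \<open>t n\<close> nonzero and strictly inside the
    interval of radius \<open>d\<close>.\<close>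
  define t where "t = (\<lambda>n::nat. d / real (n + 2))"
  have t: "t n \<noteq> 0" "\<bar>t n\<bar> < d" for n using d(1) by (auto simp: t_def field_simps add_pos_nonneg)
  have t0: "t \<longlonglongrightarrow> 0"
    unfolding t_def by real_asymp
  have "\<forall>n. \<exists>v. orthonormal_family v \<and> (\<forall>j. h (t n) *v v j = complex_of_real (r (t n) j) *s v j)"
    using d(2) [OF t(2)] by (auto simp: ordered_eigenvalues_def)
  from choice [OF this] obtain v where v: "\<And>n. orthonormal_family (v n)"
      "\<And>n j. h (t n) *v v n j = complex_of_real (r (t n) j) *s v n j"
    by blast
  \<comment> \<open>The eigenbases at \<open>t n\<close> are arbitrary. Their limit \<open>w\<close>
    is an eigenbasis of \<open>h 0\<close> adapted to the perturbation, whereas \<open>u\<close> is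
    an unrelated eigenvector of the same eigenspace.\<close>
  obtain \<phi> w where \<phi>: "strict_mono \<phi>" and w: "\<And>j. (\<lambda>n. v (\<phi> n) j) \<longlonglongrightarrow> w j" "orthonormal_family w"
    by (rule orthonormal_family_convergent_subseq [of v, OF v(1)]) blast
  define s where "s = t \<circ> \<phi>"
  have s: "filterlim s (at 0) sequentially"
    unfolding s_def using t t0 \<phi> by (auto simp: filterlim_at LIMSEQ_subseq_LIMSEQ)
  have hs: "(\<lambda>n. (h (s n) - h 0) /\<^sub>R s n) \<longlonglongrightarrow> h'"
    using filterlim_compose [OF _ s] h by (auto simp: has_vector_derivative_at_iff_quotient)
  have rs: "(\<lambda>n. (r (s n) j - r 0 j) / s n) \<longlonglongrightarrow> \<rho> j" for j
    using filterlim_compose [OF _ s] r [of j] by (auto simp: has_field_derivative_iff)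
  have hcont: "(\<lambda>n. h (s n)) \<longlonglongrightarrow> h 0"
    using filterlim_compose [OF _ s] has_vector_derivative_continuous [OF h] by (auto simp: continuous_at)
  have rcont: "(\<lambda>n. r (s n) j) \<longlonglongrightarrow> r 0 j" for j
    using filterlim_compose [OF _ s] DERIV_isCont [OF r [of j]] by (auto simp: isCont_def)
  have vs: "h (s n) *v v (\<phi> n) j = complex_of_real (r (s n) j) *s v (\<phi> n) j" for n j
    using v(2) by (simp add: s_def)
  have w0: "h 0 *v w j = complex_of_real (r 0 j) *s w j" for j
  proof (rule LIMSEQ_unique)
    show "(\<lambda>n. h (s n) *v v (\<phi> n) j) \<longlonglongrightarrow> h 0 *v w j"
      by (intro tendsto_matrix_vector_mult hcont w)
    show "(\<lambda>n. h (s n) *v v (\<phi> n) j) \<longlonglongrightarrow> complex_of_real (r 0 j) *s w j"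
      unfolding vs by (intro tendsto_vec_scale tendsto_of_real rcont w)
  qed
  \<comment> \<open>Self-adjointness moves \<open>h 0\<close> onto \<open>u\<close>, where it acts
    by \<open>r 0 j = r 0 k\<close>. The pairing thus sees only the difference quotient of the j-th
    eigenvalue, whose limit is \<open>\<rho> j = \<rho> k\<close>.\<close>
  have key: "cinner u (h' *v w j) = complex_of_real (\<rho> k) * cinner u (w j)" if j: "r 0 j = r 0 k" for j
  proof (rule LIMSEQ_unique)
    let ?F = "\<lambda>n. cinner u (((h (s n) - h 0) /\<^sub>R s n) *v v (\<phi> n) j)"
    show "?F \<longlonglongrightarrow> cinner u (h' *v w j)"
      by (intro tendsto_cinner tendsto_matrix_vector_mult hs w tendsto_const)
    have "?F n = complex_of_real ((r (s n) j - r 0 j) / s n) * cinner u (v (\<phi> n) j)" for n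
    proof -
      have "cinner u (h 0 *v v (\<phi> n) j) = complex_of_real (r 0 j) * cinner u (v (\<phi> n) j)"
        by (simp add: ordered_eigenvalues_selfadjoint [OF ev0] u(1) cinner_scale_left j)
      then have "cinner u ((h (s n) - h 0) *v v (\<phi> n) j)
          = complex_of_real (r (s n) j - r 0 j) * cinner u (v (\<phi> n) j)"
        by (simp add: matrix_vector_mult_diff_rdistrib cinner_diff_right vs cinner_scale_right algebra_simps)
      moreover have "((h (s n) - h 0) /\<^sub>R s n) *v x = complex_of_real (1 / s n) *s ((h (s n) - h 0) *v x)" for x
        by (simp add: matrix_vector_mult_scaleR_left inverse_eq_divide)
      ultimately show ?thesis by (simp add: cinner_scale_right)
    qed
    moreover have "(\<lambda>n. complex_of_real ((r (s n) j - r 0 j) / s n) * cinner u (v (\<phi> n) j))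
        \<longlonglongrightarrow> complex_of_real (\<rho> k) * cinner u (w j)"
      using rs [of j] unfolding \<rho>_eq [OF j]
      by (intro tendsto_mult tendsto_of_real tendsto_cinner tendsto_const w)
    ultimately show "?F \<longlonglongrightarrow> complex_of_real (\<rho> k) * cinner u (w j)" by (simp only:)
  qed
  have off: "cinner (w j) u = 0" if "r 0 j \<noteq> r 0 k" for j
  proof -
    have "complex_of_real (r 0 j) * cinner (w j) u = complex_of_real (r 0 k) * cinner (w j) u"
      using ordered_eigenvalues_selfadjoint [OF ev0, of "w j" u]
      by (auto simp: u(1) w0 cinner_scale_left cinner_scale_right)
    then show ?thesis using that by auto
  qed
  \<comment> \<open>Only the second \<open>u\<close> is expanded in \<open>w\<close>. The vectors of
    other eigenvalues drop out by orthogonality; on the remaining ones \<open>key\<close> supplies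
    the common factor \<open>\<rho> k\<close>.\<close>
  have "cinner u (h' *v u) = cinner u (h' *v (\<Sum>j\<in>UNIV. cinner (w j) u *s w j))"
    using orthonormal_family_expand [OF w(2), of u] by simp
  also have "\<dots> = (\<Sum>j\<in>UNIV. cinner (w j) u * cinner u (h' *v w j))"
    by (simp add: vec.sum vec.scale cinner_sum_right cinner_scale_right)
  also have "\<dots> = (\<Sum>j\<in>UNIV. complex_of_real (\<rho> k) * (cinner (w j) u * cinner u (w j)))"
    by (rule sum.cong) (use key off in \<open>auto simp: mult_ac\<close>)
  also have "\<dots> = complex_of_real (\<rho> k) * cinner u (\<Sum>j\<in>UNIV. cinner (w j) u *s w j)"
    by (simp add: cinner_sum_right cinner_scale_right sum_distrib_left)
  also have "\<dots> = complex_of_real (\<rho> k)"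
    using orthonormal_family_expand [OF w(2), of u] u(2) by (simp add: cinner_self)
  finally show ?thesis by simp
qed

text \<open>Along a subsequence staying away from \<open>\<rho>0\<close>, unit eigenvectors
  accumulate at some unit eigenvector of \<open>H0\<close>. Which one is beyond control, but
  \<open>\<rho>0\<close> is the value of the limit form on all of them, a contradiction.\<close>

lemma quadratic_form_on_eigenvectors_tendsto:
  fixes H :: "nat \<Rightarrow> complex^'d^'d"
  assumes "H \<longlonglongrightarrow> H0" "H' \<longlonglongrightarrow> H0'" "r \<longlonglongrightarrow> r0"
    and ex: "\<And>n. \<exists>u. norm u = 1 \<and> H n *v u = complex_of_real (r n) *s u"
    and \<rho>: "\<And>n u. norm u = 1 \<Longrightarrow> H n *v u = complex_of_real (r n) *s u \<Longrightarrow> \<rho> n = Re (cinner u (H' n *v u))"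
    and \<rho>0: "\<And>u. norm u = 1 \<Longrightarrow> H0 *v u = complex_of_real r0 *s u \<Longrightarrow> \<rho>0 = Re (cinner u (H0' *v u))"
  shows "\<rho> \<longlonglongrightarrow> \<rho>0"
proof (rule ccontr)
  assume "\<not> \<rho> \<longlonglongrightarrow> \<rho>0"
  then obtain e where e: "e > 0" and "\<exists>\<^sub>F n in sequentially. e \<le> dist (\<rho> n) \<rho>0"
    by (auto simp: tendsto_iff not_eventually not_less)
  then have "\<forall>N. \<exists>n\<ge>N. e \<le> dist (\<rho> n) \<rho>0" by (simp add: frequently_sequentially)
  then have inf: "infinite {n. e \<le> dist (\<rho> n) \<rho>0}" unfolding infinite_nat_iff_unbounded_le by blast
  define \<phi> where "\<phi> = enumerate {n. e \<le> dist (\<rho> n) \<rho>0}"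
  have \<phi>: "strict_mono \<phi>" "\<And>n. e \<le> dist (\<rho> (\<phi> n)) \<rho>0"
    using strict_mono_enumerate [OF inf] enumerate_in_set [OF inf] by (auto simp: \<phi>_def)
  have "\<forall>n. \<exists>u. norm u = 1 \<and> H n *v u = complex_of_real (r n) *s u" using ex by blast
  from choice [OF this] obtain u
    where u: "\<And>n. norm (u n) = 1" "\<And>n. H n *v u n = complex_of_real (r n) *s u n"
    by blast
  have "(u \<circ> \<phi>) n \<in> sphere 0 1" for n using u by simp
  then obtain l \<psi> where l: "l \<in> sphere 0 1" and \<psi>: "strict_mono (\<psi> :: nat \<Rightarrow> nat)" "((u \<circ> \<phi>) \<circ> \<psi>) \<longlonglongrightarrow> l"
    using compact_sphere [of 0 1] unfolding compact_def by metis
  define \<kappa> where "\<kappa> = \<phi> \<circ> \<psi>"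
  have \<kappa>: "strict_mono \<kappa>" using \<phi>(1) \<psi>(1) by (simp add: \<kappa>_def strict_mono_o)
  have lim: "(\<lambda>n. u (\<kappa> n)) \<longlonglongrightarrow> l" using \<psi>(2) by (simp add: \<kappa>_def o_def)
  note sub = LIMSEQ_subseq_LIMSEQ [OF _ \<kappa>, unfolded o_def]
  have "H0 *v l = complex_of_real r0 *s l"
  proof (rule LIMSEQ_unique)
    show "(\<lambda>n. H (\<kappa> n) *v u (\<kappa> n)) \<longlonglongrightarrow> H0 *v l"
      by (intro tendsto_matrix_vector_mult lim sub assms)
    show "(\<lambda>n. H (\<kappa> n) *v u (\<kappa> n)) \<longlonglongrightarrow> complex_of_real r0 *s l"
      unfolding u(2) by (intro tendsto_vec_scale tendsto_of_real lim sub assms)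
  qed
  then have "\<rho>0 = Re (cinner l (H0' *v l))" using \<rho>0 l by simp
  moreover have "(\<lambda>n. Re (cinner (u (\<kappa> n)) (H' (\<kappa> n) *v u (\<kappa> n)))) \<longlonglongrightarrow> Re (cinner l (H0' *v l))"
    by (intro tendsto_Re tendsto_cinner tendsto_matrix_vector_mult lim sub assms)
  moreover have "\<rho> (\<kappa> n) = Re (cinner (u (\<kappa> n)) (H' (\<kappa> n) *v u (\<kappa> n)))" for n
    by (rule \<rho> [OF u])
  ultimately have "(\<lambda>n. \<rho> (\<kappa> n)) \<longlonglongrightarrow> \<rho>0" by simp
  then have "\<forall>\<^sub>F n in sequentially. dist (\<rho> (\<kappa> n)) \<rho>0 < e" using e by (simp add: tendsto_iff)
  then obtain n where "dist (\<rho> (\<kappa> n)) \<rho>0 < e" by (auto simp: eventually_sequentially)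
  then show False using \<phi>(2) [of "\<psi> n"] by (simp add: \<kappa>_def)
qed

section \<open>Directional differentiability of Lipschitz functions\<close>

text \<open>Values below \<open>p\<close> and above \<open>q\<close> occur at arbitrarily small
  nonzero arguments. All quantifiers range over countable sets, which makes the set of points of
  oscillation Borel.\<close>

definition oscillates :: "(real \<Rightarrow> real) \<Rightarrow> real \<Rightarrow> real \<Rightarrow> bool" where
  "oscillates g p q \<longleftrightarrow>
     (\<forall>n. \<exists>r::rat. r \<noteq> 0 \<and> \<bar>real_of_rat r\<bar> < 1 / real (Suc n) \<and> g (real_of_rat r) < p) \<and>
     (\<forall>n. \<exists>r::rat. r \<noteq> 0 \<and> \<bar>real_of_rat r\<bar> < 1 / real (Suc n) \<and> q < g (real_of_rat r))"

text \<open>Continuity away from 0 makes the relevant set of arguments open, so it contains a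
  rational once it is nonempty.\<close>

lemma rational_in_punctured_neighbourhood:
  fixes g :: "real \<Rightarrow> real"
  assumes cont: "continuous_on (- {0}) g" and "open S" and "\<exists>\<^sub>F h in at 0. g h \<in> S"
  shows "\<exists>r::rat. r \<noteq> 0 \<and> \<bar>real_of_rat r\<bar> < 1 / real (Suc n) \<and> g (real_of_rat r) \<in> S"
proof -
  define T where "T = (- {0} \<inter> g -` S) \<inter> ball 0 (1 / real (Suc n))"
  have "open (- {0} \<inter> g -` S)"
    using cont \<open>open S\<close> by (metis continuous_on_open_vimage open_Compl closed_singleton Int_commute)
  then have "open T" unfolding T_def by blast
  have "\<forall>\<^sub>F h in at (0::real). h \<in> ball 0 (1 / real (Suc n)) \<and> h \<noteq> 0"
    unfolding eventually_at_topological by (intro exI [of _ "ball 0 (1 / real (Suc n))"]) auto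
  with assms(3) have "\<exists>\<^sub>F h in at 0. g h \<in> S \<and> h \<in> ball 0 (1 / real (Suc n)) \<and> h \<noteq> 0"
    by (rule frequently_eventually_frequently)
  then obtain h where "h \<in> T" by (auto simp: T_def dest: frequently_ex)
  then obtain e where e: "e > 0" "ball h e \<subseteq> T" using \<open>open T\<close> by (meson open_contains_ball)
  obtain r where "h < real_of_rat r" "real_of_rat r < h + e" using of_rat_dense [of h "h + e"] e(1) by auto
  then have "real_of_rat r \<in> T" using e(2) by (auto simp: subset_eq dist_real_def)
  then show ?thesis by (intro exI [of _ r]) (auto simp: T_def)
qed

text \<open>The supremum of \<open>S\<close> is the lower limit of \<open>g\<close> at 0. If
  \<open>g\<close> does not converge to it, the upper limit is strictly larger, and two rationals
  fit in between.\<close>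

lemma not_convergent_oscillates:
  fixes g :: "real \<Rightarrow> real"
  assumes cont: "continuous_on (- {0}) g" and bd: "\<And>h. h \<noteq> 0 \<Longrightarrow> \<bar>g h\<bar> \<le> M"
    and nc: "\<not> (\<exists>l. (g \<longlongrightarrow> l) (at 0))"
  shows "\<exists>p q::rat. p < q \<and> oscillates g (real_of_rat p) (real_of_rat q)"
proof -
  define S where "S = {c. \<forall>\<^sub>F h in at 0. c \<le> g h}"
  have ne0: "\<forall>\<^sub>F h in at (0::real). h \<noteq> 0" by (simp add: eventually_at_filter)
  have "- M \<in> S" unfolding S_def mem_Collect_eq
    by (rule eventually_mono [OF ne0]) (use bd in \<open>fastforce simp: abs_le_iff\<close>)
  have "c \<le> M" if "c \<in> S" for c
  proof -
    have "\<forall>\<^sub>F h in at (0::real). c \<le> M"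
      using that ne0 unfolding S_def mem_Collect_eq
      by eventually_elim (use bd in \<open>fastforce simp: abs_le_iff\<close>)
    then show ?thesis by simp
  qed
  then have bdd: "bdd_above S" by (auto simp: bdd_above_def)
  have lower: "\<forall>\<^sub>F h in at 0. c < g h" if c: "c < Sup S" for c
  proof -
    obtain c' where c': "c' \<in> S" "c < c'" using less_cSupD [of S c] \<open>- M \<in> S\<close> c by blast
    then have "\<forall>\<^sub>F h in at 0. c' \<le> g h" by (simp add: S_def)
    then show ?thesis using c'(2) by (auto elim: eventually_mono)
  qed
  have "\<not> (g \<longlongrightarrow> Sup S) (at 0)" using nc by blast
  then obtain c where c: "c > Sup S" "\<not> (\<forall>\<^sub>F h in at 0. g h < c)"
    using lower by (auto simp: order_tendsto_iff)
  obtain p where p: "Sup S < real_of_rat p" "real_of_rat p < c" using of_rat_dense [OF c(1)] by blast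
  obtain q where q: "real_of_rat p < real_of_rat q" "real_of_rat q < c" using of_rat_dense [OF p(2)] by blast
  have "\<exists>\<^sub>F h in at 0. g h \<in> {..<real_of_rat p}"
  proof -
    have "real_of_rat p \<notin> S" using p(1) cSup_upper [OF _ bdd] by force
    then show ?thesis by (simp add: S_def not_eventually not_le)
  qed
  moreover have "\<exists>\<^sub>F h in at 0. g h \<in> {real_of_rat q<..}"
    using c(2) q(2) by (auto simp: not_eventually not_less elim: frequently_elim1)
  ultimately have "oscillates g (real_of_rat p) (real_of_rat q)"
    unfolding oscillates_def
    using rational_in_punctured_neighbourhood [OF cont open_lessThan]
      rational_in_punctured_neighbourhood [OF cont open_greaterThan] by simp
  then show ?thesis using q(1) of_rat_less by blast
qed

section \<open>Differentiation on the line through Vitali coverings\<close>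

text \<open>Around each point of \<open>E\<close> there are arbitrarily short intervals that \<phi>
  stretches by at most \<open>p\<close>. Their images form a Vitali cover of the image of
  \<open>E\<close>; the covering takes place in the range because it is the image that must be
  exhausted up to a null set. Outer regularity then shrinks \<open>G\<close> to
  \<open>E\<close>.\<close>

lemma emeasure_image_le_small_slopes:
  fixes \<phi> :: "real \<Rightarrow> real"
  assumes mono: "strict_mono \<phi>" and cont: "continuous_on UNIV \<phi>"
    and E: "E \<in> sets borel" and \<phi>E: "\<phi> ` E \<in> sets borel" and "p > 0"
    and slope: "\<And>x \<delta>. x \<in> E \<Longrightarrow> \<delta> > 0 \<Longrightarrow> \<exists>h. h \<noteq> 0 \<and> \<bar>h\<bar> < \<delta> \<and> (\<phi> (x + h) - \<phi> x) / h \<le> p"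
  shows "emeasure lborel (\<phi> ` E) \<le> ennreal p * emeasure lborel E"
proof -
  have main: "emeasure lborel (\<phi> ` E) \<le> ennreal p * emeasure lborel G" if G: "open G" "E \<subseteq> G" for G
  proof -
    \<comment> \<open>Admissible intervals. The two functions below present their images as balls
      with center and radius, the form in which the covering theorem takes them.\<close>
    define K where "K = {(a, b). a < b \<and> {a..b} \<subseteq> G \<and> \<phi> b - \<phi> a \<le> p * (b - a)}"
    define cen where "cen = (\<lambda>(a, b). (\<phi> a + \<phi> b) / 2)"
    define rad where "rad = (\<lambda>(a, b). (\<phi> b - \<phi> a) / 2)"
    have cball: "cball (cen i) (rad i) = {\<phi> (fst i)..\<phi> (snd i)}" for i
      by (auto simp: cen_def rad_def cball_eq_atLeastAtMost split: prod.splits) (simp_all add: field_simps)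
    have rad_pos: "0 < rad i" if "i \<in> K" for i
      using that strict_monoD [OF mono] by (auto simp: K_def rad_def)
    have cover: "\<exists>i. i \<in> K \<and> y \<in> cball (cen i) (rad i) \<and> rad i < d" if y: "y \<in> \<phi> ` E" and "0 < d" for y d
    proof -
      obtain x where x: "x \<in> E" "y = \<phi> x" using y by blast
      obtain \<delta>1 where \<delta>1: "\<delta>1 > 0" "ball x \<delta>1 \<subseteq> G" using G x(1) by (meson open_contains_ball subsetD)
      have "isCont \<phi> x" using cont by (simp add: continuous_on_eq_continuous_at)
      then obtain \<delta>2 where \<delta>2: "\<delta>2 > 0" "\<And>z. dist z x < \<delta>2 \<Longrightarrow> dist (\<phi> z) (\<phi> x) < d"
        using \<open>d > 0\<close> unfolding continuous_at_eps_delta by blast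
      obtain h where h: "h \<noteq> 0" "\<bar>h\<bar> < min \<delta>1 \<delta>2" "(\<phi> (x + h) - \<phi> x) / h \<le> p"
        using slope [OF x(1), of "min \<delta>1 \<delta>2"] \<delta>1(1) \<delta>2(1) by auto
      define i where "i = (if h > 0 then (x, x + h) else (x + h, x))"
      have dh: "\<bar>\<phi> (x + h) - \<phi> x\<bar> < d" using \<delta>2(2) [of "x + h"] h(2) by (simp add: dist_real_def)
      have sub: "{min x (x + h)..max x (x + h)} \<subseteq> ball x \<delta>1" using h(2) by (auto simp: dist_real_def)
      have "i \<in> K"
        using h sub \<delta>1(2) by (auto simp: i_def K_def field_simps split: if_splits)
      moreover have "y \<in> cball (cen i) (rad i)"
        unfolding cball using strict_mono_less_eq [OF mono] x(2) by (auto simp: i_def)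
      moreover have "rad i < d" using dh \<open>d > 0\<close> by (auto simp: i_def rad_def)
      ultimately show ?thesis by blast
    qed
    obtain C where C: "countable C" "C \<subseteq> K"
      "pairwise (\<lambda>i j. disjnt (cball (cen i) (rad i)) (cball (cen j) (rad j))) C"
      "negligible (\<phi> ` E - (\<Union>i\<in>C. cball (cen i) (rad i)))"
      using Vitali_covering_theorem_cballs [of K rad "\<phi> ` E" cen] rad_pos cover by blast
    let ?V = "\<Union>i\<in>C. {\<phi> (fst i)..\<phi> (snd i)}"
    have V: "?V \<in> sets borel" using C(1) by (intro sets.countable_UN'') auto
    have "\<phi> ` E - ?V \<in> null_sets lborel"
      using C(4) \<phi>E V unfolding cball by (auto simp: negligible_iff_null_sets null_sets_completion_iff)
    then have "emeasure lborel (?V \<union> (\<phi> ` E - ?V)) = emeasure lborel ?V"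
      using V by (intro emeasure_Un_null_set) simp_all
    moreover have "emeasure lborel (\<phi> ` E) \<le> emeasure lborel (?V \<union> (\<phi> ` E - ?V))"
      using V \<phi>E by (intro emeasure_mono) auto
    ultimately have "emeasure lborel (\<phi> ` E) \<le> emeasure lborel ?V" by simp
    also have disj: "disjoint_family_on (\<lambda>i. {\<phi> (fst i)..\<phi> (snd i)}) C"
      using C(3) unfolding cball by (auto simp: disjoint_family_on_def pairwise_def disjnt_def)
    have "emeasure lborel ?V = (\<integral>\<^sup>+ i. emeasure lborel {\<phi> (fst i)..\<phi> (snd i)} \<partial>count_space C)"
      using C(1) disj by (intro emeasure_UN_countable) auto
    also have "\<dots> \<le> (\<integral>\<^sup>+ i. ennreal p * emeasure lborel {fst i..snd i} \<partial>count_space C)"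
    proof (rule nn_integral_mono)
      fix i assume "i \<in> space (count_space C)"
      then have "i \<in> K" using C(2) by auto
      then have "fst i < snd i" "\<phi> (snd i) - \<phi> (fst i) \<le> p * (snd i - fst i)" by (auto simp: K_def)
      moreover have "\<phi> (fst i) < \<phi> (snd i)" using calculation(1) strict_monoD [OF mono] by blast
      ultimately show "emeasure lborel {\<phi> (fst i)..\<phi> (snd i)} \<le> ennreal p * emeasure lborel {fst i..snd i}"
        using \<open>p > 0\<close> by (simp add: ennreal_mult [symmetric])
    qed
    also have "\<dots> = ennreal p * (\<integral>\<^sup>+ i. emeasure lborel {fst i..snd i} \<partial>count_space C)"
      by (rule nn_integral_cmult) auto
    \<comment> \<open>Monotonicity carries disjointness from the images back to the intervals, so
      their lengths add up to at most the measure of \<open>G\<close>.\<close>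
    also have disj2: "disjoint_family_on (\<lambda>i. {fst i..snd i}) C"
      using disj strict_mono_less_eq [OF mono] by (fastforce simp: disjoint_family_on_def)
    have "(\<integral>\<^sup>+ i. emeasure lborel {fst i..snd i} \<partial>count_space C) = emeasure lborel (\<Union>i\<in>C. {fst i..snd i})"
      using C(1) disj2 by (intro emeasure_UN_countable [symmetric]) auto
    also have "ennreal p * \<dots> \<le> ennreal p * emeasure lborel G"
      using C(2) G by (intro mult_left_mono emeasure_mono) (auto simp: K_def, fastforce)
    finally show ?thesis .
  qed
  show ?thesis
  proof (rule ennreal_le_epsilon)
    fix e :: real assume "e > 0"
    then obtain G where G: "open G" "E \<subseteq> G" "emeasure lborel (G - E) < ennreal (e / p)"
      using outer_regular_lborel [OF E, of "e / p"] \<open>p > 0\<close> by auto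
    have "emeasure lborel G = emeasure lborel E + emeasure lborel (G - E)"
      using G E by (subst plus_emeasure) (auto intro!: arg_cong [where f = "emeasure lborel"])
    also have "\<dots> \<le> emeasure lborel E + ennreal (e / p)" using G(3) by (intro add_left_mono) auto
    finally have "ennreal p * emeasure lborel G \<le> ennreal p * (emeasure lborel E + ennreal (e / p))"
      by (rule mult_left_mono) simp
    also have "\<dots> = ennreal p * emeasure lborel E + ennreal e"
      using \<open>p > 0\<close> \<open>e > 0\<close> by (simp add: distrib_left ennreal_mult [symmetric])
    finally show "emeasure lborel (\<phi> ` E) \<le> ennreal p * emeasure lborel E + ennreal e"
      using main [OF G(1,2)] by simp
  qed
qed


lemma sets_oscillates:
  fixes f :: "'a::euclidean_space \<Rightarrow> real"
  assumes [measurable]: "f \<in> borel_measurable borel"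
  shows "{x. oscillates (\<lambda>h. (f (x + h *\<^sub>R e) - f x) / h) p q} \<in> sets borel"
  unfolding oscillates_def by measurable

text \<open>Adding a steep linear function makes f an increasing homeomorphism \<phi>. Slopes of
  \<phi> below p + 2M give |\<phi>(S)| \<le> (p + 2M) |S|; slopes above q + 2M bound those of the
  inverse and give |S| \<le> |\<phi>(S)| / (q + 2M). As p < q and |S| is finite, |S| = 0.\<close>

lemma lipschitz_oscillates_null:
  fixes f :: "real \<Rightarrow> real"
  assumes f: "L-lipschitz_on UNIV f" and "p < q"
  shows "{x. oscillates (\<lambda>h. (f (x + h) - f x) / h) p q} \<in> null_sets lborel"
proof -
  \<comment> \<open>One more than the Lipschitz constant, hence positive even for a constant
    function. Slopes of f lie between -M and M, so those of \<phi> lie between M and 3M.\<close>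
  define M where "M = L + 1"
  have "L \<ge> 0" using f lipschitz_on_nonneg by blast
  then have M: "M > 0" by (simp add: M_def)
  have f_le: "\<bar>f x - f y\<bar> \<le> M * \<bar>x - y\<bar>" for x y
    using lipschitz_onD [OF f, of x y] mult_right_mono [of L M "\<bar>x - y\<bar>"] by (simp add: dist_real_def M_def)
  define \<phi> where "\<phi> = (\<lambda>x. f x + 2 * M * x)"
  have \<phi>_lower: "M * (y - x) \<le> \<phi> y - \<phi> x" and \<phi>_upper: "\<phi> y - \<phi> x \<le> 3 * M * (y - x)" if "x \<le> y" for x y
    using f_le [of y x] that by (auto simp: \<phi>_def algebra_simps abs_le_iff)
  have mono: "strict_mono \<phi>"
    by (rule strict_monoI) (smt (verit) \<phi>_lower M mult_pos_pos)
  have f_cont: "continuous_on UNIV f" using f lipschitz_on_continuous_on by blast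
  then have cont: "continuous_on UNIV \<phi>" unfolding \<phi>_def by (intro continuous_intros)
  have surj: "\<exists>x. \<phi> x = y" for y
  proof -
    define a where "a = \<bar>y - \<phi> 0\<bar> / M"
    have "a \<ge> 0" "M * a = \<bar>y - \<phi> 0\<bar>" using M by (auto simp: a_def)
    then have "\<phi> (- a) \<le> y" "y \<le> \<phi> a" "-a \<le> a" using \<phi>_lower [of 0 a] \<phi>_lower [of "-a" 0] by auto
    then show ?thesis using IVT' [of \<phi> "-a" y a] continuous_on_subset [OF cont] by blast
  qed
  define \<psi> where "\<psi> = inv \<phi>"
  have inj: "inj \<phi>" using mono by (rule strict_mono_imp_inj_on)
  have \<psi>\<phi>: "\<psi> (\<phi> x) = x" and \<phi>\<psi>: "\<phi> (\<psi> y) = y" for x y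
    using inj surj by (auto simp: \<psi>_def surj_def intro: surj_f_inv_f) (metis surj surj_def surj_f_inv_f)
  have \<psi>_mono: "strict_mono \<psi>"
    by (rule strict_monoI) (metis \<phi>\<psi> mono strict_mono_less)
  have "\<bar>\<psi> y - \<psi> z\<bar> \<le> (1 / M) * \<bar>y - z\<bar>" for y z
    using \<phi>_lower [of "\<psi> y" "\<psi> z"] \<phi>_lower [of "\<psi> z" "\<psi> y"] M unfolding \<phi>\<psi>
    by (cases "\<psi> y \<le> \<psi> z") (auto simp: field_simps)
  then have "(1/M)-lipschitz_on UNIV \<psi>" using M by (intro lipschitz_onI) (auto simp: dist_real_def)
  then have \<psi>_cont: "continuous_on UNIV \<psi>" by (rule lipschitz_on_continuous_on)
  have image: "\<phi> ` S \<in> sets borel" if "S \<in> sets borel" for S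
  proof -
    have "\<phi> ` S = \<psi> -` S \<inter> space borel" using \<psi>\<phi> \<phi>\<psi> by (auto simp: image_iff) metis
    then show ?thesis using borel_measurable_continuous_onI [OF \<psi>_cont] that by (metis measurable_sets)
  qed
  define E where "E = {x. oscillates (\<lambda>h. (f (x + h) - f x) / h) p q}"
  have E_borel: "E \<in> sets borel"
    using sets_oscillates [of f 1 p q] borel_measurable_continuous_onI [OF f_cont] by (simp add: E_def)
  have slope: "(\<phi> (x + h) - \<phi> x) / h = (f (x + h) - f x) / h + 2 * M" if "h \<noteq> 0" for x h
    using that by (simp add: \<phi>_def field_simps)
  have slope_ge: "M \<le> (\<phi> (x + h) - \<phi> x) / h" if "h \<noteq> 0" for x h
    using that \<phi>_lower [of x "x + h"] \<phi>_lower [of "x + h" x] by (cases "h > 0") (auto simp: field_simps)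
  have E_low: "\<exists>h. h \<noteq> 0 \<and> \<bar>h\<bar> < \<delta> \<and> (\<phi> (x + h) - \<phi> x) / h < p + 2 * M"
   and E_high: "\<exists>h. h \<noteq> 0 \<and> \<bar>h\<bar> < \<delta> \<and> q + 2 * M < (\<phi> (x + h) - \<phi> x) / h" if "x \<in> E" "\<delta> > 0" for x \<delta>
  proof -
    obtain n where n: "1 / real (Suc n) < \<delta>" by (rule nat_approx_posE [OF \<open>\<delta> > 0\<close>])
    have osc: "oscillates (\<lambda>h. (f (x + h) - f x) / h) p q" using that(1) by (simp add: E_def)
    obtain r :: rat where r: "r \<noteq> 0" "\<bar>real_of_rat r\<bar> < 1 / real (Suc n)"
        "(f (x + real_of_rat r) - f x) / real_of_rat r < p"
      using conjunct1 [OF osc [unfolded oscillates_def], THEN spec, of n] by blast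
    obtain s :: rat where s: "s \<noteq> 0" "\<bar>real_of_rat s\<bar> < 1 / real (Suc n)"
        "q < (f (x + real_of_rat s) - f x) / real_of_rat s"
      using conjunct2 [OF osc [unfolded oscillates_def], THEN spec, of n] by blast
    show "\<exists>h. h \<noteq> 0 \<and> \<bar>h\<bar> < \<delta> \<and> (\<phi> (x + h) - \<phi> x) / h < p + 2 * M"
      using r n by (intro exI [of _ "real_of_rat r"]) (simp add: slope)
    show "\<exists>h. h \<noteq> 0 \<and> \<bar>h\<bar> < \<delta> \<and> q + 2 * M < (\<phi> (x + h) - \<phi> x) / h"
      using s n by (intro exI [of _ "real_of_rat s"]) (simp add: slope)
  qed
  \<comment> \<open>Truncation makes the measure finite, without which the final comparison of |S|
    with itself would say nothing.\<close>
  have "E \<inter> {- real k..real k} \<in> null_sets lborel" for k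
  proof (cases "E = {}")
    case False
    then obtain x where "x \<in> E" by blast
    \<comment> \<open>Some slope of \<phi> at \<open>x\<close> is below p + 2M, while all are at
      least M > 0; a point of \<open>E\<close> is therefore needed for the sign.\<close>
    then have p': "p + 2 * M > 0" using E_low [of x 1] slope_ge M by (smt (verit) zero_less_one)
    then have q': "q + 2 * M > 0" using \<open>p < q\<close> by simp
    define S where "S = E \<inter> {- real k..real k}"
    have S: "S \<in> sets borel" using E_borel by (simp add: S_def)
    have 1: "emeasure lborel (\<phi> ` S) \<le> ennreal (p + 2 * M) * emeasure lborel S"
    proof (intro emeasure_image_le_small_slopes mono cont S image p')
      fix x \<delta> :: real assume "x \<in> S" "\<delta> > 0"
      then obtain h where "h \<noteq> 0" "\<bar>h\<bar> < \<delta>" "(\<phi> (x + h) - \<phi> x) / h < p + 2 * M"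
        using E_low [of x \<delta>] by (auto simp: S_def)
      then show "\<exists>h. h \<noteq> 0 \<and> \<bar>h\<bar> < \<delta> \<and> (\<phi> (x + h) - \<phi> x) / h \<le> p + 2 * M"
        by (intro exI [of _ h]) auto
    qed
    have 2: "emeasure lborel (\<psi> ` (\<phi> ` S)) \<le> ennreal (1 / (q + 2 * M)) * emeasure lborel (\<phi> ` S)"
    proof (intro emeasure_image_le_small_slopes \<psi>_mono \<psi>_cont image S)
      show "\<psi> ` (\<phi> ` S) \<in> sets borel" using S by (simp add: image_image \<psi>\<phi>)
      show "0 < 1 / (q + 2 * M)" using q' by simp
      fix y \<delta> :: real assume "y \<in> \<phi> ` S" "\<delta> > 0"
      then obtain x where x: "x \<in> E" "y = \<phi> x" by (auto simp: S_def)
      \<comment> \<open>The increment \<open>h'\<close> on the range side is at most 3M times the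
        increment \<open>h\<close>, whence the radius \<delta> / (3M).\<close>
      obtain h where h: "h \<noteq> 0" "\<bar>h\<bar> < \<delta> / (3 * M)" "q + 2 * M < (\<phi> (x + h) - \<phi> x) / h"
        using E_high [OF x(1), of "\<delta> / (3 * M)"] \<open>\<delta> > 0\<close> M by auto
      define h' where "h' = \<phi> (x + h) - \<phi> x"
      have "\<bar>h'\<bar> \<le> 3 * M * \<bar>h\<bar>"
        using \<phi>_upper [of x "x + h"] \<phi>_upper [of "x + h" x] \<phi>_lower [of x "x + h"] \<phi>_lower [of "x + h" x] M
        by (cases "h > 0") (auto simp: h'_def abs_le_iff mult_nonneg_nonneg
            intro: order_trans [of _ 0] order_trans [of _ "M * _"])
      also have "\<dots> < \<delta>" using h(2) M by (simp add: field_simps)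
      finally have "\<bar>h'\<bar> < \<delta>" .
      moreover have "h' \<noteq> 0" using h(1) inj by (auto simp: h'_def inj_eq)
      moreover have "(\<psi> (y + h') - \<psi> y) / h' \<le> 1 / (q + 2 * M)"
      proof -
        have "(\<psi> (y + h') - \<psi> y) / h' = 1 / (h' / h)"
          using h(1) by (simp add: h'_def x(2) \<psi>\<phi>)
        also have "\<dots> \<le> 1 / (q + 2 * M)"
          using less_imp_le [OF h(3)] q' unfolding h'_def [symmetric] by (intro frac_le) simp_all
        finally show ?thesis .
      qed
      ultimately show "\<exists>h. h \<noteq> 0 \<and> \<bar>h\<bar> < \<delta> \<and> (\<psi> (y + h) - \<psi> y) / h \<le> 1 / (q + 2 * M)" by blast
    qed
    have fin: "emeasure lborel S < \<infinity>"
      by (rule order_le_less_trans [OF emeasure_mono [of S "{- real k..real k}"]]) (auto simp: S_def)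
    then obtain m where m: "emeasure lborel S = ennreal m" "m \<ge> 0" by (auto simp: less_top_ennreal)
    have "ennreal m \<le> ennreal (1 / (q + 2 * M)) * (ennreal (p + 2 * M) * ennreal m)"
      using 2 mult_left_mono [OF 1, of "ennreal (1 / (q + 2 * M))"]
      by (simp add: image_image \<psi>\<phi> m(1))
    also have "\<dots> = ennreal ((p + 2 * M) * m / (q + 2 * M))"
      using p' q' m(2) by (simp add: ennreal_mult [symmetric] del: ennreal_mult)
    finally have "m \<le> (p + 2 * M) * m / (q + 2 * M)" using p' q' m(2) by simp
    then have "m * (q - p) \<le> 0" using q' by (simp add: field_simps)
    then have "m = 0" using m(2) \<open>p < q\<close> by (smt (verit) mult_pos_pos)
    then show ?thesis using m S by (simp add: null_sets_def S_def)
  qed simp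
  then have "(\<Union>k. E \<inter> {- real k..real k}) \<in> null_sets lborel" by (intro null_sets_UN) auto
  moreover have "(\<Union>k. E \<inter> {- real k..real k}) = E"
  proof (intro equalityI subsetI)
    fix x assume "x \<in> E"
    obtain k where "\<bar>x\<bar> \<le> real k" using real_arch_simple by blast
    then have "x \<in> {- real k..real k}" by (simp add: abs_le_iff)
    then show "x \<in> (\<Union>k. E \<inter> {- real k..real k})" using \<open>x \<in> E\<close> by blast
  qed auto
  ultimately show ?thesis by (simp add: E_def)
qed

section \<open>From lines to Euclidean space\<close>

lemma emeasure_lborel_translate:
  fixes S :: "'a::euclidean_space set"
  assumes [measurable]: "S \<in> sets borel"
  shows "emeasure lborel {x. x + a \<in> S} = emeasure lborel S"
proof -
  have "emeasure lborel S = emeasure (distr lborel borel ((+) a)) S" by (simp add: lborel_distr_plus)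
  also have "\<dots> = emeasure lborel {x. x + a \<in> S}"
    by (subst emeasure_distr) (auto simp: vimage_def add.commute)
  finally show ?thesis ..
qed

text \<open>Fubini on \<open>'a \<times> real\<close>, together with translation invariance, replaces a decomposition of \<open>'a\<close>
  into the line spanned by \<open>e\<close> and a complement.\<close>
lemma null_set_if_null_on_lines:
  fixes N :: "'a::euclidean_space set"
  assumes N [measurable]: "N \<in> sets borel"
    and lines: "\<And>x. {t. x + t *\<^sub>R e \<in> N} \<in> null_sets lborel"
  shows "N \<in> null_sets lborel"
proof -
  have "(\<integral>\<^sup>+ t. emeasure lborel N \<partial>(lborel :: real measure))
      = (\<integral>\<^sup>+ t. (\<integral>\<^sup>+ x. indicator N (x + t *\<^sub>R e) \<partial>lborel) \<partial>(lborel :: real measure))"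
  proof (rule nn_integral_cong)
    fix t :: real
    have "(\<integral>\<^sup>+ x. indicator N (x + t *\<^sub>R e) \<partial>lborel) = (\<integral>\<^sup>+ x. indicator {x. x + t *\<^sub>R e \<in> N} x \<partial>lborel)"
      by (intro nn_integral_cong) (auto simp: indicator_def)
    also have "\<dots> = emeasure lborel {x. x + t *\<^sub>R e \<in> N}"
      by (rule nn_integral_indicator) measurable
    finally show "emeasure lborel N = (\<integral>\<^sup>+ x. indicator N (x + t *\<^sub>R e) \<partial>lborel)"
      by (simp add: emeasure_lborel_translate)
  qed
  also have "\<dots> = (\<integral>\<^sup>+ x. (\<integral>\<^sup>+ t. indicator N (x + t *\<^sub>R e) \<partial>(lborel :: real measure)) \<partial>lborel)"
    by (rule lborel_pair.Fubini') measurable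
  also have "\<dots> = (\<integral>\<^sup>+ x. 0 \<partial>(lborel :: 'a measure))"
  proof (rule nn_integral_cong)
    fix x :: 'a
    have "(\<integral>\<^sup>+ t. indicator N (x + t *\<^sub>R e) \<partial>lborel) = (\<integral>\<^sup>+ t. indicator {t. x + t *\<^sub>R e \<in> N} t \<partial>(lborel :: real measure))"
      by (intro nn_integral_cong) (auto simp: indicator_def)
    also have "\<dots> = emeasure lborel {t. x + t *\<^sub>R e \<in> N}"
      by (rule nn_integral_indicator) measurable
    finally show "(\<integral>\<^sup>+ t. indicator N (x + t *\<^sub>R e) \<partial>lborel) = 0"
      using lines by (simp add: null_setsD1)
  qed
  \<comment> \<open>The left-hand side is a constant integrated over the whole real line, which has
    infinite measure; it can vanish only if the constant does.\<close>
  finally have "emeasure lborel N = 0" by (simp add: ennreal_mult_eq_top_iff)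
  then show ?thesis by (simp add: null_sets_def)
qed

text \<open>The points without a limit are covered by the oscillation sets of countably many
  rational pairs, each of them Borel and null on every line in direction \<open>e\<close>.\<close>

lemma lipschitz_directional_quotient_AE:
  fixes f :: "'a::euclidean_space \<Rightarrow> real"
  assumes f: "L-lipschitz_on UNIV f"
  shows "AE x in lborel. \<exists>l. ((\<lambda>h. (f (x + h *\<^sub>R e) - f x) / h) \<longlongrightarrow> l) (at 0)"
proof -
  let ?g = "\<lambda>x h. (f (x + h *\<^sub>R e) - f x) / h"
  define N where "N = (\<lambda>(p, q). {x. oscillates (?g x) (real_of_rat p) (real_of_rat q)})"
  have f_cont: "continuous_on UNIV f" using f lipschitz_on_continuous_on by blast
  have null: "N (p, q) \<in> null_sets lborel" if "p < q" for p q
  proof (rule null_set_if_null_on_lines [where e = e])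
    show "N (p, q) \<in> sets borel"
      unfolding N_def prod.case
      by (rule sets_oscillates [OF borel_measurable_continuous_onI [OF f_cont]])
    fix x
    have "(L * norm e)-lipschitz_on UNIV (\<lambda>t. f (x + t *\<^sub>R e))"
    proof (rule lipschitz_onI)
      fix s t :: real
      have "dist (f (x + s *\<^sub>R e)) (f (x + t *\<^sub>R e)) \<le> L * dist (x + s *\<^sub>R e) (x + t *\<^sub>R e)"
        by (rule lipschitz_onD [OF f]) auto
      also have "dist (x + s *\<^sub>R e) (x + t *\<^sub>R e) = norm e * dist s t"
        by (simp add: dist_norm flip: scaleR_diff_left)
      finally show "dist (f (x + s *\<^sub>R e)) (f (x + t *\<^sub>R e)) \<le> L * norm e * dist s t" by (simp add: mult.assoc)
    qed (use lipschitz_on_nonneg [OF f] in simp)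
    from lipschitz_oscillates_null [OF this, of "real_of_rat p" "real_of_rat q"] that
    show "{t. x + t *\<^sub>R e \<in> N (p, q)} \<in> null_sets lborel"
      by (simp add: N_def of_rat_less scaleR_add_left add.assoc)
  qed
  have "(\<Union>i\<in>{(p, q). p < q}. N i) \<in> null_sets lborel"
    using null by (intro null_sets_UN') auto
  moreover have "{x \<in> space lborel. \<not> (\<exists>l. (?g x \<longlongrightarrow> l) (at 0))} \<subseteq> (\<Union>i\<in>{(p, q). p < q}. N i)"
  proof clarify
    fix x assume nc: "\<not> (\<exists>l. (?g x \<longlongrightarrow> l) (at 0))"
    have "continuous_on (- {0}) (?g x)"
      by (intro continuous_intros continuous_on_compose2 [OF f_cont]) auto
    moreover have "\<bar>?g x h\<bar> \<le> L * norm e" if "h \<noteq> 0" for h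
      using lipschitz_onD [OF f, of "x + h *\<^sub>R e" x] that by (simp add: dist_norm field_simps)
    ultimately obtain p q where "p < q" "oscillates (?g x) (real_of_rat p) (real_of_rat q)"
      using not_convergent_oscillates nc by blast
    then show "x \<in> (\<Union>i\<in>{(p, q). p < q}. N i)" by (intro UN_I [of "(p, q)"]) (auto simp: N_def)
  qed
  ultimately show ?thesis by (rule AE_I')
qed

section \<open>Test functions and the fundamental lemma\<close>

lemma Ck_Suc_D: "Ck (Suc k) f \<Longrightarrow> Ck k f"
proof (induction k arbitrary: f)
  case 0
  then show ?case
    by (simp add: continuous_on_eq_continuous_at differentiable_imp_continuous_within)
next
  case (Suc k)
  then show ?case unfolding Ck.simps(2) by blast
qed

lemma Ck_const: "Ck k (\<lambda>x. c)"
  by (induction k arbitrary: c) (auto simp: frechet_derivative_const)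

lemma Ck_add: "Ck k f \<Longrightarrow> Ck k g \<Longrightarrow> Ck k (\<lambda>x. f x + g x)"
proof (induction k arbitrary: f g)
  case (Suc k)
  have "frechet_derivative (\<lambda>x. f x + g x) (at x) v = frechet_derivative f (at x) v + frechet_derivative g (at x) v" for x v
  proof -
    have "((\<lambda>x. f x + g x) has_derivative (\<lambda>v. frechet_derivative f (at x) v + frechet_derivative g (at x) v)) (at x)"
      using Suc.prems by (intro has_derivative_add) (auto simp: frechet_derivative_works [symmetric])
    from frechet_derivative_at [OF this] show ?thesis by metis
  qed
  then show ?case using Suc by simp
qed (auto intro: continuous_intros)

lemma Ck_mult: "Ck k f \<Longrightarrow> Ck k g \<Longrightarrow> Ck k (\<lambda>x. f x * g x)"
proof (induction k arbitrary: f g)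
  case (Suc k)
  have "frechet_derivative (\<lambda>x. f x * g x) (at x) v = f x * frechet_derivative g (at x) v + frechet_derivative f (at x) v * g x" for x v
  proof -
    have "((\<lambda>x. f x * g x) has_derivative (\<lambda>v. f x * frechet_derivative g (at x) v + frechet_derivative f (at x) v * g x)) (at x)"
      using Suc.prems by (intro has_derivative_mult) (auto simp: frechet_derivative_works [symmetric])
    from frechet_derivative_at [OF this] show ?thesis by metis
  qed
  then show ?case
    using Suc Ck_Suc_D [OF Suc.prems(1)] Ck_Suc_D [OF Suc.prems(2)] by (auto intro!: Ck_add)
qed (auto intro: continuous_intros)

lemma Ck_prod: "(\<And>i. i \<in> I \<Longrightarrow> Ck k (f i)) \<Longrightarrow> Ck k (\<lambda>x. \<Prod>i\<in>I. f i x)"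
  by (induction I rule: infinite_finite_induct) (auto simp: Ck_const Ck_mult)

text \<open>\<open>S\<close> is a family closed under differentiation, so the induction passes from
  \<open>u\<close> to its derivative inside \<open>S\<close> and no formula for higher derivatives
  is required.\<close>

lemma Ck_affine_coordinate:
  assumes "\<And>u. u \<in> S \<Longrightarrow> \<exists>u'\<in>S. \<forall>t. (u has_real_derivative u' t) (at t)" and "u \<in> S"
  shows "Ck k (\<lambda>x::real^'m. u (s * x $ i + b))"
  using assms(2)
proof (induction k arbitrary: u)
  case (Suc k)
  obtain u' where u': "u' \<in> S" "\<And>t. (u has_real_derivative u' t) (at t)" using assms(1) [OF Suc.prems] by blast
  have d: "((\<lambda>x::real^'m. u (s * x $ i + b)) has_derivative (\<lambda>v. u' (s * x $ i + b) * (s * v $ i))) (at x)" for x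
  proof -
    have "((\<lambda>x::real^'m. s * x $ i + b) has_derivative (\<lambda>v. s * v $ i)) (at x)"
      by (auto intro!: derivative_eq_intros bounded_linear_imp_has_derivative bounded_linear_vec_nth)
    from has_derivative_compose [OF this u'(2)[unfolded has_field_derivative_def]] show ?thesis .
  qed
  then have "frechet_derivative (\<lambda>x::real^'m. u (s * x $ i + b)) (at x) v = u' (s * x $ i + b) * (s * v $ i)" for x v
    using frechet_derivative_at [OF d] by metis
  then show ?case using d Suc.IH [OF u'(1)]
    by (auto simp: differentiable_def intro!: Ck_mult Ck_const)
next
  case 0
  obtain u' where u': "\<And>t. (u has_real_derivative u' t) (at t)" using assms(1) [OF 0] by blast
  then have "continuous_on UNIV u" by (meson DERIV_isCont continuous_at_imp_continuous_on)
  then show ?case by (auto intro!: continuous_intros continuous_on_compose2 [of UNIV u])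
qed

section \<open>Smooth bump functions\<close>

text \<open>The classical function exp(-c/t), extended by 0, with a polynomial factor in 1/t: this
  enlarges it to a family closed under differentiation.\<close>

definition flat :: "real \<Rightarrow> real poly \<Rightarrow> real \<Rightarrow> real" where
  "flat c p t = (if t > 0 then poly p (1 / t) * exp (- c / t) else 0)"

lemma poly_times_exp_minus_tendsto_0:
  assumes "c > 0"
  shows "((\<lambda>y. poly p y * exp (- c * y)) \<longlongrightarrow> (0::real)) at_top"
proof -
  have *: "((\<lambda>y. y ^ k * exp (- c * y)) \<longlongrightarrow> (0::real)) at_top" for k
  proof -
    have "filterlim (\<lambda>y. c * y) at_top at_top"
      by (rule filterlim_tendsto_pos_mult_at_top [OF tendsto_const assms filterlim_ident])
    then have "((\<lambda>y. (c * y) ^ k / exp (c * y)) \<longlongrightarrow> 0) at_top"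
      by (rule filterlim_compose [OF tendsto_power_div_exp_0])
    then have "((\<lambda>y. (1 / c ^ k) * ((c * y) ^ k / exp (c * y))) \<longlongrightarrow> (1 / c ^ k) * 0) at_top"
      by (intro tendsto_mult tendsto_const)
    moreover have "(1 / c ^ k) * ((c * y) ^ k / exp (c * y)) = y ^ k * exp (- c * y)" for y
      using assms by (simp add: power_mult_distrib exp_minus field_simps)
    ultimately show ?thesis by simp
  qed
  have "((\<lambda>y. \<Sum>i\<le>degree p. coeff p i * (y ^ i * exp (- c * y))) \<longlongrightarrow> (\<Sum>i\<le>degree p. coeff p i * 0)) at_top"
    by (intro tendsto_sum tendsto_mult tendsto_const *)
  then show ?thesis by (simp add: poly_altdef sum_distrib_right mult.assoc)
qed

text \<open>Differentiating p(1/t) exp(-c/t) gives (1/t)^2 (c p - p')(1/t) exp(-c/t), hence the two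
  leading zero coefficients. At t = 0 the right difference quotient is again a polynomial in 1/h
  times exp(-c/h), which tends to 0.\<close>

lemma flat_has_derivative:
  assumes "c > 0"
  shows "(flat c p has_real_derivative flat c (pCons 0 (pCons 0 (smult c p - pderiv p))) t) (at t)"
proof -
  consider "t > 0" | "t < 0" | "t = 0" by linarith
  then show ?thesis
  proof cases
    case 1
    have "((\<lambda>t. poly p (1 / t) * exp (- c / t)) has_real_derivative
        flat c (pCons 0 (pCons 0 (smult c p - pderiv p))) t) (at t)"
      using 1 by (auto intro!: derivative_eq_intros DERIV_chain' [where g = "poly p"] simp: flat_def field_simps power2_eq_square)
    then show ?thesis
      by (rule has_field_derivative_transform_within_open [where S = "{0<..}"]) (use 1 in \<open>auto simp: flat_def\<close>)
  next
    case 2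
    have "((\<lambda>t. 0) has_real_derivative flat c (pCons 0 (pCons 0 (smult c p - pderiv p))) t) (at t)"
      using 2 by (simp add: flat_def)
    then show ?thesis
      by (rule has_field_derivative_transform_within_open [where S = "{..<0}"]) (use 2 in \<open>auto simp: flat_def\<close>)
  next
    case 3
    have "((\<lambda>h. poly (pCons 0 p) (inverse h) * exp (- c * inverse h)) \<longlongrightarrow> 0) (at_right 0)"
      by (rule filterlim_compose [OF poly_times_exp_minus_tendsto_0 [OF assms] filterlim_inverse_at_top_right])
    moreover have "\<forall>\<^sub>F h in at_right (0::real). poly (pCons 0 p) (inverse h) * exp (- c * inverse h) = flat c p h / h"
      by (auto simp: eventually_at_filter flat_def field_simps)
    ultimately have r: "((\<lambda>h. flat c p h / h) \<longlongrightarrow> 0) (at_right 0)"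
      by (rule Lim_transform_eventually)
    have "\<forall>\<^sub>F h in at_left (0::real). 0 = flat c p h / h"
      by (auto simp: eventually_at_filter flat_def)
    then have l: "((\<lambda>h. flat c p h / h) \<longlongrightarrow> 0) (at_left 0)"
      by (rule Lim_transform_eventually [OF tendsto_const])
    show ?thesis unfolding 3 has_field_derivative_iff
      using filterlim_split_at [OF l r] by (simp add: flat_def)
  qed
qed

text \<open>Positive exactly on the open box, and increasing to its indicator as c decreases to 0.
  The factors 1 and -1 match the affine shape in \<open>Ck_affine_coordinate\<close>.\<close>

definition bump :: "real \<Rightarrow> real^'m \<Rightarrow> real^'m \<Rightarrow> real^'m \<Rightarrow> real" where
  "bump c a b x = (\<Prod>i\<in>UNIV. flat c 1 (1 * x $ i + - a $ i) * flat c 1 (- 1 * x $ i + b $ i))"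

lemma Ck_bump: "c > 0 \<Longrightarrow> Ck k (bump c a b)"
  unfolding bump_def
proof (intro Ck_prod Ck_mult)
  assume "c > 0"
  then have *: "\<exists>u'\<in>range (flat c). \<forall>t. (u has_real_derivative u' t) (at t)" if "u \<in> range (flat c)" for u
    using flat_has_derivative that by blast
  show "Ck k (\<lambda>x. flat c 1 (1 * x $ i + - a $ i))" "Ck k (\<lambda>x. flat c 1 (- 1 * x $ i + b $ i))" for i
    by (rule Ck_affine_coordinate [OF *, where u = "flat c 1"]; simp)+
qed

lemma bump_nonneg: "0 \<le> bump c a b x"
  by (auto simp: bump_def flat_def intro!: prod_nonneg)

lemma bump_le_1: "c > 0 \<Longrightarrow> bump c a b x \<le> 1"
  unfolding bump_def by (intro prod_le_1 conjI mult_le_one) (auto simp: flat_def)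

lemma bump_eq_0: "x \<notin> box a b \<Longrightarrow> bump c a b x = 0"
  unfolding bump_def by (rule prod_zero) (auto simp: flat_def mem_box_cart not_less, metis not_less)

lemma bump_test_function:
  assumes "c > 0" "cbox a b \<subseteq> U"
  shows "bump c a b \<in> test_functions U"
proof -
  have "{x. bump c a b x \<noteq> 0} \<subseteq> cbox a b" using bump_eq_0 box_subset_cbox by blast
  then have "closure {x. bump c a b x \<noteq> 0} \<subseteq> cbox a b" by (rule closure_minimal [OF _ closed_cbox])
  moreover from this have "compact (closure {x. bump c a b x \<noteq> 0})"
    by (meson bounded_cbox bounded_subset closed_closure compact_eq_bounded_closed)
  ultimately show ?thesis using assms Ck_bump by (auto simp: test_functions_def)
qed

lemma bump_tendsto_indicator: "(\<lambda>n. bump (1 / real (Suc n)) a b x) \<longlonglongrightarrow> indicator (box a b) x"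
proof (cases "x \<in> box a b")
  case True
  have flat1: "(\<lambda>n. flat (1 / real (Suc n)) 1 t) \<longlonglongrightarrow> 1" if "t > 0" for t
  proof -
    have "(\<lambda>n. exp (- (1 / real (Suc n)) / t)) \<longlonglongrightarrow> exp (- 0 / t)"
      by (intro tendsto_intros LIMSEQ_Suc [OF lim_1_over_n]) (use that in auto)
    then show ?thesis using that by (simp add: flat_def)
  qed
  have "(\<lambda>n. bump (1 / real (Suc n)) a b x) \<longlonglongrightarrow> (\<Prod>i\<in>(UNIV :: 'a set). 1 * 1)"
    unfolding bump_def using True by (intro tendsto_prod tendsto_mult flat1) (auto simp: mem_box_cart)
  then show ?thesis using True by simp
qed (simp add: bump_eq_0)

section \<open>Functions annihilated by all test functions\<close>

text \<open>Completeness: the preimages differ inside a null set. This gives measurability of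
  \<open>dir_deriv\<close> and \<open>weak_partial\<close>, whose values are controlled only almost
  everywhere.\<close>

lemma borel_measurable_lebesgue_on_cong_AE:
  fixes f g :: "'a::euclidean_space \<Rightarrow> 'b::topological_space"
  assumes U: "U \<in> sets lebesgue" and g: "g \<in> borel_measurable (lebesgue_on U)"
    and ae: "AE x in lebesgue. x \<in> U \<longrightarrow> f x = g x"
  shows "f \<in> borel_measurable (lebesgue_on U)"
proof (rule measurableI)
  obtain N where N: "N \<in> null_sets lebesgue" "{x. \<not> (x \<in> U \<longrightarrow> f x = g x)} \<subseteq> N"
    using ae by (auto simp: eventually_ae_filter)
  fix S :: "'b set" assume S: "S \<in> sets borel"
  have "f -` S \<inter> U = ((g -` S \<inter> U) - N) \<union> (f -` S \<inter> U \<inter> N)"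
    using N(2) by auto
  moreover have "g -` S \<inter> U \<in> sets lebesgue"
    using measurable_sets [OF g S] U by (simp add: sets_restrict_space_iff space_restrict_space Int_ac)
  moreover have "f -` S \<inter> U \<inter> N \<in> sets lebesgue"
    using N(1) by (metis Int_lower2 null_sets_completion_subset null_setsD2)
  ultimately have "f -` S \<inter> U \<in> sets lebesgue"
    using N(1) by (metis null_setsD2 sets.Diff sets.Un)
  then show "f -` S \<inter> space (lebesgue_on U) \<in> sets (lebesgue_on U)"
    using U by (simp add: sets_restrict_space_iff space_restrict_space)
qed simp


lemma sigma_finite_lebesgue: "sigma_finite_measure (lebesgue :: 'a::euclidean_space measure)"
proof
  have "range (\<lambda>n::nat. cball (0::'a) (real n)) \<subseteq> sets lebesgue" by auto
  moreover have "\<Union>(range (\<lambda>n::nat. cball (0::'a) (real n))) = space lebesgue"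
    using real_arch_simple by auto
  moreover have "emeasure lebesgue (cball (0::'a) (real n)) \<noteq> \<infinity>" for n
    using emeasure_bounded_finite [OF bounded_cball, of "0::'a" "real n"] by simp
  ultimately show "\<exists>A. countable A \<and> A \<subseteq> sets (lebesgue :: 'a measure) \<and> \<Union> A = space lebesgue \<and>
      (\<forall>a\<in>A. emeasure lebesgue a \<noteq> \<infinity>)"
    by (intro exI [of _ "range (\<lambda>n::nat. cball (0::'a) (real n))"] conjI ballI) auto
qed

text \<open>Boxes are stable under intersection and generate the Borel sets, so vanishing integrals
  spread to all of them; \<open>total\<close> handles complements, as the whole space is not a box.
  A Lebesgue set is Borel up to a null set.\<close>

lemma AE_zero_if_box_integrals_zero:
  fixes G :: "'a::euclidean_space \<Rightarrow> 'b::euclidean_space"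
  assumes int: "integrable lebesgue G"
    and box: "\<And>a b. set_lebesgue_integral lebesgue (box a b) G = 0"
    and total: "integral\<^sup>L lebesgue G = 0"
  shows "AE x in lebesgue. G x = 0"
proof (rule sigma_finite_measure.density_zero [OF sigma_finite_lebesgue int])
  let ?B = "range (\<lambda>(a, b). box a b :: 'a set)"
  have sets_borel: "sets (borel :: 'a measure) = sigma_sets UNIV ?B"
    by (subst borel_eq_box) (rule sets_measure_of, simp)
  have set_int: "set_integrable lebesgue A G" if "A \<in> sets lebesgue" for A
    using int that by (simp add: set_integrable_def integrable_mult_indicator)
  have leb: "A \<in> sets lebesgue" if "A \<in> sigma_sets UNIV ?B" for A
    using that sets_borel by (metis sets_completionI_sets sets_lborel)
  have borel: "set_lebesgue_integral lebesgue A G = 0" if "A \<in> sigma_sets UNIV ?B" for A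
  proof (rule sigma_sets_induct_disjoint [OF _ _ that, where P = "\<lambda>A. set_lebesgue_integral lebesgue A G = 0"])
    show "Int_stable ?B"
      by (force simp: Int_stable_def box_Int_box)
    show "set_lebesgue_integral lebesgue {} G = 0" by (simp add: set_lebesgue_integral_def)
    show "set_lebesgue_integral lebesgue A G = 0" if "A \<in> ?B" for A using that box by auto
    show "set_lebesgue_integral lebesgue (UNIV - A) G = 0"
      if "A \<in> sigma_sets UNIV ?B" "set_lebesgue_integral lebesgue A G = 0" for A
    proof -
      have "set_lebesgue_integral lebesgue (UNIV - A) G
          = (LINT x|lebesgue. G x - indicator A x *\<^sub>R G x)"
        unfolding set_lebesgue_integral_def
        by (rule Bochner_Integration.integral_cong) (auto simp: indicator_def)
      also have "\<dots> = integral\<^sup>L lebesgue G - set_lebesgue_integral lebesgue A G"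
        unfolding set_lebesgue_integral_def
        using int set_int [OF leb [OF that(1)]] by (intro Bochner_Integration.integral_diff) (auto simp: set_integrable_def)
      finally show ?thesis using that(2) total by simp
    qed
    show "set_lebesgue_integral lebesgue (\<Union>i. A i) G = 0"
      if A: "disjoint_family A" "range A \<subseteq> sigma_sets UNIV ?B"
        "\<And>i. set_lebesgue_integral lebesgue (A i) G = 0" for A :: "nat \<Rightarrow> 'a set"
    proof -
      have Al: "A i \<in> sets lebesgue" for i using A(2) leb by blast
      have "(LINT x:(\<Union>i. A i)|lebesgue. G x) = (\<Sum>i. (LINT x:(A i)|lebesgue. G x))"
        using A(1) Al set_int by (intro lebesgue_integral_countable_add) (auto simp: disjoint_family_on_def)
      then show ?thesis using A(3) by simp
    qed
  qed auto
  fix A :: "'a set" assume "A \<in> sets lebesgue"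
  then obtain S N N' where A: "A = S \<union> N" "N \<subseteq> N'" "N' \<in> null_sets lborel" "S \<in> sets lborel"
    by (rule sets_completionE)
  have "AE x in lebesgue. x \<notin> N'" using A(3) by (intro AE_completion AE_not_in)
  then have "AE x in lebesgue. indicator A x *\<^sub>R G x = indicator S x *\<^sub>R G x"
    by eventually_elim (use A(1,2) in \<open>auto simp: indicator_def\<close>)
  moreover have "S \<in> sets lebesgue" using A(4) by (rule sets_completionI_sets)
  ultimately have "set_lebesgue_integral lebesgue A G = set_lebesgue_integral lebesgue S G"
    unfolding set_lebesgue_integral_def
    using set_int [of A] set_int [of S] \<open>A \<in> sets lebesgue\<close>
    by (intro integral_cong_AE) (auto simp: set_integrable_def)
  also have "\<dots> = 0" using borel [of S] A(4) sets_borel by simp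
  finally show "set_lebesgue_integral lebesgue A G = 0" .
qed

text \<open>On a box whose closure lies in U, \<open>g\<close> is integrable, and bumps converge
  boundedly to indicators of smaller boxes, so all box integrals vanish. Countably many such boxes
  cover U.\<close>

lemma AE_zero_if_test_integrals_zero:
  fixes g :: "real^'m \<Rightarrow> 'b::euclidean_space"
  assumes U: "open U" and g: "locally_integrable U g"
    and test: "\<And>\<phi>. \<phi> \<in> test_functions U \<Longrightarrow> (LINT x|lebesgue_on U. \<phi> x *\<^sub>R g x) = 0"
  shows "AE x in lebesgue. x \<in> U \<longrightarrow> g x = 0"
proof -
  have U_leb: "U \<in> sets lebesgue" using U by (simp add: borel_open)
  have on_box: "AE x in lebesgue. x \<in> box c d \<longrightarrow> g x = 0" if cd: "cbox c d \<subseteq> U" for c d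
  proof -
    have "integrable (lebesgue_on (cbox c d)) g" using g cd by (simp add: locally_integrable_def)
    then have intc: "integrable lebesgue (\<lambda>x. indicator (cbox c d) x *\<^sub>R g x)"
      by (subst (asm) integrable_restrict_space) auto
    define H where "H = (\<lambda>x. indicator (box c d) x *\<^sub>R g x)"
    have H_eq: "H = (\<lambda>x. indicator (box c d) x *\<^sub>R (indicator (cbox c d) x *\<^sub>R g x))"
      using box_subset_cbox by (fastforce simp: H_def indicator_def fun_eq_iff)
    have H: "integrable lebesgue H" unfolding H_eq by (rule integrable_mult_indicator [OF _ intc]) simp
    have zero: "set_lebesgue_integral lebesgue (box a b) H = 0" for a b
    proof -
      \<comment> \<open>Two boxes meet in a box, possibly empty. A nonempty one has its closure
        inside U and thus carries an admissible bump.\<close>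
      obtain a' b' where ab': "box a b \<inter> box c d = box a' b'" using box_Int_box by blast
      have bumpH: "(LINT x|lebesgue. bump e a' b' x *\<^sub>R H x) = 0" if "e > 0" for e
      proof (cases "box a' b' = {}")
        case True
        then show ?thesis using bump_eq_0 [of _ a' b' e] by simp
      next
        case False
        have "closure (box a' b') \<subseteq> closure (box c d)" using ab' by (intro closure_mono) blast
        also have "\<dots> \<subseteq> cbox c d" by (rule closure_minimal [OF box_subset_cbox closed_cbox])
        finally have "cbox a' b' \<subseteq> U" using False cd by (simp add: closure_box)
        then have 0: "(LINT x|lebesgue_on U. bump e a' b' x *\<^sub>R g x) = 0"
          by (intro test bump_test_function that)
        have sub: "box a' b' \<subseteq> U" "box a' b' \<subseteq> box c d"
          using ab' \<open>cbox a' b' \<subseteq> U\<close> box_subset_cbox by blast+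
        have "(LINT x|lebesgue_on U. bump e a' b' x *\<^sub>R g x)
            = (LINT x|lebesgue. indicator U x *\<^sub>R (bump e a' b' x *\<^sub>R g x))"
          using U_leb by (intro integral_restrict_space) simp
        also have "\<dots> = (LINT x|lebesgue. bump e a' b' x *\<^sub>R H x)"
          using sub bump_eq_0 [of _ a' b' e]
          by (intro Bochner_Integration.integral_cong refl) (auto simp: H_def indicator_def)
        finally show ?thesis using 0 by simp
      qed
      have "(\<lambda>n. LINT x|lebesgue. bump (1 / real (Suc n)) a' b' x *\<^sub>R H x)
          \<longlonglongrightarrow> (LINT x|lebesgue. indicator (box a' b') x *\<^sub>R H x)"
      proof (rule integral_dominated_convergence [where w = "\<lambda>x. norm (H x)"])
        have bm: "bump e a' b' \<in> borel_measurable lebesgue" if "e > 0" for e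
          using Ck_bump [OF that, of 0 a' b']
          by (intro measurable_completion) (simp add: borel_measurable_continuous_onI)
        show "(\<lambda>x. bump (1 / real (Suc n)) a' b' x *\<^sub>R H x) \<in> borel_measurable lebesgue" for n
          using bm [of "1 / real (Suc n)"] H by (intro borel_measurable_scaleR) auto
        show "(\<lambda>x. indicator (box a' b') x *\<^sub>R H x) \<in> borel_measurable lebesgue"
          by (rule borel_measurable_integrable [OF integrable_mult_indicator [OF _ H]]) simp
        show "AE x in lebesgue. (\<lambda>n. bump (1 / real (Suc n)) a' b' x *\<^sub>R H x) \<longlonglongrightarrow> indicator (box a' b') x *\<^sub>R H x"
          by (intro AE_I2 tendsto_scaleR bump_tendsto_indicator tendsto_const)
        show "AE x in lebesgue. norm (bump (1 / real (Suc n)) a' b' x *\<^sub>R H x) \<le> norm (H x)" for n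
          using bump_le_1 [of "1 / real (Suc n)" a' b'] bump_nonneg [of "1 / real (Suc n)" a' b']
          by (intro AE_I2) (simp add: mult_left_le_one_le)
      qed (use H in simp)
      then have "(LINT x|lebesgue. indicator (box a' b') x *\<^sub>R H x) = 0"
        using bumpH by (simp add: LIMSEQ_const_iff)
      also have "(LINT x|lebesgue. indicator (box a' b') x *\<^sub>R H x) = set_lebesgue_integral lebesgue (box a b) H"
        unfolding set_lebesgue_integral_def ab' [symmetric]
        by (intro Bochner_Integration.integral_cong refl) (auto simp: H_def indicator_def)
      finally show ?thesis .
    qed
    have "integral\<^sup>L lebesgue H = set_lebesgue_integral lebesgue (box c d) H"
      unfolding set_lebesgue_integral_def
      by (intro Bochner_Integration.integral_cong refl) (auto simp: H_def indicator_def)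
    then have "AE x in lebesgue. H x = 0" using zero by (intro AE_zero_if_box_integrals_zero H) auto
    then show ?thesis by eventually_elim (auto simp: H_def)
  qed
  define F where "F = {box c d |c d. cbox c d \<subseteq> U}"
  obtain F' where F': "F' \<subseteq> F" "countable F'" "\<Union>F' = \<Union>F"
    using Lindelof [of F] by (auto simp: F_def)
  have "AE x in lebesgue. \<forall>B\<in>F'. x \<in> B \<longrightarrow> g x = 0"
    using F' on_box by (subst AE_ball_countable) (auto simp: F_def)
  moreover have "U \<subseteq> \<Union>F"
  proof
    fix x assume "x \<in> U"
    then obtain c d where cd: "cbox c d \<subseteq> U" "x \<in> box c d" using open_contains_cbox [OF U] by metis
    then have "box c d \<in> F" by (auto simp: F_def)
    with cd(2) show "x \<in> \<Union>F" by (rule UnionI [rotated])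
  qed
  ultimately show ?thesis using F'(3) by (auto elim!: eventually_mono)
qed

section \<open>Weak derivatives of Lipschitz functions\<close>

text \<open>McShane's formula: the infimum of the cones f y + L dist x y. Extension to the whole
  space is what makes translations and full lines available.\<close>

lemma lipschitz_extension_real:
  fixes f :: "'a::metric_space \<Rightarrow> real"
  assumes f: "L-lipschitz_on S f"
  shows "\<exists>F. L-lipschitz_on UNIV F \<and> (\<forall>x\<in>S. F x = f x)"
proof (cases "S = {}")
  case True
  then show ?thesis using lipschitz_on_nonneg [OF f] by (intro exI [of _ "\<lambda>x. 0"]) (auto simp: lipschitz_on_def)
next
  case False
  then obtain z where z: "z \<in> S" by blast
  have L: "L \<ge> 0" by (rule lipschitz_on_nonneg [OF f])
  define F where "F = (\<lambda>x. INF y\<in>S. f y + L * dist x y)"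
  have f_le: "f x - f y \<le> L * dist x y" if "x \<in> S" "y \<in> S" for x y
    using lipschitz_onD [OF f that] by (simp add: dist_real_def)
  have bdd: "bdd_below ((\<lambda>y. f y + L * dist x y) ` S)" for x
  proof (rule bdd_belowI2)
    fix y assume "y \<in> S"
    then have "f z - f y \<le> L * dist z y" by (rule f_le [OF z])
    also have "\<dots> \<le> L * (dist x z + dist x y)" using L dist_triangle3 by (intro mult_left_mono) auto
    finally show "f z - L * dist x z \<le> f y + L * dist x y" by (simp add: algebra_simps)
  qed
  have le: "F x \<le> F y + L * dist x y" for x y
  proof -
    have "F x - L * dist x y \<le> F y"
      unfolding F_def
    proof (rule cINF_greatest [OF False])
      fix w assume w: "w \<in> S"
      have "(INF w\<in>S. f w + L * dist x w) \<le> f w + L * dist x w" by (rule cINF_lower [OF bdd w])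
      also have "\<dots> \<le> f w + L * (dist x y + dist y w)"
        using L dist_triangle by (intro add_left_mono mult_left_mono) auto
      finally show "(INF w\<in>S. f w + L * dist x w) - L * dist x y \<le> f w + L * dist y w"
        by (simp add: algebra_simps)
    qed
    then show ?thesis by simp
  qed
  have "L-lipschitz_on UNIV F"
    using le [of _ _] L by (intro lipschitz_onI) (auto simp: dist_real_def abs_le_iff, metis diff_le_eq add.commute, metis diff_le_eq add.commute dist_commute)
  moreover have "F x = f x" if "x \<in> S" for x
  proof (rule antisym)
    show "F x \<le> f x" using cINF_lower [OF bdd [of x] that] by (simp add: F_def)
    show "f x \<le> F x" unfolding F_def
      by (rule cINF_greatest [OF False]) (use f_le [OF that] in \<open>simp add: algebra_simps\<close>)
  qed
  ultimately show ?thesis by blast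
qed

text \<open>Coordinatewise extension, at the price of the dimension as a factor. The loss is
  harmless: derivative bounds are later read off from \<open>f\<close> on U, not from the
  extension.\<close>

lemma lipschitz_extension:
  fixes f :: "'a::metric_space \<Rightarrow> 'b::euclidean_space"
  assumes f: "L-lipschitz_on S f"
  obtains C F where "C-lipschitz_on UNIV F" "\<And>x. x \<in> S \<Longrightarrow> F x = f x"
proof -
  have "\<exists>F. L-lipschitz_on UNIV F \<and> (\<forall>x\<in>S. F x = f x \<bullet> b)" if "b \<in> Basis" for b
  proof (rule lipschitz_extension_real, rule lipschitz_onI)
    fix x y assume xy: "x \<in> S" "y \<in> S"
    have "dist (f x \<bullet> b) (f y \<bullet> b) = \<bar>(f x - f y) \<bullet> b\<bar>" by (simp add: dist_real_def inner_diff_left)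
    also have "\<dots> \<le> norm (f x - f y)" by (rule Basis_le_norm [OF that])
    also have "\<dots> \<le> L * dist x y" using lipschitz_onD [OF f xy] by (simp add: dist_norm)
    finally show "dist (f x \<bullet> b) (f y \<bullet> b) \<le> L * dist x y" .
  qed (rule lipschitz_on_nonneg [OF f])
  then have "\<forall>b. \<exists>F. b \<in> Basis \<longrightarrow> L-lipschitz_on UNIV F \<and> (\<forall>x\<in>S. F x = f x \<bullet> b)" by blast
  from choice [OF this] obtain F where F: "\<And>b. b \<in> Basis \<Longrightarrow> L-lipschitz_on UNIV (F b)"
      "\<And>b x. b \<in> Basis \<Longrightarrow> x \<in> S \<Longrightarrow> F b x = f x \<bullet> b"
    by blast
  show thesis
  proof
    show "(real DIM('b) * L)-lipschitz_on UNIV (\<lambda>x. \<Sum>b\<in>Basis. F b x *\<^sub>R b)"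
    proof (rule lipschitz_onI)
      fix x y :: 'a
      have "dist (\<Sum>b\<in>Basis. F b x *\<^sub>R b) (\<Sum>b\<in>Basis. F b y *\<^sub>R b) = norm (\<Sum>b\<in>Basis. (F b x - F b y) *\<^sub>R b)"
        by (simp add: dist_norm sum_subtractf scaleR_diff_left)
      also have "\<dots> \<le> (\<Sum>b\<in>(Basis :: 'b set). L * dist x y)"
        using lipschitz_onD [OF F(1), of _ x y] by (intro sum_norm_le) (simp add: dist_real_def)
      finally show "dist (\<Sum>b\<in>Basis. F b x *\<^sub>R b) (\<Sum>b\<in>Basis. F b y *\<^sub>R b) \<le> real DIM('b) * L * dist x y"
        by simp
    qed (use lipschitz_on_nonneg [OF f] in simp)
    show "(\<Sum>b\<in>Basis. F b x *\<^sub>R b) = f x" if "x \<in> S" for x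
      using F(2) that by (simp add: euclidean_representation)
  qed
qed

text \<open>Total by way of \<open>vector_derivative\<close>, hence meaningful only where the
  derivative along the line exists.\<close>

definition dir_deriv :: "'a::real_normed_vector \<Rightarrow> ('a \<Rightarrow> 'b::real_normed_vector) \<Rightarrow> 'a \<Rightarrow> 'b" where
  "dir_deriv e f x = vector_derivative (\<lambda>t. f (x + t *\<^sub>R e)) (at 0)"

lemma lipschitz_has_dir_deriv_AE_UNIV:
  fixes F :: "'a::euclidean_space \<Rightarrow> 'b::euclidean_space"
  assumes F: "C-lipschitz_on UNIV F"
  shows "AE x in lborel. ((\<lambda>t. F (x + t *\<^sub>R e)) has_vector_derivative dir_deriv e F x) (at 0)"
proof -
  have "AE x in lborel. \<exists>l. ((\<lambda>h. (F (x + h *\<^sub>R e) \<bullet> b - F x \<bullet> b) / h) \<longlongrightarrow> l) (at 0)" if "b \<in> Basis" for b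
  proof (rule lipschitz_directional_quotient_AE)
    show "C-lipschitz_on UNIV (\<lambda>x. F x \<bullet> b)"
    proof (rule lipschitz_onI)
      fix x y
      have "dist (F x \<bullet> b) (F y \<bullet> b) = \<bar>(F x - F y) \<bullet> b\<bar>" by (simp add: dist_real_def inner_diff_left)
      also have "\<dots> \<le> norm (F x - F y)" by (rule Basis_le_norm [OF that])
      also have "\<dots> \<le> C * dist x y" using lipschitz_onD [OF F, of x y] by (simp add: dist_norm)
      finally show "dist (F x \<bullet> b) (F y \<bullet> b) \<le> C * dist x y" .
    qed (rule lipschitz_on_nonneg [OF F])
  qed
  then have "AE x in lborel. \<forall>b\<in>Basis. \<exists>l. ((\<lambda>h. (F (x + h *\<^sub>R e) \<bullet> b - F x \<bullet> b) / h) \<longlongrightarrow> l) (at 0)"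
    by (intro AE_finite_allI) auto
  then show ?thesis
  proof eventually_elim
    case (elim x)
    then have "\<forall>b. \<exists>l. b \<in> Basis \<longrightarrow> ((\<lambda>h. (F (x + h *\<^sub>R e) \<bullet> b - F x \<bullet> b) / h) \<longlongrightarrow> l) (at 0)" by blast
    from choice [OF this] obtain l
      where l: "\<And>b. b \<in> Basis \<Longrightarrow> ((\<lambda>h. (F (x + h *\<^sub>R e) \<bullet> b - F x \<bullet> b) / h) \<longlongrightarrow> l b) (at 0)" by blast
    have "((\<lambda>h. (F (x + h *\<^sub>R e) - F x) /\<^sub>R h) \<longlongrightarrow> (\<Sum>b\<in>Basis. l b *\<^sub>R b)) (at 0)"
      using l by (subst tendsto_componentwise_iff) (auto simp: inner_diff_left divide_inverse mult.commute)
    then have "((\<lambda>t. F (x + t *\<^sub>R e)) has_vector_derivative (\<Sum>b\<in>Basis. l b *\<^sub>R b)) (at 0)"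
      by (simp add: has_vector_derivative_at_iff_quotient)
    then show ?case unfolding dir_deriv_def by (metis vector_derivative_at)
  qed
qed

lemma has_vector_derivative_line_cong:
  fixes f g :: "'a::real_normed_vector \<Rightarrow> 'b::real_normed_vector"
  assumes U: "open U" "x \<in> U" and eq: "\<And>y. y \<in> U \<Longrightarrow> f y = g y"
    and f: "((\<lambda>t. f (x + t *\<^sub>R e)) has_vector_derivative D) (at 0)"
  shows "((\<lambda>t. g (x + t *\<^sub>R e)) has_vector_derivative D) (at 0)"
proof (rule has_vector_derivative_transform_within_open [OF f])
  show "open ((\<lambda>t. x + t *\<^sub>R e) -` U)" by (intro open_vimage U continuous_intros)
qed (use U eq in auto)

lemma lipschitz_has_dir_deriv_AE:
  fixes f :: "'a::euclidean_space \<Rightarrow> 'b::euclidean_space"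
  assumes f: "L-lipschitz_on U f" and U: "open U"
  shows "AE x in lebesgue. x \<in> U \<longrightarrow> ((\<lambda>t. f (x + t *\<^sub>R e)) has_vector_derivative dir_deriv e f x) (at 0)"
proof -
  obtain C F where F: "C-lipschitz_on UNIV F" "\<And>x. x \<in> U \<Longrightarrow> F x = f x"
    using lipschitz_extension [OF f] by metis
  have "AE x in lebesgue. ((\<lambda>t. F (x + t *\<^sub>R e)) has_vector_derivative dir_deriv e F x) (at 0)"
    by (rule AE_completion [OF lipschitz_has_dir_deriv_AE_UNIV [OF F(1)]])
  then show ?thesis
  proof eventually_elim
    case (elim x)
    show ?case
    proof
      assume "x \<in> U"
      from has_vector_derivative_line_cong [OF U this F(2) elim]
      show "((\<lambda>t. f (x + t *\<^sub>R e)) has_vector_derivative dir_deriv e f x) (at 0)"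
        unfolding dir_deriv_def by (metis vector_derivative_at)
    qed
  qed
qed

text \<open>Besides supplying dominating constants, this bound is later applied to
  \<open>A - B n\<close>, whose Lipschitz constants tend to 0: smallness in the Lipschitz norm
  becomes pointwise smallness of derivatives.\<close>

lemma norm_directional_derivative_le:
  fixes f :: "'a::real_normed_vector \<Rightarrow> 'b::real_normed_vector"
  assumes f: "L-lipschitz_on U f" and U: "open U" "x \<in> U"
    and D: "((\<lambda>t. f (x + t *\<^sub>R e)) has_vector_derivative D) (at 0)"
  shows "norm D \<le> L * norm e"
proof (rule tendsto_upperbound)
  show "((\<lambda>h. norm ((f (x + h *\<^sub>R e) - f x) /\<^sub>R h)) \<longlongrightarrow> norm D) (at 0)"
    using D by (intro tendsto_norm) (simp add: has_vector_derivative_at_iff_quotient)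
  have "open ((\<lambda>t. x + t *\<^sub>R e) -` U)" by (intro open_vimage U continuous_intros)
  then have "\<forall>\<^sub>F h in at 0. h \<noteq> 0 \<and> x + h *\<^sub>R e \<in> U"
    unfolding eventually_at_topological by (rule exI [of _ "(\<lambda>t. x + t *\<^sub>R e) -` U", OF conjI]) (use U in auto)
  then show "\<forall>\<^sub>F h in at 0. norm ((f (x + h *\<^sub>R e) - f x) /\<^sub>R h) \<le> L * norm e"
  proof eventually_elim
    case (elim h)
    then have "norm (f (x + h *\<^sub>R e) - f x) \<le> L * norm (h *\<^sub>R e)"
      using lipschitz_onD [OF f, of "x + h *\<^sub>R e" x] U by (simp add: dist_norm)
    moreover have "norm ((f (x + h *\<^sub>R e) - f x) /\<^sub>R h) = norm (f (x + h *\<^sub>R e) - f x) / \<bar>h\<bar>"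
      by (simp add: divide_inverse mult.commute)
    ultimately show ?case using elim by (simp add: divide_le_eq mult_ac)
  qed
qed simp

lemma integral_lborel_translate:
  fixes g :: "'a::euclidean_space \<Rightarrow> 'b::euclidean_space"
  assumes [measurable]: "g \<in> borel_measurable borel"
  shows "(LINT x|lborel. g (x + a)) = (LINT x|lborel. g x)"
proof -
  have "(LINT x|lborel. g x) = (LINT x|distr lborel borel ((+) a). g x)" by (simp add: lborel_distr_plus)
  also have "\<dots> = (LINT x|lborel. g (a + x))" by (rule integral_distr) measurable
  finally show ?thesis by (simp add: add.commute)
qed

lemma integrable_lborel_compact_support:
  fixes g :: "'a::euclidean_space \<Rightarrow> 'b::euclidean_space"
  assumes "continuous_on UNIV g" "compact K" "\<And>x. x \<notin> K \<Longrightarrow> g x = 0"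
  shows "integrable lborel g"
proof -
  have "integrable lborel (\<lambda>x. indicator K x *\<^sub>R g x)"
    by (rule borel_integrable_compact [OF assms(2) continuous_on_subset [OF assms(1)]]) simp
  also have "(\<lambda>x. indicator K x *\<^sub>R g x) = g" using assms(3) by (auto simp: indicator_def fun_eq_iff)
  finally show ?thesis .
qed

lemma test_functionE:
  assumes "\<phi> \<in> test_functions U"
  obtains K where "compact K" "K \<subseteq> U" "\<And>x. x \<notin> K \<Longrightarrow> \<phi> x = 0"
    "continuous_on UNIV \<phi>" "\<And>x. (\<phi> has_derivative frechet_derivative \<phi> (at x)) (at x)"
    "\<And>i. continuous_on UNIV (\<lambda>x. frechet_derivative \<phi> (at x) (axis i 1))"
    "\<And>x i. x \<notin> K \<Longrightarrow> frechet_derivative \<phi> (at x) (axis i 1) = 0"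
proof
  let ?K = "closure {x. \<phi> x \<noteq> 0}"
  have Ck: "\<And>k. Ck k \<phi>" using assms by (simp add: test_functions_def)
  show "compact ?K" "?K \<subseteq> U" using assms by (auto simp: test_functions_def)
  show 0: "\<phi> x = 0" if "x \<notin> ?K" for x
    using that subsetD [OF closure_subset, of x "{x. \<phi> x \<noteq> 0}"] by auto
  show "continuous_on UNIV \<phi>" using Ck [of 0] by simp
  show "(\<phi> has_derivative frechet_derivative \<phi> (at x)) (at x)" for x
    using Ck [of "Suc 0"] by (simp add: frechet_derivative_works [symmetric])
  show "continuous_on UNIV (\<lambda>x. frechet_derivative \<phi> (at x) (axis i 1))" for i
    using Ck [of "Suc 0"] by simp
  show "frechet_derivative \<phi> (at x) (axis i 1) = 0" if "x \<notin> ?K" for x i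
  proof -
    have "((\<lambda>x. 0) has_derivative (\<lambda>v. 0)) (at x)" by simp
    then have "(\<phi> has_derivative (\<lambda>v. 0)) (at x)"
    proof (rule has_derivative_transform_within_open)
      show "open (- ?K)" by (rule open_Compl [OF closed_closure])
      show "x \<in> - ?K" using that unfolding Compl_iff .
      show "0 = \<phi> y" if "y \<in> - ?K" for y using 0 [of y] that unfolding Compl_iff by metis
    qed
    from frechet_derivative_at [OF this] show ?thesis by metis
  qed
qed

lemma integrable_test_scaleR:
  assumes U: "open U" and \<phi>: "\<phi> \<in> test_functions U" and g: "locally_integrable U g"
  shows "integrable (lebesgue_on U) (\<lambda>x. \<phi> x *\<^sub>R g x)"
proof -
  obtain K where K: "compact K" "K \<subseteq> U" "\<And>x. x \<notin> K \<Longrightarrow> \<phi> x = 0" and cont: "continuous_on UNIV \<phi>"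
    using test_functionE [OF \<phi>] by metis
  have K_leb: "K \<in> sets lebesgue" using K(1) by (simp add: borel_compact)
  have U_leb: "U \<in> sets lebesgue" using U by (simp add: borel_open)
  have "integrable (lebesgue_on K) g" using g K by (simp add: locally_integrable_def)
  then have int: "integrable lebesgue (\<lambda>x. indicator K x *\<^sub>R g x)"
    using K_leb by (subst (asm) integrable_restrict_space) auto
  have "bounded (\<phi> ` K)" using K(1) cont by (meson compact_continuous_image compact_imp_bounded continuous_on_subset subset_UNIV)
  then obtain B where B: "\<And>x. x \<in> K \<Longrightarrow> \<bar>\<phi> x\<bar> \<le> B" by (auto simp: bounded_iff)
  have "integrable lebesgue (\<lambda>x. \<phi> x *\<^sub>R (indicator K x *\<^sub>R g x))"
  proof (rule Bochner_Integration.integrable_bound)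
    show "integrable lebesgue (\<lambda>x. B *\<^sub>R (indicator K x *\<^sub>R g x))" using int by (rule integrable_scaleR_right)
    have "\<phi> \<in> borel_measurable lebesgue"
      by (intro measurable_completion) (simp add: cont borel_measurable_continuous_onI)
    then show "(\<lambda>x. \<phi> x *\<^sub>R (indicator K x *\<^sub>R g x)) \<in> borel_measurable lebesgue"
      by (rule borel_measurable_scaleR) (rule borel_measurable_integrable [OF int])
    show "AE x in lebesgue. norm (\<phi> x *\<^sub>R (indicator K x *\<^sub>R g x)) \<le> norm (B *\<^sub>R (indicator K x *\<^sub>R g x))"
      using B by (intro AE_I2) (fastforce simp: indicator_def intro!: mult_right_mono)
  qed
  also have "(\<lambda>x. \<phi> x *\<^sub>R (indicator K x *\<^sub>R g x)) = (\<lambda>x. indicator U x *\<^sub>R (\<phi> x *\<^sub>R g x))"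
    using K by (auto simp: indicator_def fun_eq_iff)
  finally show ?thesis using U_leb by (subst integrable_restrict_space) auto
qed

text \<open>The fundamental lemma applied to the difference. It pins down
  \<open>weak_partial\<close>, which is an arbitrary choice among the weak derivatives.\<close>

lemma has_weak_partial_unique_AE:
  assumes U: "open U" and g: "has_weak_partial U i f g" and g': "has_weak_partial U i f g'"
  shows "AE x in lebesgue. x \<in> U \<longrightarrow> g x = g' x"
proof -
  have loc: "locally_integrable U g" "locally_integrable U g'" using g g' by (auto simp: has_weak_partial_def)
  have "AE x in lebesgue. x \<in> U \<longrightarrow> g x - g' x = 0"
  proof (rule AE_zero_if_test_integrals_zero [OF U])
    show "locally_integrable U (\<lambda>x. g x - g' x)" using loc by (auto simp: locally_integrable_def)
    fix \<phi> assume \<phi>: "\<phi> \<in> test_functions U"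
    have "(LINT x|lebesgue_on U. \<phi> x *\<^sub>R g x) = (LINT x|lebesgue_on U. \<phi> x *\<^sub>R g' x)"
      using bspec [OF conjunct2 [OF conjunct2 [OF g [unfolded has_weak_partial_def]]] \<phi>]
        bspec [OF conjunct2 [OF conjunct2 [OF g' [unfolded has_weak_partial_def]]] \<phi>]
      by simp
    then show "(LINT x|lebesgue_on U. \<phi> x *\<^sub>R (g x - g' x)) = 0"
      using integrable_test_scaleR [OF U \<phi> loc(1)] integrable_test_scaleR [OF U \<phi> loc(2)]
      by (simp add: scaleR_diff_right)
  qed
  then show ?thesis by simp
qed

text \<open>A Borel representative of the directional derivative, obtained as the sequential limit
  of difference quotients with steps 1/(n+1).\<close>

lemma lipschitz_dir_deriv_limit:
  fixes F :: "'a::euclidean_space \<Rightarrow> 'b::euclidean_space"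
  assumes F: "C-lipschitz_on UNIV F"
  obtains G where "G \<in> borel_measurable borel" "AE x in lborel. G x = dir_deriv e F x"
    "AE x in lborel. (\<lambda>n. (F (x + (1 / real (Suc n)) *\<^sub>R e) - F x) /\<^sub>R (1 / real (Suc n))) \<longlonglongrightarrow> G x"
proof -
  let ?q = "\<lambda>n x. (F (x + (1 / real (Suc n)) *\<^sub>R e) - F x) /\<^sub>R (1 / real (Suc n))"
  have [measurable]: "F \<in> borel_measurable borel"
    by (rule borel_measurable_continuous_onI [OF lipschitz_on_continuous_on [OF F]])
  define G where "G = (\<lambda>x. lim (\<lambda>n. ?q n x))"
  have h: "filterlim (\<lambda>n. 1 / real (Suc n)) (at 0) sequentially"
    using LIMSEQ_Suc [OF lim_1_over_n] by (auto simp: filterlim_at)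
  have conv: "AE x in lborel. (\<lambda>n. ?q n x) \<longlonglongrightarrow> dir_deriv e F x"
    using lipschitz_has_dir_deriv_AE_UNIV [OF F, where e = e]
  proof eventually_elim
    case (elim x)
    then have "((\<lambda>h. (F (x + h *\<^sub>R e) - F x) /\<^sub>R h) \<longlongrightarrow> dir_deriv e F x) (at 0)"
      by (simp add: has_vector_derivative_at_iff_quotient)
    from filterlim_compose [OF this h] show ?case .
  qed
  then have G: "AE x in lborel. G x = dir_deriv e F x"
    by eventually_elim (simp add: G_def limI)
  show thesis
  proof
    show "G \<in> borel_measurable borel" unfolding G_def by measurable
    show "AE x in lborel. G x = dir_deriv e F x" by (rule G)
    show "AE x in lborel. (\<lambda>n. ?q n x) \<longlonglongrightarrow> G x" using conv G by eventually_elim simp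
  qed
qed

lemma dir_deriv_cong_AE:
  fixes f F :: "'a::euclidean_space \<Rightarrow> 'b::euclidean_space"
  assumes U: "open U" and F: "C-lipschitz_on UNIV F" "\<forall>x\<in>U. F x = f x"
  shows "AE x in lebesgue. x \<in> U \<longrightarrow> dir_deriv e f x = dir_deriv e F x"
  using AE_completion [OF lipschitz_has_dir_deriv_AE_UNIV [OF F(1), where e = e]]
proof eventually_elim
  case (elim x)
  show ?case
  proof
    assume "x \<in> U"
    then have "((\<lambda>t. f (x + t *\<^sub>R e)) has_vector_derivative dir_deriv e F x) (at 0)"
      using F(2) by (intro has_vector_derivative_line_cong [OF U _ _ elim]) auto
    then show "dir_deriv e f x = dir_deriv e F x" unfolding dir_deriv_def [of e f] by (rule vector_derivative_at)
  qed
qed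

lemma borel_measurable_dir_deriv:
  fixes f :: "'a::euclidean_space \<Rightarrow> 'b::euclidean_space"
  assumes f: "L-lipschitz_on U f" and U: "open U"
  shows "dir_deriv e f \<in> borel_measurable (lebesgue_on U)"
proof -
  obtain C F where F: "C-lipschitz_on UNIV F" "\<forall>x\<in>U. F x = f x"
    by (rule lipschitz_extension [OF f]) blast
  obtain G where G: "G \<in> borel_measurable borel" "AE x in lborel. G x = dir_deriv e F x"
    by (rule lipschitz_dir_deriv_limit [OF F(1), where e = e]) blast
  show ?thesis
  proof (rule borel_measurable_lebesgue_on_cong_AE)
    show "U \<in> sets lebesgue" using U by (simp add: borel_open)
    show "G \<in> borel_measurable (lebesgue_on U)"
      using G(1) by (intro measurable_restrict_space1 measurable_completion) simp
    show "AE x in lebesgue. x \<in> U \<longrightarrow> dir_deriv e f x = G x"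
      using dir_deriv_cong_AE [OF U F, where e = e] AE_completion [OF G(2)] by eventually_elim auto
  qed
qed


section \<open>Integration by parts\<close>

text \<open>Integration by parts is exact for difference quotients, by translation invariance.
  Dominated convergence on both sides replaces the quotients by derivatives.\<close>

lemma weak_partial_by_difference_quotients:
  fixes F :: "real^'m \<Rightarrow> 'b::euclidean_space"
  assumes F: "C-lipschitz_on UNIV F" and \<phi>: "\<phi> \<in> test_functions U"
    and G: "G \<in> borel_measurable borel"
      "AE x in lborel. (\<lambda>n. (F (x + (1 / real (Suc n)) *\<^sub>R axis i 1) - F x) /\<^sub>R (1 / real (Suc n))) \<longlonglongrightarrow> G x"
  shows "(LINT x|lborel. frechet_derivative \<phi> (at x) (axis i 1) *\<^sub>R F x) = - (LINT x|lborel. \<phi> x *\<^sub>R G x)"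
proof -
  obtain K where K: "compact K" "\<And>x. x \<notin> K \<Longrightarrow> \<phi> x = 0"
    and cont: "continuous_on UNIV \<phi>"
    and der: "\<And>x. (\<phi> has_derivative frechet_derivative \<phi> (at x)) (at x)"
    and dcont: "\<And>i. continuous_on UNIV (\<lambda>x. frechet_derivative \<phi> (at x) (axis i 1))"
    and d0: "\<And>x i. x \<notin> K \<Longrightarrow> frechet_derivative \<phi> (at x) (axis i 1) = 0"
    by (rule test_functionE [OF \<phi>]) blast
  define e :: "real^'m" where "e = axis i 1"
  define d where "d = (\<lambda>x. frechet_derivative \<phi> (at x) e)"
  have e1: "norm e = 1" by (simp add: e_def)
  have d_cont: "continuous_on UNIV d" using dcont by (simp add: d_def e_def)
  have F_cont: "continuous_on UNIV F" by (rule lipschitz_on_continuous_on [OF F])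
  have [measurable]: "F \<in> borel_measurable borel" "\<phi> \<in> borel_measurable borel" "d \<in> borel_measurable borel"
    using F_cont cont d_cont by (auto intro: borel_measurable_continuous_onI)
  note [measurable] = G(1)
  obtain R where R: "K \<subseteq> cball 0 R" using compact_imp_bounded [OF K(1)] by (auto simp: bounded_iff subset_eq)
  have "bounded (d ` K)"
    using K(1) d_cont by (meson compact_continuous_image compact_imp_bounded continuous_on_subset subset_UNIV)
  then obtain B0 where B0: "\<And>x. x \<in> K \<Longrightarrow> \<bar>d x\<bar> \<le> B0" by (auto simp: bounded_iff)
  define B where "B = max B0 0"
  have B: "\<bar>d x\<bar> \<le> B" for x using B0 [of x] d0 [of x i] by (cases "x \<in> K") (auto simp: B_def d_def e_def)
  define h where "h = (\<lambda>n. 1 / real (Suc n))"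
  have h: "0 < h n" "h n \<le> 1" for n by (auto simp: h_def)
  have h0: "filterlim h (at 0) sequentially"
    using LIMSEQ_Suc [OF lim_1_over_n] unfolding h_def by (auto simp: filterlim_at)
  have line: "((\<lambda>t. \<phi> (x - t *\<^sub>R e)) has_real_derivative - d (x - t *\<^sub>R e)) (at t)" for x t
  proof -
    interpret l: linear "frechet_derivative \<phi> (at (x - t *\<^sub>R e))"
      by (rule has_derivative_linear [OF der])
    have "((\<lambda>t. x - t *\<^sub>R e) has_derivative (\<lambda>s. - (s *\<^sub>R e))) (at t)"
      by (auto intro!: derivative_eq_intros)
    note line = has_derivative_compose [OF this der]
    have eq: "(\<lambda>s. frechet_derivative \<phi> (at (x - t *\<^sub>R e)) (- (s *\<^sub>R e))) = (*) (- d (x - t *\<^sub>R e))"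
      by (simp add: fun_eq_iff d_def l.neg l.scale)
    show ?thesis using line unfolding eq has_field_derivative_def .
  qed
  \<comment> \<open>A backward quotient of the test function pairs with the forward quotient
    \<open>P\<close> of \<open>F\<close>.\<close>
  define Q where "Q = (\<lambda>n x. (\<phi> x - \<phi> (x - h n *\<^sub>R e)) / h n)"
  define P where "P = (\<lambda>n x. (F (x + h n *\<^sub>R e) - F x) /\<^sub>R h n)"
  have parts: "(LINT x|lborel. Q n x *\<^sub>R F x) = - (LINT x|lborel. \<phi> x *\<^sub>R P n x)" for n
  proof -
    define g where "g = (\<lambda>x. \<phi> x *\<^sub>R F (x + h n *\<^sub>R e))"
    have i1: "integrable lborel (\<lambda>x. \<phi> x *\<^sub>R F x)"
      using K by (intro integrable_lborel_compact_support [of _ K] continuous_intros cont F_cont) auto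
    have i2: "integrable lborel g" unfolding g_def
      using K by (intro integrable_lborel_compact_support [of _ K] continuous_intros cont
          continuous_on_compose2 [OF F_cont]) auto
    have g_shift: "g (x + - (h n *\<^sub>R e)) = \<phi> (x - h n *\<^sub>R e) *\<^sub>R F x" for x by (simp add: g_def)
    have i3: "integrable lborel (\<lambda>x. \<phi> (x - h n *\<^sub>R e) *\<^sub>R F x)"
    proof (rule integrable_lborel_compact_support [of _ "(+) (h n *\<^sub>R e) ` K"])
      show "continuous_on UNIV (\<lambda>x. \<phi> (x - h n *\<^sub>R e) *\<^sub>R F x)"
        by (intro continuous_intros F_cont continuous_on_compose2 [OF cont]) auto
      show "compact ((+) (h n *\<^sub>R e) ` K)" by (rule compact_translation [OF K(1)])
      show "\<phi> (x - h n *\<^sub>R e) *\<^sub>R F x = 0" if "x \<notin> (+) (h n *\<^sub>R e) ` K" for x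
      proof -
        have "x - h n *\<^sub>R e \<notin> K" using that by (metis add.commute diff_add_cancel image_eqI)
        then show ?thesis by (simp add: K(2))
      qed
    qed
    have shift: "(LINT x|lborel. \<phi> (x - h n *\<^sub>R e) *\<^sub>R F x) = (LINT x|lborel. g x)"
      using integral_lborel_translate [of g "- (h n *\<^sub>R e)"] unfolding g_shift by (simp add: g_def)
    have "(LINT x|lborel. Q n x *\<^sub>R F x) = (LINT x|lborel. (\<phi> x *\<^sub>R F x - \<phi> (x - h n *\<^sub>R e) *\<^sub>R F x) /\<^sub>R h n)"
      by (simp add: Q_def divide_inverse mult.commute scaleR_diff_left flip: scaleR_scaleR)
    also have "\<dots> = ((LINT x|lborel. \<phi> x *\<^sub>R F x) - (LINT x|lborel. g x)) /\<^sub>R h n"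
      using i1 i3 by (simp add: shift)
    also have "\<dots> = - (LINT x|lborel. (g x - \<phi> x *\<^sub>R F x) /\<^sub>R h n)"
      using i1 i2 by (simp flip: scaleR_minus_right)
    also have "(\<lambda>x. (g x - \<phi> x *\<^sub>R F x) /\<^sub>R h n) = (\<lambda>x. \<phi> x *\<^sub>R P n x)"
      by (simp add: g_def P_def fun_eq_iff scaleR_diff_right mult.commute)
    finally show ?thesis .
  qed
  have "(\<lambda>n. LINT x|lborel. Q n x *\<^sub>R F x) \<longlonglongrightarrow> (LINT x|lborel. d x *\<^sub>R F x)"
  \<comment> \<open>Steps are at most 1, so all quotients \<open>Q n\<close> vanish outside the ball
    of radius R + 1; the mean value theorem bounds them by \<open>B\<close>.\<close>
  proof (rule integral_dominated_convergence [where w = "\<lambda>x. indicator (cball 0 (R + 1)) x *\<^sub>R (B * norm (F x))"])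
    show "(\<lambda>x. d x *\<^sub>R F x) \<in> borel_measurable lborel" by measurable
    show "(\<lambda>x. Q n x *\<^sub>R F x) \<in> borel_measurable lborel" for n unfolding Q_def by measurable
    show "integrable lborel (\<lambda>x. indicator (cball 0 (R + 1)) x *\<^sub>R (B * norm (F x)))"
      by (intro borel_integrable_compact continuous_intros continuous_on_subset [OF F_cont]) auto
    show "AE x in lborel. (\<lambda>n. Q n x *\<^sub>R F x) \<longlonglongrightarrow> d x *\<^sub>R F x"
    proof (intro AE_I2 tendsto_scaleR tendsto_const)
      fix x
      have "((\<lambda>t. (\<phi> (x - t *\<^sub>R e) - \<phi> x) / t) \<longlongrightarrow> - d x) (at 0)"
        using line [of x 0] by (simp add: has_field_derivative_iff)
      from tendsto_minus [OF filterlim_compose [OF this h0]]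
      show "(\<lambda>n. Q n x) \<longlonglongrightarrow> d x"
        by (simp add: Q_def minus_divide_left)
    qed
    show "AE x in lborel. norm (Q n x *\<^sub>R F x) \<le> indicator (cball 0 (R + 1)) x *\<^sub>R (B * norm (F x))" for n
    proof (intro AE_I2)
      fix x
      have "\<bar>Q n x\<bar> \<le> B"
      proof -
        have "\<exists>z>0. z < h n \<and> \<phi> (x - h n *\<^sub>R e) - \<phi> (x - 0 *\<^sub>R e) = (h n - 0) * - d (x - z *\<^sub>R e)"
          by (rule MVT2 [OF h(1)]) (rule line)
        then obtain z where "\<phi> (x - h n *\<^sub>R e) - \<phi> (x - 0 *\<^sub>R e) = (h n - 0) * - d (x - z *\<^sub>R e)"
          by blast
        then have "Q n x = d (x - z *\<^sub>R e)" using h(1) [of n] by (simp add: Q_def field_simps)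
        then show ?thesis using B by simp
      qed
      moreover have "Q n x = 0" if "x \<notin> cball 0 (R + 1)"
      proof -
        have "norm x > R + 1" using that by simp
        moreover have "norm (x - h n *\<^sub>R e) \<ge> norm x - h n"
          using norm_triangle_ineq2 [of x "h n *\<^sub>R e"] h(1) [of n] e1 by simp
        ultimately have "x \<notin> K" "x - h n *\<^sub>R e \<notin> K" using R h(2) [of n] by force+
        then show ?thesis by (simp add: Q_def K(2))
      qed
      ultimately show "norm (Q n x *\<^sub>R F x) \<le> indicator (cball 0 (R + 1)) x *\<^sub>R (B * norm (F x))"
        by (cases "x \<in> cball 0 (R + 1)") (auto intro: mult_right_mono)
    qed
  qed
  moreover have "(\<lambda>n. LINT x|lborel. \<phi> x *\<^sub>R P n x) \<longlonglongrightarrow> (LINT x|lborel. \<phi> x *\<^sub>R G x)"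
  proof (rule integral_dominated_convergence [where w = "\<lambda>x. \<bar>\<phi> x\<bar> * C"])
    show "(\<lambda>x. \<phi> x *\<^sub>R G x) \<in> borel_measurable lborel" by measurable
    show "(\<lambda>x. \<phi> x *\<^sub>R P n x) \<in> borel_measurable lborel" for n unfolding P_def by measurable
    show "integrable lborel (\<lambda>x. \<bar>\<phi> x\<bar> * C)"
      using K by (intro integrable_lborel_compact_support [of _ K] continuous_intros cont) auto
    show "AE x in lborel. (\<lambda>n. \<phi> x *\<^sub>R P n x) \<longlonglongrightarrow> \<phi> x *\<^sub>R G x"
      using G(2) by eventually_elim (simp only: P_def h_def e_def tendsto_scaleR tendsto_const)
    show "AE x in lborel. norm (\<phi> x *\<^sub>R P n x) \<le> \<bar>\<phi> x\<bar> * C" for n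
    proof (intro AE_I2)
      fix x
      have "norm (F (x + h n *\<^sub>R e) - F x) \<le> C * h n"
        using lipschitz_onD [OF F, of "x + h n *\<^sub>R e" x] h(1) [of n] e1 by (simp add: dist_norm)
      moreover have "norm (P n x) = norm (F (x + h n *\<^sub>R e) - F x) / h n"
        using h(1) [of n] by (simp add: P_def divide_inverse mult.commute)
      ultimately have "norm (P n x) \<le> C" using h(1) [of n] by (simp add: divide_le_eq)
      then show "norm (\<phi> x *\<^sub>R P n x) \<le> \<bar>\<phi> x\<bar> * C" by (simp add: mult_left_mono)
    qed
  qed
  then have "(\<lambda>n. LINT x|lborel. Q n x *\<^sub>R F x) \<longlonglongrightarrow> - (LINT x|lborel. \<phi> x *\<^sub>R G x)"
    unfolding parts by (rule tendsto_minus)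
  ultimately show ?thesis unfolding d_def e_def by (rule LIMSEQ_unique)
qed

lemma continuous_imp_integrable_lebesgue_on_compact:
  fixes f :: "real^'m \<Rightarrow> 'b::euclidean_space"
  assumes "continuous_on K f" "compact K"
  shows "integrable (lebesgue_on K) f"
proof -
  have "integrable lborel (\<lambda>x. indicator K x *\<^sub>R f x)" by (rule borel_integrable_compact [OF assms(2,1)])
  then have "integrable lebesgue (\<lambda>x. indicator K x *\<^sub>R f x)"
    by (subst integrable_completion) auto
  then show ?thesis using assms(2) by (subst integrable_restrict_space) (auto simp: borel_compact)
qed

text \<open>Test functions and their derivatives vanish off U, so the integrals over U become
  integrals of a Lipschitz extension over the whole space.\<close>

lemma lipschitz_has_weak_partial:
  fixes f :: "real^'m \<Rightarrow> 'b::euclidean_space"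
  assumes f: "L-lipschitz_on U f" and U: "open U"
  shows "has_weak_partial U i f (dir_deriv (axis i 1) f)"
  unfolding has_weak_partial_def
proof (intro conjI ballI)
  let ?e = "axis i 1 :: real^'m"
  have U_leb: "U \<in> sets lebesgue" using U by (simp add: borel_open)
  have dm: "dir_deriv ?e f \<in> borel_measurable (lebesgue_on U)" by (rule borel_measurable_dir_deriv [OF f U])
  obtain C F where F: "C-lipschitz_on UNIV F" "\<forall>x\<in>U. F x = f x"
    by (rule lipschitz_extension [OF f]) blast
  obtain G where G: "G \<in> borel_measurable borel" "AE x in lborel. G x = dir_deriv ?e F x"
    "AE x in lborel. (\<lambda>n. (F (x + (1 / real (Suc n)) *\<^sub>R ?e) - F x) /\<^sub>R (1 / real (Suc n))) \<longlonglongrightarrow> G x"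
    by (rule lipschitz_dir_deriv_limit [OF F(1), where e = ?e]) blast
  have dG: "AE x in lebesgue. x \<in> U \<longrightarrow> dir_deriv ?e f x = G x"
    using dir_deriv_cong_AE [OF U F, where e = ?e] AE_completion [OF G(2)] by eventually_elim auto
  show "locally_integrable U f"
    unfolding locally_integrable_def
    using continuous_imp_integrable_lebesgue_on_compact continuous_on_subset [OF lipschitz_on_continuous_on [OF f]] by blast
  show "locally_integrable U (dir_deriv ?e f)"
    unfolding locally_integrable_def
  proof (intro allI impI, elim conjE)
    fix K assume K: "compact K" "K \<subseteq> U"
    have K_leb: "K \<in> sets lebesgue" using K(1) by (simp add: borel_compact)
    have "integrable (lebesgue_on K) (\<lambda>x. L)" by (rule continuous_imp_integrable_lebesgue_on_compact [OF continuous_on_const K(1)])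
    then show "integrable (lebesgue_on K) (dir_deriv ?e f)"
    proof (rule Bochner_Integration.integrable_bound)
      show "dir_deriv ?e f \<in> borel_measurable (lebesgue_on K)"
        using dm K(2) by (rule measurable_restrict_mono)
      have "AE x in lebesgue. x \<in> K \<longrightarrow> norm (dir_deriv ?e f x) \<le> norm L"
        using lipschitz_has_dir_deriv_AE [OF f U, where e = ?e]
      proof eventually_elim
        case (elim x)
        then show ?case using norm_directional_derivative_le [OF f U, of x ?e "dir_deriv ?e f x"] K(2) by auto
      qed
      then show "AE x in lebesgue_on K. norm (dir_deriv ?e f x) \<le> norm L"
        using K_leb by (subst AE_restrict_space_iff) auto
    qed
  qed
  fix \<phi> assume \<phi>: "\<phi> \<in> test_functions U"
  obtain K where K: "K \<subseteq> U" "\<And>x. x \<notin> K \<Longrightarrow> \<phi> x = 0"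
      "\<And>x i. x \<notin> K \<Longrightarrow> frechet_derivative \<phi> (at x) (axis i 1) = 0"
    and cont: "continuous_on UNIV \<phi>"
    and dcont: "\<And>i. continuous_on UNIV (\<lambda>x. frechet_derivative \<phi> (at x) (axis i 1))"
    by (rule test_functionE [OF \<phi>]) blast
  have off: "\<phi> x = 0" "frechet_derivative \<phi> (at x) ?e = 0" if "x \<notin> U" for x
    using K that by blast+
  have [measurable]: "F \<in> borel_measurable borel" "\<phi> \<in> borel_measurable borel"
      "(\<lambda>x. frechet_derivative \<phi> (at x) ?e) \<in> borel_measurable borel"
    using lipschitz_on_continuous_on [OF F(1)] cont dcont by (auto intro: borel_measurable_continuous_onI)
  note [measurable] = G(1)
  have "(LINT x|lebesgue_on U. frechet_derivative \<phi> (at x) ?e *\<^sub>R f x)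
      = (LINT x|lebesgue. indicator U x *\<^sub>R (frechet_derivative \<phi> (at x) ?e *\<^sub>R f x))"
    using U_leb by (intro integral_restrict_space) simp
  also have "\<dots> = (LINT x|lebesgue. frechet_derivative \<phi> (at x) ?e *\<^sub>R F x)"
    using F(2) off by (intro Bochner_Integration.integral_cong refl) (auto simp: indicator_def)
  also have "\<dots> = (LINT x|lborel. frechet_derivative \<phi> (at x) ?e *\<^sub>R F x)"
    by (rule integral_completion) measurable
  also have "\<dots> = - (LINT x|lborel. \<phi> x *\<^sub>R G x)"
    by (rule weak_partial_by_difference_quotients [OF F(1) \<phi> G(1,3)])
  also have "(LINT x|lborel. \<phi> x *\<^sub>R G x) = (LINT x|lebesgue. \<phi> x *\<^sub>R G x)"
    by (rule integral_completion [symmetric]) measurable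
  also have "\<dots> = (LINT x|lebesgue. indicator U x *\<^sub>R (\<phi> x *\<^sub>R dir_deriv ?e f x))"
  proof (rule integral_cong_AE)
    show "(\<lambda>x. \<phi> x *\<^sub>R G x) \<in> borel_measurable lebesgue" by (rule measurable_completion) measurable
    have "\<phi> \<in> borel_measurable (lebesgue_on U)"
      by (intro measurable_restrict_space1 measurable_completion) simp
    from borel_measurable_scaleR [OF this dm]
    show "(\<lambda>x. indicator U x *\<^sub>R (\<phi> x *\<^sub>R dir_deriv ?e f x)) \<in> borel_measurable lebesgue"
      using U_leb by (subst (asm) borel_measurable_restrict_space_iff) auto
    show "AE x in lebesgue. \<phi> x *\<^sub>R G x = indicator U x *\<^sub>R (\<phi> x *\<^sub>R dir_deriv ?e f x)"
      using dG by eventually_elim (use off in \<open>auto simp: indicator_def\<close>)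
  qed
  also have "\<dots> = (LINT x|lebesgue_on U. \<phi> x *\<^sub>R dir_deriv ?e f x)"
    using U_leb by (intro integral_restrict_space [symmetric]) simp
  finally show "(LINT x|lebesgue_on U. frechet_derivative \<phi> (at x) ?e *\<^sub>R f x)
      = - (LINT x|lebesgue_on U. \<phi> x *\<^sub>R dir_deriv ?e f x)" .
qed

section \<open>The characteristic map\<close>

lemma almgren_tuple_component:
  fixes \<Delta> :: "complex multiset \<Rightarrow> real^'d::{finite,linorder}^'h"
  assumes \<Delta>: "\<forall>M. size M = CARD('d) \<longrightarrow> \<Delta> M = (1 / sqrt (real CARD('h))) *\<^sub>R (\<chi> l. sorted_form (\<theta> l) M)"
    and M: "normal_matrix (M :: complex^'d::{finite,linorder}^'d::{finite,linorder})"
  shows "sqrt (real CARD('h)) * \<Delta> (eigenvalue_tuple M) $ l $ j = sorted_form (\<theta> l) (eigenvalue_tuple M) $ j"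
  by (simp add: \<Delta> normal_matrix_spectrum(1) [OF M])

lemma almgren_tuple_lipschitz:
  fixes \<Delta> :: "complex multiset \<Rightarrow> real^'d::{finite,linorder}^'h"
  assumes \<Delta>: "\<forall>M. size M = CARD('d) \<longrightarrow> \<Delta> M = (1 / sqrt (real CARD('h))) *\<^sub>R (\<chi> l. sorted_form (\<theta> l) M)"
  obtains C where "C \<ge> 0"
    "\<And>M N :: complex^'d::{finite,linorder}^'d::{finite,linorder}. normal_matrix M \<Longrightarrow> normal_matrix N \<Longrightarrow>
      norm (\<Delta> (eigenvalue_tuple M) - \<Delta> (eigenvalue_tuple N)) \<le> C * norm (M - N)"
proof -
  have "\<forall>l. \<exists>K. 0 < K \<and> (\<forall>X :: complex^'d::{finite,linorder}^'d::{finite,linorder}. norm (herm_part (\<theta> l) X) \<le> norm X * K)"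
    using bounded_linear.pos_bounded [OF bounded_linear_herm_part] by blast
  from choice [OF this] obtain K where K: "\<And>l. 0 < K l"
    "\<And>l (X :: complex^'d::{finite,linorder}^'d::{finite,linorder}). norm (herm_part (\<theta> l) X) \<le> norm X * K l" by blast
  \<comment> \<open>A crude constant: the coordinatewise Weyl bounds are simply added over all d h
    coordinates.\<close>
  define C where "C = (\<Sum>l\<in>UNIV. real CARD('d) * K l)"
  show thesis
  proof (rule that [of C])
    show "C \<ge> 0" unfolding C_def using K(1) by (intro sum_nonneg) (simp add: less_imp_le)
    fix M N :: "complex^'d::{finite,linorder}^'d::{finite,linorder}"
    assume MN: "normal_matrix M" "normal_matrix N"
    let ?X = "\<Delta> (eigenvalue_tuple M) - \<Delta> (eigenvalue_tuple N)"
    have comp: "\<bar>?X $ l $ j\<bar> \<le> K l * norm (M - N)" for l j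
    proof -
      note spec = normal_matrix_spectrum(2) [where \<theta> = "\<theta> l"]
      have "1 \<le> sqrt (real CARD('h))" by (simp add: Suc_leI)
      then have "\<bar>?X $ l $ j\<bar> \<le> sqrt (real CARD('h)) * \<bar>?X $ l $ j\<bar>"
        using mult_right_mono [of 1 "sqrt (real CARD('h))" "\<bar>?X $ l $ j\<bar>"] by simp
      also have "\<dots> = \<bar>sqrt (real CARD('h)) * ?X $ l $ j\<bar>" by (simp add: abs_mult)
      also have "sqrt (real CARD('h)) * ?X $ l $ j
          = sorted_form (\<theta> l) (eigenvalue_tuple M) $ j - sorted_form (\<theta> l) (eigenvalue_tuple N) $ j"
        using almgren_tuple_component [OF \<Delta> MN(1), of l j] almgren_tuple_component [OF \<Delta> MN(2), of l j]
        by (simp add: right_diff_distrib)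
      also have "\<bar>\<dots>\<bar> \<le> norm (herm_part (\<theta> l) M - herm_part (\<theta> l) N)"
        using ordered_eigenvalues_le [OF spec [OF MN(1)] spec [OF MN(2)], where j = j]
          ordered_eigenvalues_le [OF spec [OF MN(2)] spec [OF MN(1)], where j = j]
        by (simp add: abs_le_iff norm_minus_commute)
      also have "\<dots> \<le> K l * norm (M - N)"
        using K(2) [of l "M - N"] by (simp add: linear_diff [OF linear_herm_part] mult.commute)
      finally show ?thesis .
    qed
    have "norm ?X \<le> (\<Sum>l\<in>UNIV. norm (?X $ l))"
      unfolding norm_vec_def [of ?X] by (rule L2_set_le_sum) simp
    also have "\<dots> \<le> (\<Sum>l\<in>UNIV. \<Sum>j\<in>UNIV. \<bar>?X $ l $ j\<bar>)"
      by (intro sum_mono norm_le_l1_cart)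
    also have "\<dots> \<le> (\<Sum>l\<in>UNIV. \<Sum>j\<in>(UNIV :: 'd set). K l * norm (M - N))"
      by (intro sum_mono comp)
    also have "\<dots> = C * norm (M - N)" by (simp add: C_def sum_distrib_right mult.assoc)
    finally show "norm ?X \<le> C * norm (M - N)" .
  qed
qed

text \<open>Scaled by sqrt h, the coordinates of block \<open>l\<close> are all the ordered
  eigenvalues of one Hermitian path. Differentiability of the entire tuple is what the derivative
  formula asks for, even to read off the single index \<open>k\<close>.\<close>

lemma almgren_tuple_derivative:
  fixes \<Delta> :: "complex multiset \<Rightarrow> real^'d::{finite,linorder}^'h"
    and M :: "real \<Rightarrow> complex^'d::{finite,linorder}^'d::{finite,linorder}"
  assumes \<Delta>: "\<forall>M. size M = CARD('d) \<longrightarrow> \<Delta> M = (1 / sqrt (real CARD('h))) *\<^sub>R (\<chi> l. sorted_form (\<theta> l) M)"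
    and normal: "\<forall>\<^sub>F t in nhds 0. normal_matrix (M t)"
    and M': "(M has_vector_derivative M') (at 0)"
    and D: "((\<lambda>t. \<Delta> (eigenvalue_tuple (M t))) has_vector_derivative D) (at 0)"
    and v: "norm v = 1"
      "herm_part (\<theta> l) (M 0) *v v
        = complex_of_real (sqrt (real CARD('h)) * \<Delta> (eigenvalue_tuple (M 0)) $ l $ k) *s v"
  shows "sqrt (real CARD('h)) * D $ l $ k = Re (cinner v (herm_part (\<theta> l) M' *v v))"
proof (rule ordered_eigenvalue_derivative [where h = "\<lambda>t. herm_part (\<theta> l) (M t)"
      and r = "\<lambda>t j. sqrt (real CARD('h)) * \<Delta> (eigenvalue_tuple (M t)) $ l $ j"])
  show "\<forall>\<^sub>F t in nhds 0. ordered_eigenvalues (herm_part (\<theta> l) (M t))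
      (\<lambda>j. sqrt (real CARD('h)) * \<Delta> (eigenvalue_tuple (M t)) $ l $ j)"
    using normal
  proof eventually_elim
    case (elim t)
    show ?case unfolding almgren_tuple_component [OF \<Delta> elim] by (rule normal_matrix_spectrum(2) [OF elim])
  qed
  show "((\<lambda>t. herm_part (\<theta> l) (M t)) has_vector_derivative herm_part (\<theta> l) M') (at 0)"
    by (rule bounded_linear.has_vector_derivative [OF bounded_linear_herm_part M'])
  show "((\<lambda>t. sqrt (real CARD('h)) * \<Delta> (eigenvalue_tuple (M t)) $ l $ j) has_real_derivative
      sqrt (real CARD('h)) * D $ l $ j) (at 0)" for j
  proof -
    have "bounded_linear (\<lambda>z :: real^'d::{finite,linorder}^'h. sqrt (real CARD('h)) * z $ l $ j)"
      by (intro bounded_linear_const_mult bounded_linear_compose [OF bounded_linear_vec_nth] bounded_linear_vec_nth)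
    from bounded_linear.has_vector_derivative [OF this D]
    show ?thesis by (simp only: has_real_derivative_iff_has_vector_derivative)
  qed
qed (use v in auto)

text \<open>The pointwise heart of the continuity proof. Convergence is required only of the values
  and derivatives at t = 0; the neighbourhoods on which the paths are normal may depend on
  n.\<close>

lemma almgren_tuple_derivative_tendsto:
  fixes \<Delta> :: "complex multiset \<Rightarrow> real^'d::{finite,linorder}^'h"
    and M :: "real \<Rightarrow> complex^'d::{finite,linorder}^'d::{finite,linorder}"
    and N :: "nat \<Rightarrow> real \<Rightarrow> complex^'d::{finite,linorder}^'d::{finite,linorder}"
  assumes \<Delta>: "\<forall>M. size M = CARD('d) \<longrightarrow> \<Delta> M = (1 / sqrt (real CARD('h))) *\<^sub>R (\<chi> l. sorted_form (\<theta> l) M)"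
    and M: "\<forall>\<^sub>F t in nhds 0. normal_matrix (M t)" "(M has_vector_derivative M') (at 0)"
      "((\<lambda>t. \<Delta> (eigenvalue_tuple (M t))) has_vector_derivative D) (at 0)"
    and N: "\<And>n. \<forall>\<^sub>F t in nhds 0. normal_matrix (N n t)" "\<And>n. (N n has_vector_derivative N' n) (at 0)"
      "\<And>n. ((\<lambda>t. \<Delta> (eigenvalue_tuple (N n t))) has_vector_derivative E n) (at 0)"
    and lim: "(\<lambda>n. N n 0) \<longlonglongrightarrow> M 0" "N' \<longlonglongrightarrow> M'"
  shows "E \<longlonglongrightarrow> D"
proof (intro vec_tendstoI)
  fix l k
  let ?s = "sqrt (real CARD('h))"
  obtain C where C: "\<And>M N :: complex^'d::{finite,linorder}^'d::{finite,linorder}. normal_matrix M \<Longrightarrow> normal_matrix N \<Longrightarrow>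
      norm (\<Delta> (eigenvalue_tuple M) - \<Delta> (eigenvalue_tuple N)) \<le> C * norm (M - N)"
    by (rule almgren_tuple_lipschitz [OF \<Delta>]) blast+
  have nM: "normal_matrix (M 0)" and nN: "normal_matrix (N n 0)" for n
    using M(1) N(1) eventually_nhds_x_imp_x by blast+
  have herm: "f \<longlonglongrightarrow> a \<Longrightarrow> (\<lambda>n. herm_part (\<theta> l) (f n)) \<longlonglongrightarrow> herm_part (\<theta> l) a"
    for f :: "nat \<Rightarrow> complex^'d::{finite,linorder}^'d::{finite,linorder}" and a
    by (rule bounded_linear.tendsto [OF bounded_linear_herm_part])
  have "(\<lambda>n. \<Delta> (eigenvalue_tuple (N n 0))) \<longlonglongrightarrow> \<Delta> (eigenvalue_tuple (M 0))"
  proof (rule Lim_null_comparison [THEN LIM_zero_cancel])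
    show "\<forall>\<^sub>F n in sequentially. norm (\<Delta> (eigenvalue_tuple (N n 0)) - \<Delta> (eigenvalue_tuple (M 0)))
        \<le> C * norm (N n 0 - M 0)"
      by (intro always_eventually allI C nM nN)
    show "(\<lambda>n. C * norm (N n 0 - M 0)) \<longlonglongrightarrow> 0"
      using lim(1) by (intro tendsto_mult_right_zero tendsto_norm_zero) (simp add: LIM_zero)
  qed
  then have rlim: "(\<lambda>n. ?s * \<Delta> (eigenvalue_tuple (N n 0)) $ l $ k) \<longlonglongrightarrow> ?s * \<Delta> (eigenvalue_tuple (M 0)) $ l $ k"
    by (intro tendsto_mult tendsto_const tendsto_vec_nth)
  have "(\<lambda>n. ?s * E n $ l $ k) \<longlonglongrightarrow> ?s * D $ l $ k"
  proof (rule quadratic_form_on_eigenvectors_tendsto [OF herm [OF lim(1)] herm [OF lim(2)] rlim])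
    fix n
    have "ordered_eigenvalues (herm_part (\<theta> l) (N n 0)) (\<lambda>j. ?s * \<Delta> (eigenvalue_tuple (N n 0)) $ l $ j)"
      unfolding almgren_tuple_component [OF \<Delta> nN] by (rule normal_matrix_spectrum(2) [OF nN])
    then obtain w where w: "orthonormal_family w"
      "\<And>j. herm_part (\<theta> l) (N n 0) *v w j = complex_of_real (?s * \<Delta> (eigenvalue_tuple (N n 0)) $ l $ j) *s w j"
      unfolding ordered_eigenvalues_def by blast
    then show "\<exists>u. norm u = 1 \<and>
        herm_part (\<theta> l) (N n 0) *v u = complex_of_real (?s * \<Delta> (eigenvalue_tuple (N n 0)) $ l $ k) *s u"
      using norm_orthonormal_family by blast
  next
    fix n u
    assume "norm u = 1" "herm_part (\<theta> l) (N n 0) *v u = complex_of_real (?s * \<Delta> (eigenvalue_tuple (N n 0)) $ l $ k) *s u"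
    then show "?s * E n $ l $ k = Re (cinner u (herm_part (\<theta> l) (N' n) *v u))"
      by (rule almgren_tuple_derivative [OF \<Delta> N])
  next
    fix u
    assume "norm u = 1" "herm_part (\<theta> l) (M 0) *v u = complex_of_real (?s * \<Delta> (eigenvalue_tuple (M 0)) $ l $ k) *s u"
    then show "?s * D $ l $ k = Re (cinner u (herm_part (\<theta> l) M' *v u))"
      by (rule almgren_tuple_derivative [OF \<Delta> M])
  qed
  then show "(\<lambda>n. E n $ l $ k) \<longlonglongrightarrow> D $ l $ k"
    by (subst (asm) tendsto_mult_left_iff) auto
qed

section \<open>Estimates in the Lipschitz and Lebesgue norms\<close>

text \<open>A Lipschitz bound on the compact closure keeps both suprema in \<open>C01_norm\<close>
  bounded, so that each dominates its terms.\<close>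

lemma C01_norm_bounds:
  fixes f :: "real^'m \<Rightarrow> complex^'d^'d"
  assumes U: "open U" "bounded U" and f: "L-lipschitz_on (closure U) f"
  shows "x \<in> U \<Longrightarrow> norm (f x) \<le> C01_norm U f"
    and "x \<in> U \<Longrightarrow> y \<in> U \<Longrightarrow> norm (f x - f y) \<le> C01_norm U f * norm (x - y)"
proof -
  let ?P = "{(x, y). x \<in> U \<and> y \<in> U \<and> x \<noteq> y}"
  let ?S = "SUP x\<in>U. norm (f x)"
  let ?T = "SUP (x, y)\<in>?P. norm (f x - f y) / norm (x - y)"
  have cpt: "compact (f ` closure U)"
    using U(2) lipschitz_on_continuous_on [OF f] by (intro compact_continuous_image) auto
  then obtain B where B: "\<And>x. x \<in> closure U \<Longrightarrow> norm (f x) \<le> B"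
    using compact_imp_bounded [OF cpt] by (auto simp: bounded_iff)
  have bddS: "bdd_above ((\<lambda>x. norm (f x)) ` U)"
    using B closure_subset by (intro bdd_aboveI2 [of _ _ B]) blast
  have bddT: "bdd_above ((\<lambda>(x, y). norm (f x - f y) / norm (x - y)) ` ?P)"
  proof (rule bdd_aboveI2)
    fix p assume "p \<in> ?P"
    then obtain x y where p: "p = (x, y)" "x \<in> closure U" "y \<in> closure U" "x \<noteq> y"
      using closure_subset by blast
    then show "(case p of (x, y) \<Rightarrow> norm (f x - f y) / norm (x - y)) \<le> L"
      using lipschitz_onD [OF f, of x y] by (simp add: dist_norm divide_le_eq)
  qed
  have S: "norm (f x) \<le> ?S" if "x \<in> U" for x using bddS that by (rule cSUP_upper [rotated])
  have T: "norm (f x - f y) / norm (x - y) \<le> ?T" if "x \<in> U" "y \<in> U" "x \<noteq> y" for x y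
    using cSUP_upper [OF _ bddT, of "(x, y)"] that by simp
  have S0: "0 \<le> ?S" if "x \<in> U" for x using S [OF that] norm_ge_zero order_trans by blast
  \<comment> \<open>An open set containing \<open>x\<close> contains another point, so the supremum
    over pairs is not taken over the empty set.\<close>
  have T0: "0 \<le> ?T" if x: "x \<in> U" for x
  proof -
    have "\<not> U \<subseteq> {x}" using U(1) x not_open_singleton [of x] by (metis empty_iff subset_singletonD)
    then obtain y where "y \<in> U" "x \<noteq> y" by blast
    then show ?thesis using T [OF x, of y] by (meson divide_nonneg_nonneg norm_ge_zero order_trans)
  qed
  show "norm (f x) \<le> C01_norm U f" if "x \<in> U"
    using S [OF that] T0 [OF that] by (simp add: C01_norm_def)
  show "norm (f x - f y) \<le> C01_norm U f * norm (x - y)" if "x \<in> U" "y \<in> U"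
  proof (cases "x = y")
    case False
    then have "norm (f x - f y) \<le> ?T * norm (x - y)" using T [OF that False] by (simp add: divide_le_eq)
    also have "\<dots> \<le> C01_norm U f * norm (x - y)"
      using S0 [OF that(1)] by (intro mult_right_mono) (auto simp: C01_norm_def)
    finally show ?thesis .
  qed simp
qed


lemma Lq_spaceI_bounded:
  fixes f :: "real^'m \<Rightarrow> 'b::euclidean_space"
  assumes U: "open U" "bounded U" and q: "1 \<le> q"
    and f: "f \<in> borel_measurable (lebesgue_on U)" and bd: "AE x in lebesgue. x \<in> U \<longrightarrow> norm (f x) \<le> B"
  shows "f \<in> Lq_space q U"
proof -
  have U_leb: "U \<in> sets lebesgue" using U by (simp add: borel_open)
  have "emeasure lebesgue U < \<infinity>" using emeasure_bounded_finite [OF U(2)] U(1) by (simp add: borel_open)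
  then have fin: "finite_measure (lebesgue_on U)"
    using U_leb by (intro finite_measureI) (simp add: emeasure_restrict_space space_restrict_space)
  have "integrable (lebesgue_on U) (\<lambda>x. norm (f x) powr q)"
  proof (rule finite_measure.integrable_const_bound [OF fin])
    show "(\<lambda>x. norm (f x) powr q) \<in> borel_measurable (lebesgue_on U)" using f by measurable
    have "AE x in lebesgue. x \<in> U \<longrightarrow> norm (norm (f x) powr q) \<le> B powr q"
      using bd by eventually_elim (use q in \<open>auto intro!: powr_mono2\<close>)
    then show "AE x in lebesgue_on U. norm (norm (f x) powr q) \<le> B powr q"
      using U_leb by (subst AE_restrict_space_iff) auto
  qed
  then show ?thesis using f by (simp add: Lq_space_def)
qed

text \<open>Dominated convergence; a bounded U has finite measure, so the constant
  \<open>B powr q\<close> is an integrable majorant.\<close>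

lemma Lq_norm_tendsto_0:
  fixes g :: "nat \<Rightarrow> real^'m \<Rightarrow> 'b::euclidean_space"
  assumes U: "open U" "bounded U" and q: "1 \<le> q"
    and g: "\<And>n. g n \<in> borel_measurable (lebesgue_on U)"
    and bd: "\<And>n. AE x in lebesgue. x \<in> U \<longrightarrow> norm (g n x) \<le> B"
    and lim: "AE x in lebesgue. x \<in> U \<longrightarrow> (\<lambda>n. g n x) \<longlonglongrightarrow> 0"
  shows "(\<lambda>n. Lq_norm q U (g n)) \<longlonglongrightarrow> 0"
proof -
  have U_leb: "U \<in> sets lebesgue" using U by (simp add: borel_open)
  have "emeasure lebesgue U < \<infinity>" using emeasure_bounded_finite [OF U(2)] U(1) by (simp add: borel_open)
  then have fin: "finite_measure (lebesgue_on U)"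
    using U_leb by (intro finite_measureI) (simp add: emeasure_restrict_space space_restrict_space)
  have "(\<lambda>n. LINT x|lebesgue_on U. norm (g n x) powr q) \<longlonglongrightarrow> (LINT x|lebesgue_on U. 0)"
  proof (rule integral_dominated_convergence [where w = "\<lambda>x. B powr q"])
    show "integrable (lebesgue_on U) (\<lambda>x. B powr q)" using fin by (rule finite_measure.integrable_const)
    show "(\<lambda>x. norm (g n x) powr q) \<in> borel_measurable (lebesgue_on U)" for n using g [of n] by measurable
    have "AE x in lebesgue. x \<in> U \<longrightarrow> (\<lambda>n. norm (g n x) powr q) \<longlonglongrightarrow> 0"
      using lim
    proof eventually_elim
      case (elim x)
      show ?case
      proof
        assume "x \<in> U"
        then have "(\<lambda>n. norm (g n x)) \<longlonglongrightarrow> 0" using elim by (simp add: tendsto_norm_zero)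
        then show "(\<lambda>n. norm (g n x) powr q) \<longlonglongrightarrow> 0"
          by (rule tendsto_zero_powrI [where b = q]) (use q in auto)
      qed
    qed
    then show "AE x in lebesgue_on U. (\<lambda>n. norm (g n x) powr q) \<longlonglongrightarrow> 0"
      using U_leb by (subst AE_restrict_space_iff) auto
    show "AE x in lebesgue_on U. norm (norm (g n x) powr q) \<le> B powr q" for n
    proof -
      have "AE x in lebesgue. x \<in> U \<longrightarrow> norm (norm (g n x) powr q) \<le> B powr q"
        using bd [of n] by eventually_elim (use q in \<open>auto intro!: powr_mono2\<close>)
      then show ?thesis using U_leb by (subst AE_restrict_space_iff) auto
    qed
  qed simp
  then have "(\<lambda>n. LINT x|lebesgue_on U. norm (g n x) powr q) \<longlonglongrightarrow> 0" by simp
  then show ?thesis unfolding Lq_norm_def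
    by (rule tendsto_zero_powrI [where b = "1 / q"]) (use q in auto)
qed

lemma weak_partial_lipschitz_AE:
  fixes f :: "real^'m \<Rightarrow> 'b::euclidean_space"
  assumes f: "L-lipschitz_on U f" and U: "open U"
  shows "AE x in lebesgue. x \<in> U \<longrightarrow> weak_partial U i f x = dir_deriv (axis i 1) f x"
proof (rule has_weak_partial_unique_AE [OF U])
  show *: "has_weak_partial U i f (dir_deriv (axis i 1) f)" by (rule lipschitz_has_weak_partial [OF f U])
  show "has_weak_partial U i f (weak_partial U i f)"
    unfolding weak_partial_def using someI [of "has_weak_partial U i f", OF *] by simp
qed

lemma lipschitz_W1q_space:
  fixes f :: "real^'m \<Rightarrow> 'b::euclidean_space"
  assumes f: "L-lipschitz_on U f" and U: "open U" "bounded U" and q: "1 \<le> q"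
  shows "f \<in> W1q_space q U"
proof -
  have U_leb: "U \<in> sets lebesgue" using U by (simp add: borel_open)
  obtain C F where F: "C-lipschitz_on UNIV F" "\<forall>x\<in>U. F x = f x"
    by (rule lipschitz_extension [OF f]) blast
  have F_cont: "continuous_on UNIV F" by (rule lipschitz_on_continuous_on [OF F(1)])
  have "F \<in> borel_measurable (lebesgue_on U)"
    using F_cont by (intro measurable_restrict_space1 measurable_completion) (simp add: borel_measurable_continuous_onI)
  then have meas: "f \<in> borel_measurable (lebesgue_on U)"
    by (rule borel_measurable_lebesgue_on_cong_AE [OF U_leb]) (use F(2) in auto)
  have "compact (F ` closure U)"
    using U(2) by (intro compact_continuous_image continuous_on_subset [OF F_cont]) auto
  then have "bounded (F ` closure U)" by (rule compact_imp_bounded)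
  then obtain B where B: "\<And>x. x \<in> closure U \<Longrightarrow> norm (F x) \<le> B" by (auto simp: bounded_iff)
  have "norm (f x) \<le> B" if "x \<in> U" for x
    using B [OF subsetD [OF closure_subset that]] F(2) that by simp
  then have "f \<in> Lq_space q U" by (intro Lq_spaceI_bounded [OF U q meas, of B]) auto
  moreover have "dir_deriv (axis i 1) f \<in> Lq_space q U" for i
  proof (rule Lq_spaceI_bounded [where B = L, OF U q borel_measurable_dir_deriv [OF f U(1)]])
    show "AE x in lebesgue. x \<in> U \<longrightarrow> norm (dir_deriv (axis i 1) f x) \<le> L"
      using lipschitz_has_dir_deriv_AE [OF f U(1), where e = "axis i 1"]
    proof eventually_elim
      case (elim x)
      then show ?case
        using norm_directional_derivative_le [OF f U(1), of x "axis i 1" "dir_deriv (axis i 1) f x"] by auto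
    qed
  qed
  ultimately show ?thesis
    unfolding W1q_space_def using lipschitz_has_weak_partial [OF f U(1)] by blast
qed

lemma C01_normal_line:
  assumes U: "open U" "x \<in> U" and A: "A \<in> C01_normal U"
  shows "\<forall>\<^sub>F t in nhds 0. normal_matrix (A (x + t *\<^sub>R e))"
proof -
  have "open ((\<lambda>t. x + t *\<^sub>R e) -` U)" by (intro open_vimage U continuous_intros)
  then have "\<forall>\<^sub>F t in nhds 0. t \<in> (\<lambda>t. x + t *\<^sub>R e) -` U"
    by (rule eventually_nhds_in_open) (use U in simp)
  then show ?thesis
    by eventually_elim (use A closure_subset in \<open>auto simp: C01_normal_def\<close>)
qed


lemma tendsto_if_norm_diff_le:
  fixes f :: "nat \<Rightarrow> 'a::real_normed_vector"
  assumes "\<And>n. norm (f n - l) \<le> s n" "s \<longlonglongrightarrow> 0"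
  shows "f \<longlonglongrightarrow> l"
proof (rule LIM_zero_cancel)
  show "(\<lambda>n. f n - l) \<longlonglongrightarrow> 0"
    by (rule Lim_null_comparison [OF always_eventually [OF allI [OF assms(1)]] assms(2)])
qed

theorem theorem1p11:
  fixes U :: "(real^'m) set"
    and \<Delta> :: "complex multiset \<Rightarrow> real^'d::{finite,linorder}^'h"
    and q :: real
  assumes "open U" and "bounded U"
    and "almgren_embedding \<Delta>"
    and "1 \<le> q"
  shows "(\<forall>A :: real^'m \<Rightarrow> complex^'d::{finite,linorder}^'d::{finite,linorder}. A \<in> C01_normal U \<longrightarrow>
            eigenvalue_tuple \<circ> A \<in> W1q_tuples \<Delta> q U) \<and>
         (\<forall>A :: real^'m \<Rightarrow> complex^'d::{finite,linorder}^'d::{finite,linorder}. A \<in> C01_normal U \<longrightarrow>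
            (\<forall>\<epsilon>>0. \<exists>\<delta>>0. \<forall>B\<in>C01_normal U. C01_norm U (\<lambda>x. A x - B x) < \<delta> \<longrightarrow>
               W1q_dist \<Delta> q U (eigenvalue_tuple \<circ> A) (eigenvalue_tuple \<circ> B) < \<epsilon>))"
proof -
  note U = \<open>open U\<close> \<open>bounded U\<close>
  note q = \<open>1 \<le> q\<close>
  obtain \<theta> :: "'h \<Rightarrow> complex" where \<Delta>: "\<forall>M. size M = CARD('d) \<longrightarrow>
      \<Delta> M = (1 / sqrt (real CARD('h))) *\<^sub>R (\<chi> l. sorted_form (\<theta> l) M)"
    using assms(3) unfolding almgren_embedding_def by blast
  obtain C where C: "C \<ge> 0"
    "\<And>M N :: complex^'d::{finite,linorder}^'d::{finite,linorder}. normal_matrix M \<Longrightarrow> normal_matrix N \<Longrightarrow>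
      norm (\<Delta> (eigenvalue_tuple M) - \<Delta> (eigenvalue_tuple N)) \<le> C * norm (M - N)"
    by (rule almgren_tuple_lipschitz [OF \<Delta>]) blast+
  have normal: "normal_matrix (A x)" if "A \<in> C01_normal U" "x \<in> U"
    for A :: "real^'m \<Rightarrow> complex^'d::{finite,linorder}^'d::{finite,linorder}" and x
    using that closure_subset by (auto simp: C01_normal_def)
  have lip: "(C * L)-lipschitz_on U (\<lambda>x. \<Delta> (eigenvalue_tuple (A x)))"
    if A: "A \<in> C01_normal U" and L: "L-lipschitz_on U A"
    for A :: "real^'m \<Rightarrow> complex^'d::{finite,linorder}^'d::{finite,linorder}" and L
  proof (rule lipschitz_onI)
    fix x y assume xy: "x \<in> U" "y \<in> U"
    have "dist (\<Delta> (eigenvalue_tuple (A x))) (\<Delta> (eigenvalue_tuple (A y))) \<le> C * norm (A x - A y)"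
      unfolding dist_norm by (intro C normal A xy)
    also have "\<dots> \<le> C * (L * dist x y)"
      using lipschitz_onD [OF L xy] C(1) by (intro mult_left_mono) (auto simp: dist_norm)
    finally show "dist (\<Delta> (eigenvalue_tuple (A x))) (\<Delta> (eigenvalue_tuple (A y))) \<le> C * L * dist x y"
      by (simp add: mult.assoc)
  qed (use C(1) lipschitz_on_nonneg [OF L] in simp)
  show ?thesis
  proof (intro conjI allI impI)
    fix A :: "real^'m \<Rightarrow> complex^'d::{finite,linorder}^'d::{finite,linorder}"
    assume A: "A \<in> C01_normal U"
    obtain L where "L-lipschitz_on (closure U) A" using A by (auto simp: C01_normal_def)
    then have "L-lipschitz_on U A" by (rule lipschitz_on_subset [OF _ closure_subset])
    from lipschitz_W1q_space [OF lip [OF A this] U q]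
    show "eigenvalue_tuple \<circ> A \<in> W1q_tuples \<Delta> q U"
      using normal_matrix_spectrum(1) [OF normal [OF A]] by (simp add: W1q_tuples_def o_def)
  next
    fix A :: "real^'m \<Rightarrow> complex^'d::{finite,linorder}^'d::{finite,linorder}" and \<epsilon> :: real
    assume A: "A \<in> C01_normal U" and "\<epsilon> > 0"
    obtain L where Lc: "L-lipschitz_on (closure U) A" using A by (auto simp: C01_normal_def)
    then have L: "L-lipschitz_on U A" by (rule lipschitz_on_subset [OF _ closure_subset])
    show "\<exists>\<delta>>0. \<forall>B\<in>C01_normal U. C01_norm U (\<lambda>x. A x - B x) < \<delta> \<longrightarrow>
        W1q_dist \<Delta> q U (eigenvalue_tuple \<circ> A) (eigenvalue_tuple \<circ> B) < \<epsilon>"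
    \<comment> \<open>Failure of continuity yields a sequence \<open>B n\<close> converging to
      \<open>A\<close> in the Lipschitz norm with distances at least \<epsilon>; only countably many
      families then enter the almost everywhere arguments.\<close>
    proof (rule ccontr)
      assume neg: "\<not> ?thesis"
      have "\<forall>n. \<exists>B. B \<in> C01_normal U \<and> C01_norm U (\<lambda>x. A x - B x) < 1 / real (Suc n) \<and>
          \<epsilon> \<le> W1q_dist \<Delta> q U (eigenvalue_tuple \<circ> A) (eigenvalue_tuple \<circ> B)"
      proof
        fix n
        have "0 < 1 / real (Suc n)" by simp
        with neg show "\<exists>B. B \<in> C01_normal U \<and> C01_norm U (\<lambda>x. A x - B x) < 1 / real (Suc n) \<and>
            \<epsilon> \<le> W1q_dist \<Delta> q U (eigenvalue_tuple \<circ> A) (eigenvalue_tuple \<circ> B)"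
          unfolding not_ex not_all by (meson not_less)
      qed
      from choice [OF this] obtain B where B: "\<And>n. B n \<in> C01_normal U"
        "\<And>n. C01_norm U (\<lambda>x. A x - B n x) < 1 / real (Suc n)"
        "\<And>n. \<epsilon> \<le> W1q_dist \<Delta> q U (eigenvalue_tuple \<circ> A) (eigenvalue_tuple \<circ> B n)" by blast
      define s where "s = (\<lambda>n. 1 / real (Suc n))"
      have s: "0 < s n" "s n \<le> 1" for n by (auto simp: s_def)
      have s0: "s \<longlonglongrightarrow> 0" unfolding s_def by (rule LIMSEQ_Suc [OF lim_1_over_n])
      have diff_bounds: "x \<in> U \<Longrightarrow> norm (A x - B n x) \<le> s n"
          "(s n)-lipschitz_on U (\<lambda>x. A x - B n x)" for n x
      proof -
        obtain K where "K-lipschitz_on (closure U) (B n)" using B(1) [of n] by (auto simp: C01_normal_def)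
        from lipschitz_on_diff [OF Lc this] have AB: "(L + K)-lipschitz_on (closure U) (\<lambda>x. A x - B n x)" .
        note bounds = C01_norm_bounds [OF U AB]
        show "norm (A x - B n x) \<le> s n" if "x \<in> U"
          using bounds(1) [OF that] B(2) [of n] by (simp add: s_def)
        show "(s n)-lipschitz_on U (\<lambda>x. A x - B n x)"
        proof (rule lipschitz_onI)
          fix x y assume "x \<in> U" "y \<in> U"
          then have "dist (A x - B n x) (A y - B n y) \<le> C01_norm U (\<lambda>x. A x - B n x) * dist x y"
            using bounds(2) by (simp add: dist_norm)
          also have "\<dots> \<le> s n * dist x y"
            using B(2) [of n] by (intro mult_right_mono) (auto simp: s_def)
          finally show "dist (A x - B n x) (A y - B n y) \<le> s n * dist x y" .
        qed (use s(1) [of n] in simp)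
      qed
      \<comment> \<open>\<open>B n\<close> is \<open>A\<close> minus a map with constant
        \<open>s n\<close> \<le> 1, so one Lipschitz constant serves all n. This is where the bound
        \<open>T\<close>, independent of n, comes from.\<close>
      have LB: "(L + 1)-lipschitz_on U (B n)" for n
      proof -
        have "(L + s n)-lipschitz_on U (\<lambda>x. A x - (A x - B n x))"
          by (rule lipschitz_on_diff [OF L diff_bounds(2)])
        then show ?thesis using s(2) [of n] by (auto intro: lipschitz_on_le)
      qed
      define uA where "uA = (\<lambda>x. \<Delta> (eigenvalue_tuple (A x)))"
      define uB where "uB = (\<lambda>n x. \<Delta> (eigenvalue_tuple (B n x)))"
      define f where "f = (\<lambda>n x. uA x - uB n x)"
      define T where "T = C * L + C * (L + 1)"
      have uA: "(C * L)-lipschitz_on U uA" unfolding uA_def by (rule lip [OF A L])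
      have uB: "(C * (L + 1))-lipschitz_on U (uB n)" for n unfolding uB_def by (rule lip [OF B(1) LB])
      have f: "T-lipschitz_on U (f n)" for n
        unfolding f_def T_def by (rule lipschitz_on_diff [OF uA uB])
      have f_small: "norm (f n x) \<le> C * s n" if "x \<in> U" for n x
      proof -
        have "norm (f n x) \<le> C * norm (A x - B n x)"
          unfolding f_def uA_def uB_def by (intro C normal A B that)
        also have "\<dots> \<le> C * s n" by (intro mult_left_mono diff_bounds that C)
        finally show ?thesis .
      qed
      have Lq_f: "(\<lambda>n. Lq_norm q U (f n)) \<longlonglongrightarrow> 0"
      proof (rule Lq_norm_tendsto_0 [OF U q, where B = C])
        show "f n \<in> borel_measurable (lebesgue_on U)" for n
          using lipschitz_W1q_space [OF f U q] by (auto simp: W1q_space_def Lq_space_def)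
        show "AE x in lebesgue. x \<in> U \<longrightarrow> norm (f n x) \<le> C" for n
          using f_small s(2) [of n] C(1) by (intro AE_I2) (meson mult_left_le order_trans)
        have "(\<lambda>n. C * s n) \<longlonglongrightarrow> 0" by (rule tendsto_mult_right_zero [OF s0])
        then have "(\<lambda>n. f n x) \<longlonglongrightarrow> 0" if "x \<in> U" for x
          by (rule Lim_null_comparison [rotated]) (intro always_eventually allI f_small that)
        then show "AE x in lebesgue. x \<in> U \<longrightarrow> (\<lambda>n. f n x) \<longlonglongrightarrow> 0" by simp
      qed
      have Lq_df: "(\<lambda>n. Lq_norm q U (weak_partial U i (f n))) \<longlonglongrightarrow> 0" for i
      proof (rule Lq_norm_tendsto_0 [OF U q, where B = T])
        let ?e = "axis i 1 :: real^'m"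
        have U_leb: "U \<in> sets lebesgue" using U by (simp add: borel_open)
        show "weak_partial U i (f n) \<in> borel_measurable (lebesgue_on U)" for n
          by (rule borel_measurable_lebesgue_on_cong_AE
              [OF U_leb borel_measurable_dir_deriv [OF f U(1)] weak_partial_lipschitz_AE [OF f U(1)]])
        show "AE x in lebesgue. x \<in> U \<longrightarrow> norm (weak_partial U i (f n) x) \<le> T" for n
          using weak_partial_lipschitz_AE [OF f [of n] U(1), where i = i]
            lipschitz_has_dir_deriv_AE [OF f [of n] U(1), where e = ?e]
        proof eventually_elim
          case (elim x)
          then show ?case
            using norm_directional_derivative_le [OF f [of n] U(1), of x ?e "dir_deriv ?e (f n) x"] by auto
        qed
        have "AE x in lebesgue. \<forall>n. (x \<in> U \<longrightarrow> weak_partial U i (f n) x = dir_deriv ?e (f n) x)"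
          using weak_partial_lipschitz_AE [OF f U(1)] by (subst AE_all_countable) blast
        moreover have "AE x in lebesgue. x \<in> U \<longrightarrow> ((\<lambda>t. A (x + t *\<^sub>R ?e)) has_vector_derivative dir_deriv ?e A x) (at 0)"
          by (rule lipschitz_has_dir_deriv_AE [OF L U(1)])
        moreover have "AE x in lebesgue. x \<in> U \<longrightarrow> ((\<lambda>t. uA (x + t *\<^sub>R ?e)) has_vector_derivative dir_deriv ?e uA x) (at 0)"
          by (rule lipschitz_has_dir_deriv_AE [OF uA U(1)])
        moreover have "AE x in lebesgue. \<forall>n. x \<in> U \<longrightarrow> ((\<lambda>t. B n (x + t *\<^sub>R ?e)) has_vector_derivative dir_deriv ?e (B n) x) (at 0)"
          using lipschitz_has_dir_deriv_AE [OF LB U(1)] by (subst AE_all_countable) blast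
        moreover have "AE x in lebesgue. \<forall>n. x \<in> U \<longrightarrow> ((\<lambda>t. uB n (x + t *\<^sub>R ?e)) has_vector_derivative dir_deriv ?e (uB n) x) (at 0)"
          using lipschitz_has_dir_deriv_AE [OF uB U(1)] by (subst AE_all_countable) blast
        ultimately show "AE x in lebesgue. x \<in> U \<longrightarrow> (\<lambda>n. weak_partial U i (f n) x) \<longlonglongrightarrow> 0"
        proof eventually_elim
          case (elim x)
          show ?case
          proof
            assume x: "x \<in> U"
            note dA = elim(2) [rule_format, OF x] and duA = elim(3) [rule_format, OF x]
              and dB = elim(4) [rule_format, OF x] and duB = elim(5) [rule_format, OF x]
            have df: "dir_deriv ?e (f n) x = dir_deriv ?e uA x - dir_deriv ?e (uB n) x" for n
              unfolding dir_deriv_def [of ?e "f n"] unfolding f_def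
              by (intro vector_derivative_at has_vector_derivative_diff duA duB)
            have "(\<lambda>n. B n x) \<longlonglongrightarrow> A x"
            proof (rule tendsto_if_norm_diff_le [OF _ s0])
              show "norm (B n x - A x) \<le> s n" for n
                using diff_bounds(1) [OF x, of n] by (simp add: norm_minus_commute)
            qed
            \<comment> \<open>The direction is a unit vector and \<open>A - B n\<close> has
              Lipschitz constant \<open>s n\<close>, so the matrix derivatives converge at every
              point where they all exist.\<close>
            moreover have "norm (dir_deriv ?e (B n) x - dir_deriv ?e A x) \<le> s n" for n
              using norm_directional_derivative_le [OF diff_bounds(2) U(1) x has_vector_derivative_diff [OF dA dB]]
              by (simp add: norm_minus_commute)
            then have "(\<lambda>n. dir_deriv ?e (B n) x) \<longlonglongrightarrow> dir_deriv ?e A x"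
              by (rule tendsto_if_norm_diff_le [OF _ s0])
            ultimately have "(\<lambda>n. dir_deriv ?e (uB n) x) \<longlonglongrightarrow> dir_deriv ?e uA x"
              using duA duB unfolding uA_def uB_def
              by (intro almgren_tuple_derivative_tendsto [OF \<Delta> C01_normal_line [OF U(1) x A] dA _
                    C01_normal_line [OF U(1) x B(1)] dB]) auto
            from tendsto_diff [OF tendsto_const this, of "dir_deriv ?e uA x"]
            show "(\<lambda>n. weak_partial U i (f n) x) \<longlonglongrightarrow> 0"
              using elim(1) x by (simp add: df)
          qed
        qed
      qed
      have "(\<lambda>n. W1q_norm q U (f n)) \<longlonglongrightarrow> 0 + (\<Sum>i\<in>(UNIV :: 'm set). 0)"
        unfolding W1q_norm_def by (intro tendsto_add tendsto_sum Lq_f Lq_df)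
      moreover have "W1q_norm q U (f n) = W1q_dist \<Delta> q U (eigenvalue_tuple \<circ> A) (eigenvalue_tuple \<circ> B n)" for n
        by (simp add: W1q_dist_def f_def uA_def uB_def)
      ultimately have "(\<lambda>n. W1q_dist \<Delta> q U (eigenvalue_tuple \<circ> A) (eigenvalue_tuple \<circ> B n)) \<longlonglongrightarrow> 0" by simp
      then have "\<epsilon> \<le> 0" by (rule LIMSEQ_le_const) (use B(3) in auto)
      then show False using \<open>\<epsilon> > 0\<close> by simp
    qed
  qed
qed

end
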